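(* Let $\widetilde{\mathcal D}$ be tangent to a codimension-one foliation $\mathcal F$ of $M^{n+1}$, and let there exist global biregular foliated coordinates $(x_0,x_1,\dots,x_n)$ with the leaves of $\mathcal F$ given by $\{x_0=c\}$. Let $\hat C<0$ be a constant and let $y=\pm\frac1n\sqrt{|\hat C|}$. Then there exist metrics $g$ on $M$, for which these coordinates are orthogonal, of the form $g=g_{00}\,dx_0^2+\sum_{i=1}^ng_{ii}\,dx_i^2$ with $$g_{ii}=\epsilon_i\,f_i(x_1,\dots,x_n)\,e^{-2\int\sqrt{|g_{00}|}\,y\,dx_0},\quad i=1,\dots,n,$$ and with $\hat C=(\operatorname{div}\tilde H)(\Omega,g)$, that are critical for the action $J_\Omega(g)=\int_\Omega\mathrm S_{\rm mix}(g)\,d\mathrm{vol}_g$ with respect to both $\bar g^\perp$- and $\bar g^\top$-variations, for all open relatively compact $\Omega\subset M$.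
   Context: Biregular foliated coordinates: the leaves are the level sets $\{x_0=c\}$ and the curves orthogonal to the leaves are $\{x_i=c_i,\ i>0\}$; orthogonal means $g_{\mu\nu}=0$ for $\mu\ne\nu$. Here $f_i$ are positive smooth functions, $\epsilon_i\in\{-1,1\}$, $g_{00}$ is a smooth function of constant sign on $M$, and $\int\cdot\,dx_0$ is an antiderivative in $x_0$ with $x_1,\dots,x_n$ fixed. $N$ is the unit normal of $\mathcal F$, $\epsilon_N=g(N,N)$, $\tilde H=\epsilon_N\nabla_NN$, and $f(\Omega,g)=\mathrm{Vol}(\Omega,g)^{-1}\int_\Omega f\,d\mathrm{vol}_g$. For a pseudo-Riemannian metric non-degenerate on $\widetilde{\mathcal D}$, $\mathcal D$ is the orthogonal complement of $\widetilde{\mathcal D}$ for that metric (rank $p=1$), and $\mathrm S_{\rm mix}$ is the sum of sectional curvatures $\sum_{a}K(E_a\wedge N)$, $\{E_a\}$ a local orthonormal frame of $\widetilde{\mathcal D}$, $N$ a unit normal (so $\mathrm S_{\rm mix}=\epsilon_N\mathrm{Ric}(N,N)$). Variations are smooth families $g_t$ ($|t|<\varepsilon$, $g_0=g$) of pseudo-Riemannian metrics non-degenerate on $\widetilde{\mathcal D}$. A $g^\perp$-variation satisfies $g_t(X,Y)=g(X,Y)$ for $X,Y\in\widetilde{\mathcal D}$; a $g^\top$-variation satisfies $g_t(X,Y)=g(X,Y)$ for $X,Y\in\mathcal D$ and keeps $\widetilde{\mathcal D},\mathcal D$ orthogonal. Given a $g^\perp$-variation $g_t$ with support contained in $\Omega$,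 let $\mathcal D(t)$ be the $g_t$-orthogonal complement of $\widetilde{\mathcal D}$; the associated $\bar g^\perp$-variation is $\bar g_t=\phi^\perp_t\,g_t|_{\mathcal D(t)\times\mathcal D(t)}+g|_{\widetilde{\mathcal D}\times\widetilde{\mathcal D}}$ (with respect to $TM=\widetilde{\mathcal D}\oplus\mathcal D(t)$), $\phi_t^\perp=(\mathrm{Vol}(\Omega,g_t)/\mathrm{Vol}(\Omega,g))^{-2/p}$ with $p=1$. Given a $g^\top$-variation $g_t$ with support contained in $\Omega$, the associated $\bar g^\top$-variation is $\bar g_t=g|_{\mathcal D\times\mathcal D}+\phi^\top_t\,g_t|_{\widetilde{\mathcal D}\times\widetilde{\mathcal D}}$, $\phi_t^\top=(\mathrm{Vol}(\Omega,g_t)/\mathrm{Vol}(\Omega,g))^{-2/n}$. $g$ is critical with respect to a class of variations if $\frac{d}{dt}J_\Omega(\bar g_t)|_{t=0}=0$ for all of them. *)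

theory Defs
  imports "HOL-Analysis.Analysis"
begin

text \<open>
  A manifold of dimension n+1 with a global chart is identified with the image U of the chart, an
  open subset of \<open>real ^ 'n option\<close>, where n = \<open>CARD('n)\<close>. The index \<open>None\<close> stands for the coordinate
  x_0 and \<open>Some i\<close> for the coordinates x_1, ..., x_n. Tangent spaces are identified with
  \<open>real ^ 'n option\<close> through the coordinate frame, and (0,2)-tensor fields are functions
  of a point and two tangent vectors. Values outside of U are irrelevant.
\<close>

type_synonym 'n point = "real ^ 'n option"
type_synonym 'n tensor2 = "'n point \<Rightarrow> 'n point \<Rightarrow> 'n point \<Rightarrow> real"
type_synonym 'n vfield = "'n point \<Rightarrow> 'n point"


subsection \<open>Smooth functions on open sets\<close>

primrec Ck_on :: "nat \<Rightarrow> 'a::real_normed_vector set \<Rightarrow> ('a \<Rightarrow> real) \<Rightarrow> bool" where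
  "Ck_on 0 S f \<longleftrightarrow> continuous_on S f"
| "Ck_on (Suc k) S f \<longleftrightarrow>
     (\<forall>x\<in>S. f differentiable (at x)) \<and>
     (\<forall>v. Ck_on k S (\<lambda>x. frechet_derivative f (at x) v))"

definition smooth_on :: "'a::real_normed_vector set \<Rightarrow> ('a \<Rightarrow> real) \<Rightarrow> bool" where
  "smooth_on S f \<longleftrightarrow> (\<forall>k. Ck_on k S f)"


subsection \<open>Biregular foliated coordinates\<close>

text \<open>
  The leaves are the slices x_0 = c of U, the curves transverse to them are the slices
  on which x_1, ..., x_n are constant; leaves and curves are connected.
\<close>

definition biregular_domain :: "'n::finite point set \<Rightarrow> bool" where
  "biregular_domain U \<longleftrightarrow>
     open U \<and> U \<noteq> {} \<and> connected U \<and>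
     (\<forall>c. connected {x \<in> U. x $ None = c}) \<and>
     (\<forall>c. connected {x \<in> U. \<forall>i. x $ Some i = c i})"

definition leaf_coords :: "'n::finite point \<Rightarrow> real ^ 'n" where
  "leaf_coords x = (\<chi> i. x $ Some i)"

text \<open>The tangent space of the leaves, i.e. the distribution usually written D-tilde.\<close>

definition leaf_tangent :: "'n::finite point set" where
  "leaf_tangent = {v. v $ None = 0}"

definition antiderivative_x0 ::
  "'n::finite point set \<Rightarrow> ('n point \<Rightarrow> real) \<Rightarrow> ('n point \<Rightarrow> real) \<Rightarrow> bool" where
  "antiderivative_x0 U h F \<longleftrightarrow>
     (\<forall>x\<in>U. ((\<lambda>s. F (x + s *\<^sub>R axis None 1)) has_real_derivative h x) (at 0))"


subsection \<open>Pseudo-Riemannian metrics\<close>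

definition nondegenerate_on :: "'a::real_vector set \<Rightarrow> ('a \<Rightarrow> 'a \<Rightarrow> real) \<Rightarrow> bool" where
  "nondegenerate_on V b \<longleftrightarrow> (\<forall>v\<in>V. v \<noteq> 0 \<longrightarrow> (\<exists>w\<in>V. b v w \<noteq> 0))"

text \<open>Constancy of the signature is automatic on connected U, which is the only case used.\<close>

definition pseudo_metric :: "'n::finite point set \<Rightarrow> 'n tensor2 \<Rightarrow> bool" where
  "pseudo_metric U g \<longleftrightarrow>
     (\<forall>x\<in>U. bilinear (g x) \<and> (\<forall>v w. g x v w = g x w v) \<and> nondegenerate_on UNIV (g x)) \<and>
     (\<forall>v w. smooth_on U (\<lambda>x. g x v w))"

definition adapted_metric :: "'n::finite point set \<Rightarrow> 'n tensor2 \<Rightarrow> bool" where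
  "adapted_metric U g \<longleftrightarrow>
     pseudo_metric U g \<and> (\<forall>x\<in>U. nondegenerate_on leaf_tangent (g x))"

definition orthogonal_coordinates :: "'n::finite point set \<Rightarrow> 'n tensor2 \<Rightarrow> bool" where
  "orthogonal_coordinates U g \<longleftrightarrow>
     (\<forall>x\<in>U. \<forall>\<mu> \<nu>. \<mu> \<noteq> \<nu> \<longrightarrow> g x (axis \<mu> 1) (axis \<nu> 1) = 0)"

definition gram :: "'n::finite tensor2 \<Rightarrow> 'n point \<Rightarrow> real ^ 'n option ^ 'n option" where
  "gram g x = (\<chi> i j. g x (axis i 1) (axis j 1))"

definition pderiv :: "('n::finite point \<Rightarrow> real) \<Rightarrow> 'n option \<Rightarrow> 'n point \<Rightarrow> real" where
  "pderiv h i x = frechet_derivative h (at x) (axis i 1)"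

definition christoffel ::
  "'n::finite tensor2 \<Rightarrow> 'n point \<Rightarrow> 'n option \<Rightarrow> 'n option \<Rightarrow> 'n option \<Rightarrow> real" where
  "christoffel g x k i j =
     (\<Sum>l\<in>UNIV. matrix_inv (gram g x) $ k $ l *
        (pderiv (\<lambda>z. gram g z $ j $ l) i x + pderiv (\<lambda>z. gram g z $ i $ l) j x
         - pderiv (\<lambda>z. gram g z $ i $ j) l x)) / 2"

text \<open>The Levi-Civita covariant derivative of Y in the direction of X.\<close>

definition nabla :: "'n::finite tensor2 \<Rightarrow> 'n vfield \<Rightarrow> 'n vfield \<Rightarrow> 'n vfield" where
  "nabla g X Y x = (\<chi> k. frechet_derivative (\<lambda>z. Y z $ k) (at x) (X x)
       + (\<Sum>i\<in>UNIV. \<Sum>j\<in>UNIV. christoffel g x k i j * X x $ i * Y x $ j))"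

definition divergence :: "'n::finite tensor2 \<Rightarrow> 'n vfield \<Rightarrow> 'n point \<Rightarrow> real" where
  "divergence g X x = (\<Sum>k\<in>UNIV. nabla g (\<lambda>_. axis k 1) X x $ k)"

text \<open>
  R(u,v)w, evaluated on the extensions of u, v, w with constant coefficients in the
  coordinate frame; these commute, so the Lie bracket term of R vanishes.
\<close>

definition curvature ::
  "'n::finite tensor2 \<Rightarrow> 'n point \<Rightarrow> 'n point \<Rightarrow> 'n point \<Rightarrow> 'n point \<Rightarrow> 'n point" where
  "curvature g x u v w =
     nabla g (\<lambda>_. u) (nabla g (\<lambda>_. v) (\<lambda>_. w)) x - nabla g (\<lambda>_. v) (nabla g (\<lambda>_. u) (\<lambda>_. w)) x"

definition sectional ::
  "'n::finite tensor2 \<Rightarrow> 'n point \<Rightarrow> 'n point \<Rightarrow> 'n point \<Rightarrow> real" where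
  "sectional g x u v = g x (curvature g x u v v) u / (g x u u * g x v v - (g x u v)\<^sup>2)"


subsection \<open>Volume\<close>

text \<open>The integral of h over \<open>\<Omega>\<close> with respect to the volume form of g.\<close>

definition integral_vol :: "'n::finite tensor2 \<Rightarrow> 'n point set \<Rightarrow> ('n point \<Rightarrow> real) \<Rightarrow> real" where
  "integral_vol g \<Omega> h = (LINT x:\<Omega>|lborel. h x * sqrt \<bar>det (gram g x)\<bar>)"

definition Vol :: "'n::finite point set \<Rightarrow> 'n tensor2 \<Rightarrow> real" where
  "Vol \<Omega> g = integral_vol g \<Omega> (\<lambda>_. 1)"

definition mean_value :: "('n::finite point \<Rightarrow> real) \<Rightarrow> 'n point set \<Rightarrow> 'n tensor2 \<Rightarrow> real" where
  "mean_value h \<Omega> g = integral_vol g \<Omega> h / Vol \<Omega> g"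

text \<open>Nonempty, since mean values over \<open>\<Omega>\<close> are taken.\<close>

definition open_rel_compact :: "'n::finite point set \<Rightarrow> 'n point set \<Rightarrow> bool" where
  "open_rel_compact U \<Omega> \<longleftrightarrow> open \<Omega> \<and> \<Omega> \<noteq> {} \<and> compact (closure \<Omega>) \<and> closure \<Omega> \<subseteq> U"


subsection \<open>Extrinsic geometry of the foliation and the mixed scalar curvature\<close>

definition normal_space :: "'n::finite tensor2 \<Rightarrow> 'n point \<Rightarrow> 'n point set" where
  "normal_space g x = {v. \<forall>w\<in>leaf_tangent. g x v w = 0}"

text \<open>
  The unit normal is oriented by x_0. None of the quantities below depends on this choice.
\<close>

definition unit_normal :: "'n::finite tensor2 \<Rightarrow> 'n vfield" where
  "unit_normal g x = (THE v. v \<in> normal_space g x \<and> \<bar>g x v v\<bar> = 1 \<and> v $ None > 0)"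

definition normal_sign :: "'n::finite tensor2 \<Rightarrow> 'n point \<Rightarrow> real" where
  "normal_sign g x = g x (unit_normal g x) (unit_normal g x)"

definition H_tilde :: "'n::finite tensor2 \<Rightarrow> 'n vfield" where
  "H_tilde g x = normal_sign g x *\<^sub>R nabla g (unit_normal g) (unit_normal g) x"

definition leaf_frame :: "'n::finite tensor2 \<Rightarrow> 'n point \<Rightarrow> ('n \<Rightarrow> 'n point) \<Rightarrow> bool" where
  "leaf_frame g x E \<longleftrightarrow>
     (\<forall>a. E a \<in> leaf_tangent \<and> \<bar>g x (E a) (E a)\<bar> = 1) \<and>
     (\<forall>a b. a \<noteq> b \<longrightarrow> g x (E a) (E b) = 0)"

text \<open>The sum does not depend on the orthonormal frame that is chosen.\<close>

definition S_mix :: "'n::finite tensor2 \<Rightarrow> 'n point \<Rightarrow> real" where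
  "S_mix g x =
     (let E = SOME E. leaf_frame g x E in \<Sum>a\<in>UNIV. sectional g x (E a) (unit_normal g x))"

definition J :: "'n::finite point set \<Rightarrow> 'n tensor2 \<Rightarrow> real" where
  "J \<Omega> g = integral_vol g \<Omega> (S_mix g)"


subsection \<open>Variations and critical metrics\<close>

definition variation ::
  "'n::finite point set \<Rightarrow> 'n tensor2 \<Rightarrow> real \<Rightarrow> (real \<Rightarrow> 'n tensor2) \<Rightarrow> bool" where
  "variation U g \<epsilon> gt \<longleftrightarrow>
     \<epsilon> > 0 \<and>
     (\<forall>t. \<bar>t\<bar> < \<epsilon> \<longrightarrow> adapted_metric U (gt t)) \<and>
     (\<forall>v w. smooth_on ({-\<epsilon><..<\<epsilon>} \<times> U) (\<lambda>(t, x). gt t x v w)) \<and>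
     (\<forall>x\<in>U. gt 0 x = g x)"

definition supported_in ::
  "'n::finite point set \<Rightarrow> 'n tensor2 \<Rightarrow> real \<Rightarrow> (real \<Rightarrow> 'n tensor2) \<Rightarrow> 'n point set \<Rightarrow> bool" where
  "supported_in U g \<epsilon> gt \<Omega> \<longleftrightarrow>
     (\<forall>t. \<bar>t\<bar> < \<epsilon> \<longrightarrow> U \<inter> closure {x \<in> U. gt t x \<noteq> g x} \<subseteq> \<Omega>)"

definition perp_variation ::
  "'n::finite point set \<Rightarrow> 'n tensor2 \<Rightarrow> real \<Rightarrow> (real \<Rightarrow> 'n tensor2) \<Rightarrow> bool" where
  "perp_variation U g \<epsilon> gt \<longleftrightarrow>
     variation U g \<epsilon> gt \<and>
     (\<forall>t. \<bar>t\<bar> < \<epsilon> \<longrightarrow> (\<forall>x\<in>U. \<forall>v\<in>leaf_tangent. \<forall>w\<in>leaf_tangent. gt t x v w = g x v w))"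

definition top_variation ::
  "'n::finite point set \<Rightarrow> 'n tensor2 \<Rightarrow> real \<Rightarrow> (real \<Rightarrow> 'n tensor2) \<Rightarrow> bool" where
  "top_variation U g \<epsilon> gt \<longleftrightarrow>
     variation U g \<epsilon> gt \<and>
     (\<forall>t. \<bar>t\<bar> < \<epsilon> \<longrightarrow>
        (\<forall>x\<in>U. \<forall>v\<in>normal_space g x. \<forall>w\<in>normal_space g x. gt t x v w = g x v w) \<and>
        (\<forall>x\<in>U. \<forall>v\<in>leaf_tangent. \<forall>w\<in>normal_space g x. gt t x v w = 0))"

text \<open>
  The components of v in the decomposition of the tangent space into the leaf tangent space
  and its orthogonal complement with respect to g.
\<close>

definition leaf_part :: "'n::finite tensor2 \<Rightarrow> 'n point \<Rightarrow> 'n point \<Rightarrow> 'n point" where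
  "leaf_part g x v = (THE a. a \<in> leaf_tangent \<and> v - a \<in> normal_space g x)"

definition normal_part :: "'n::finite tensor2 \<Rightarrow> 'n point \<Rightarrow> 'n point \<Rightarrow> 'n point" where
  "normal_part g x v = v - leaf_part g x v"

text \<open>The argument h below is a member of a variation of g.\<close>

definition bar_perp :: "'n::finite point set \<Rightarrow> 'n tensor2 \<Rightarrow> 'n tensor2 \<Rightarrow> 'n tensor2" where
  "bar_perp \<Omega> g h x v w =
     (Vol \<Omega> h / Vol \<Omega> g) powr (- 2) * h x (normal_part h x v) (normal_part h x w)
     + g x (leaf_part h x v) (leaf_part h x w)"

definition bar_top :: "'n::finite point set \<Rightarrow> 'n tensor2 \<Rightarrow> 'n tensor2 \<Rightarrow> 'n tensor2" where
  "bar_top \<Omega> g h x v w =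
     g x (normal_part g x v) (normal_part g x w)
     + (Vol \<Omega> h / Vol \<Omega> g) powr (- 2 / real CARD('n)) * h x (leaf_part g x v) (leaf_part g x w)"

definition critical_bar_perp :: "'n::finite point set \<Rightarrow> 'n point set \<Rightarrow> 'n tensor2 \<Rightarrow> bool" where
  "critical_bar_perp U \<Omega> g \<longleftrightarrow>
     (\<forall>\<epsilon> gt. perp_variation U g \<epsilon> gt \<and> supported_in U g \<epsilon> gt \<Omega> \<longrightarrow>
        ((\<lambda>t. J \<Omega> (bar_perp \<Omega> g (gt t))) has_real_derivative 0) (at 0))"

definition critical_bar_top :: "'n::finite point set \<Rightarrow> 'n point set \<Rightarrow> 'n tensor2 \<Rightarrow> bool" where
  "critical_bar_top U \<Omega> g \<longleftrightarrow>
     (\<forall>\<epsilon> gt. top_variation U g \<epsilon> gt \<and> supported_in U g \<epsilon> gt \<Omega> \<longrightarrow>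
        ((\<lambda>t. J \<Omega> (bar_top \<Omega> g (gt t))) has_real_derivative 0) (at 0))"

end

theory Submission
  imports Defs
begin

text \<open>
  For a general metric with unit normal N, shape operator A and mean curvature H = div N, the
  contracted Ricci identity turns the density of the mixed scalar curvature into a divergence plus
  the volume density times \<open>H\<^sup>2 - tr A\<^sup>2\<close>. Splitting off from A the multiple c of the identity,
  this becomes a divergence minus \<open>n (n - 1) c\<^sup>2\<close> times the volume density plus a remainder which is
  quadratic in T = A - c id.

  The metric \<open>\<Sum> dX\<^sub>\<mu>\<^sup>2 / (y \<Sum> X\<^sub>\<mu>)\<^sup>2\<close> with \<open>X\<^sub>\<mu> = exp (\<plusminus>x\<^sub>\<mu>)\<close> has totally umbilical leaves
  with A = - y id, so T = 0 for it, and the divergence of \<open>\<nabla>\<^sub>N N\<close> is the constant \<open>- n\<^sup>2 y\<^sup>2\<close>. For a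
  variation of it, T = O(t) uniformly on \<open>\<Omega>\<close>, and the remainder contributes \<open>O(t\<^sup>2)\<close> to the action.
  The modified variations preserve the volume of \<open>\<Omega>\<close>. Near the boundary of \<open>\<Omega>\<close> they rescale the
  normal by a constant \<open>\<alpha>\<close> and the leaves by a constant \<open>\<beta>\<close>, so by the divergence theorem the
  divergence term contributes a multiple of \<open>\<alpha> \<beta>\<^sup>n (2 (n - 1) / \<alpha> - n / \<alpha>\<^sup>2 - n / \<beta>\<^sup>2)\<close>, which is
  stationary at \<open>\<alpha> = \<beta> = 1\<close>. As \<open>\<alpha>\<close> and \<open>\<beta>\<close> are 1 + O(t), the action changes by \<open>O(t\<^sup>2)\<close>.
\<close>

section \<open>Smooth functions\<close>

text \<open>The shape of \<open>U\<close> is unknown, so the metric is written down on all of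
  coordinate space: the exponentials map it into the positive orthant, where the sum of the X is
  positive. A coefficient \<open>g00\<close> depending on x_0 alone is excluded: H-tilde would
  vanish, whereas the mean of its divergence has to be \<open>C\<close>. A half-space metric whose
  boundary is oblique to the leaves has normal curves that are not geodesics and yet a constant
  umbilicity factor. All \<open>\<epsilon> i\<close> are 1; near this Riemannian metric the normal
  stays spacelike, uniformly on the compact closure of \<Omega>. No first variation formula is
  derived. Second derivatives of the metric enter the action only through a divergence, so Lipschitz
  bounds in t for the metric and its first derivatives control the rest, without differentiation
  under the integral sign. The obstacle is that a modified variation is not supported in \<Omega>,
  since the volume factor acts everywhere; a boundary contribution remains and is read off from the
  flux of a rescaled model metric, which is explicit. The constant multiple of the volume stays
  fixed because the volume does.\<close>

lemma frechet_derivative_cong_open: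
  assumes "open S" "x \<in> S" "\<And>z. z \<in> S \<Longrightarrow> f z = g z"
  shows "frechet_derivative f (at x) = frechet_derivative g (at x)"
proof -
  have "(f has_derivative D) (at x) \<longleftrightarrow> (g has_derivative D) (at x)" for D
    using assms by (metis has_derivative_transform_within_open)
  then show ?thesis
    by (simp add: frechet_derivative_def)
qed

lemma differentiable_cong_open:
  assumes "open S" "x \<in> S" "\<And>z. z \<in> S \<Longrightarrow> f z = g z"
  shows "f differentiable (at x) \<longleftrightarrow> g differentiable (at x)"
  using assms unfolding differentiable_def by (metis has_derivative_transform_within_open)

lemma Ck_on_cong:
  assumes "open S" "\<And>x. x \<in> S \<Longrightarrow> f x = g x"
  shows "Ck_on k S f \<longleftrightarrow> Ck_on k S g"
  using assms(2)
proof (induction k arbitrary: f g)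
  case 0
  then show ?case by (simp cong: continuous_on_cong)
next
  case (Suc k)
  have "Ck_on k S (\<lambda>x. frechet_derivative f (at x) v)
      \<longleftrightarrow> Ck_on k S (\<lambda>x. frechet_derivative g (at x) v)" for v
    by (rule Suc.IH) (metis Suc.prems assms(1) frechet_derivative_cong_open)
  moreover have "\<forall>x\<in>S. f differentiable (at x) \<longleftrightarrow> g differentiable (at x)"
    using Suc.prems assms(1) differentiable_cong_open by metis
  ultimately show ?case by auto
qed

text \<open>\<open>Ck_on\<close> refers to the derivative selected by
  \<open>frechet_derivative\<close>; here any family \<open>D\<close> of derivatives may be
  supplied, since the derivative at a point is unique and \<open>Ck_on\<close> respects equality on
  an open set. The induction steps of the closure rules go through it.\<close>

lemma Ck_on_SucI:
  assumes "open S" "\<And>x. x \<in> S \<Longrightarrow> (f has_derivative D x) (at x)"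
    and "\<And>v. Ck_on k S (\<lambda>x. D x v)"
  shows "Ck_on (Suc k) S f"
proof -
  have "Ck_on k S (\<lambda>x. frechet_derivative f (at x) v)" for v
    using assms(2) Ck_on_cong[OF assms(1), of "\<lambda>x. frechet_derivative f (at x) v" "\<lambda>x. D x v"]
      assms(3)[of v] by (metis frechet_derivative_at)
  then show ?thesis
    using assms(2) by (auto simp: differentiable_def)
qed

lemma Ck_on_mono: "Ck_on k S f \<Longrightarrow> T \<subseteq> S \<Longrightarrow> Ck_on k T f"
  by (induction k arbitrary: f) (auto intro: continuous_on_subset)

text \<open>The product, inverse and exponential rules rest on this: the derivative of f * g
  contains f and g themselves, which therefore have to be available at the lower order.\<close>

lemma Ck_on_SucD: "Ck_on (Suc k) S f \<Longrightarrow> Ck_on k S f"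
proof (induction k arbitrary: f)
  case 0
  then show ?case
    by (auto intro: continuous_at_imp_continuous_on differentiable_imp_continuous_within)
next
  case (Suc k)
  then show ?case by (simp add: Suc.IH)
qed

lemma Ck_on_has_derivative:
  "Ck_on (Suc k) S f \<Longrightarrow> x \<in> S \<Longrightarrow> (f has_derivative frechet_derivative f (at x)) (at x)"
  using frechet_derivative_works by auto

lemma Ck_on_const: "Ck_on k S (\<lambda>x. c)"
  by (induction k arbitrary: c) auto

lemma Ck_on_add:
  assumes "open S"
  shows "Ck_on k S f \<Longrightarrow> Ck_on k S g \<Longrightarrow> Ck_on k S (\<lambda>x. f x + g x)"
proof (induction k arbitrary: f g)
  case 0
  then show ?case by (auto intro: continuous_intros)
next
  case (Suc k)
  have "Ck_on k S (\<lambda>x. frechet_derivative f (at x) v + frechet_derivative g (at x) v)" for v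
    by (rule Suc.IH) (use Suc.prems in auto)
  then show ?case
    by (intro Ck_on_SucI[OF assms has_derivative_add])
      (use Suc.prems in \<open>auto intro: Ck_on_has_derivative\<close>)
qed

lemma Ck_on_mult:
  assumes "open S"
  shows "Ck_on k S f \<Longrightarrow> Ck_on k S g \<Longrightarrow> Ck_on k S (\<lambda>x. f x * g x)"
proof (induction k arbitrary: f g)
  case 0
  then show ?case by (auto intro: continuous_intros)
next
  case (Suc k)
  note c = Ck_on_SucD[OF Suc.prems(1)] Ck_on_SucD[OF Suc.prems(2)]
  have "Ck_on k S (\<lambda>x. f x * frechet_derivative g (at x) v + frechet_derivative f (at x) v * g x)" for v
    by (intro Ck_on_add[OF assms] Suc.IH c) (use Suc.prems in auto)
  then show ?case
    by (intro Ck_on_SucI[OF assms has_derivative_mult])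
      (use Suc.prems in \<open>auto intro: Ck_on_has_derivative\<close>)
qed

lemma Ck_on_inverse:
  assumes "open S"
  shows "Ck_on k S f \<Longrightarrow> (\<And>x. x \<in> S \<Longrightarrow> f x \<noteq> 0) \<Longrightarrow> Ck_on k S (\<lambda>x. inverse (f x))"
proof (induction k)
  case 0
  then show ?case by (auto intro: continuous_intros)
next
  case (Suc k)
  have c: "Ck_on k S (\<lambda>x. inverse (f x))"
    using Suc Ck_on_SucD by blast
  have "Ck_on k S (\<lambda>x. (- 1) * (inverse (f x) * frechet_derivative f (at x) v * inverse (f x)))" for v
    by (intro Ck_on_mult[OF assms] c Ck_on_const) (use Suc.prems in auto)
  then show ?case
    by (intro Ck_on_SucI[OF assms Deriv.has_derivative_inverse])
      (use Suc.prems in \<open>auto intro: Ck_on_has_derivative\<close>)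
qed

text \<open>The derivative is written with a factor \<open>sqrt \<bar>f x\<bar>\<close>, so that the
  induction in \<open>Ck_on_sqrt_abs\<close> meets the function itself again. Both signs of f are
  covered, because near a nonzero a the absolute value is multiplication by
  \<open>sgn a\<close>.\<close>

lemma has_derivative_sqrt_abs:
  assumes "(f has_derivative D) (at x)" "f x \<noteq> (0::real)"
  shows "((\<lambda>z. sqrt \<bar>f z\<bar>) has_derivative (\<lambda>v. D v * inverse (f x) * sqrt \<bar>f x\<bar> / 2)) (at x)"
proof -
  have D: "((\<lambda>t. sqrt \<bar>t\<bar>) has_real_derivative sqrt \<bar>a\<bar> / (2 * a)) (at a)" if "a \<noteq> 0" for a :: real
  proof -
    have "((\<lambda>t. sqrt (sgn a * t)) has_real_derivative sgn a / (2 * sqrt (sgn a * a))) (at a)"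
      using that by (auto intro!: derivative_eq_intros simp: sgn_real_def field_simps)
    moreover have "sgn a / (2 * sqrt (sgn a * a)) = sqrt \<bar>a\<bar> / (2 * a)"
      using that by (auto simp: sgn_real_def field_simps)
    moreover have "eventually (\<lambda>t. sqrt (sgn a * t) = sqrt \<bar>t\<bar>) (nhds a)"
    proof -
      have "open {t. sgn a * t > 0}" by (intro open_Collect_less continuous_intros)
      moreover have "a \<in> {t. sgn a * t > 0}" using that by (auto simp: sgn_real_def)
      moreover have "sgn a * t = \<bar>t\<bar>" if "sgn a * t > 0" for t
        using that by (auto simp: sgn_real_def split: if_splits)
      ultimately show ?thesis
        unfolding eventually_nhds by (smt (verit) mem_Collect_eq)
    qed
    ultimately show ?thesis
      by (metis (mono_tags) DERIV_cong_ev)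
  qed
  have "((\<lambda>z. sqrt \<bar>f z\<bar>) has_derivative (\<lambda>v. D v * (sqrt \<bar>f x\<bar> / (2 * f x)))) (at x)"
    using DERIV_compose_FDERIV[OF D[OF assms(2)] assms(1)] .
  then show ?thesis
    by (simp add: field_simps)
qed

lemma Ck_on_sqrt_abs:
  assumes "open S"
  shows "Ck_on k S f \<Longrightarrow> (\<And>x. x \<in> S \<Longrightarrow> f x \<noteq> 0) \<Longrightarrow> Ck_on k S (\<lambda>x. sqrt \<bar>f x\<bar>)"
proof (induction k)
  case 0
  then show ?case by (auto intro: continuous_intros)
next
  case (Suc k)
  have c: "Ck_on k S (\<lambda>x. sqrt \<bar>f x\<bar>)" "Ck_on k S (\<lambda>x. inverse (f x))"
    using Suc Ck_on_SucD Ck_on_inverse[OF assms] by blast+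
  have "Ck_on k S (\<lambda>x. frechet_derivative f (at x) v * inverse (f x) * sqrt \<bar>f x\<bar> * (1 / 2))" for v
    by (intro Ck_on_mult[OF assms] c Ck_on_const) (use Suc.prems in auto)
  then show ?case
    by (intro Ck_on_SucI[OF assms has_derivative_sqrt_abs])
      (use Suc.prems in \<open>auto intro: Ck_on_has_derivative\<close>)
qed

lemma Ck_on_exp:
  assumes "open S"
  shows "Ck_on k S f \<Longrightarrow> Ck_on k S (\<lambda>x. exp (f x))"
proof (induction k)
  case 0
  then show ?case by (auto intro: continuous_intros)
next
  case (Suc k)
  have c: "Ck_on k S (\<lambda>x. exp (f x))"
    using Suc Ck_on_SucD by blast
  have "Ck_on k S (\<lambda>x. frechet_derivative f (at x) v * exp (f x))" for v
    by (intro Ck_on_mult[OF assms] c) (use Suc.prems in auto)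
  then show ?case
    by (intro Ck_on_SucI[OF assms DERIV_compose_FDERIV[OF DERIV_exp]])
      (use Suc.prems in \<open>auto intro: Ck_on_has_derivative\<close>)
qed

lemma smooth_on_const [simp, intro]: "smooth_on S (\<lambda>x. c)"
  by (simp add: smooth_on_def Ck_on_const)

lemma smooth_on_add:
  "open S \<Longrightarrow> smooth_on S f \<Longrightarrow> smooth_on S g \<Longrightarrow> smooth_on S (\<lambda>x. f x + g x)"
  by (simp add: smooth_on_def Ck_on_add)

lemma smooth_on_mult:
  "open S \<Longrightarrow> smooth_on S f \<Longrightarrow> smooth_on S g \<Longrightarrow> smooth_on S (\<lambda>x. f x * g x)"
  by (simp add: smooth_on_def Ck_on_mult)

lemma smooth_on_uminus: "open S \<Longrightarrow> smooth_on S f \<Longrightarrow> smooth_on S (\<lambda>x. - f x)"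
  using smooth_on_mult[of S "\<lambda>_. - 1" f] by simp

lemma smooth_on_diff:
  "open S \<Longrightarrow> smooth_on S f \<Longrightarrow> smooth_on S g \<Longrightarrow> smooth_on S (\<lambda>x. f x - g x)"
  using smooth_on_add[of S f "\<lambda>x. - g x"] smooth_on_uminus[of S g] by simp

lemma smooth_on_inverse:
  "open S \<Longrightarrow> smooth_on S f \<Longrightarrow> (\<And>x. x \<in> S \<Longrightarrow> f x \<noteq> 0) \<Longrightarrow> smooth_on S (\<lambda>x. inverse (f x))"
  by (simp add: smooth_on_def Ck_on_inverse)

lemma smooth_on_divide:
  "open S \<Longrightarrow> smooth_on S f \<Longrightarrow> smooth_on S g \<Longrightarrow> (\<And>x. x \<in> S \<Longrightarrow> g x \<noteq> 0) \<Longrightarrow>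
    smooth_on S (\<lambda>x. f x / g x)"
  by (simp add: divide_inverse smooth_on_mult smooth_on_inverse)

lemma smooth_on_sqrt_abs:
  "open S \<Longrightarrow> smooth_on S f \<Longrightarrow> (\<And>x. x \<in> S \<Longrightarrow> f x \<noteq> 0) \<Longrightarrow> smooth_on S (\<lambda>x. sqrt \<bar>f x\<bar>)"
  by (simp add: smooth_on_def Ck_on_sqrt_abs)

lemma smooth_on_exp: "open S \<Longrightarrow> smooth_on S f \<Longrightarrow> smooth_on S (\<lambda>x. exp (f x))"
  by (simp add: smooth_on_def Ck_on_exp)

lemma smooth_on_sum:
  "open S \<Longrightarrow> (\<And>i. i \<in> I \<Longrightarrow> smooth_on S (f i)) \<Longrightarrow> smooth_on S (\<lambda>x. \<Sum>i\<in>I. f i x)"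
  by (induction I rule: infinite_finite_induct) (auto intro: smooth_on_add)

lemma smooth_on_prod:
  "open S \<Longrightarrow> (\<And>i. i \<in> I \<Longrightarrow> smooth_on S (f i)) \<Longrightarrow> smooth_on S (\<lambda>x. \<Prod>i\<in>I. f i x)"
  by (induction I rule: infinite_finite_induct) (auto intro: smooth_on_mult)

lemma smooth_on_power:
  "open S \<Longrightarrow> smooth_on S f \<Longrightarrow> smooth_on S (\<lambda>x. f x ^ k)"
  by (induction k) (auto intro: smooth_on_mult)

lemma smooth_on_bounded_linear:
  assumes "bounded_linear f"
  shows "smooth_on S f"
proof -
  have "smooth_on UNIV f"
    unfolding smooth_on_def
  proof
    fix k
    show "Ck_on k UNIV f"
    proof (cases k)
      case 0
      then show ?thesis
        using assms linear_continuous_on by auto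
    next
      case (Suc j)
      then show ?thesis
        using Ck_on_SucI[of UNIV f "\<lambda>_. f" j] Ck_on_const
          bounded_linear_imp_has_derivative[OF assms] by blast
    qed
  qed
  then show ?thesis
    by (auto simp: smooth_on_def intro: Ck_on_mono)
qed

lemma smooth_on_component: "smooth_on S (\<lambda>x :: real ^ 'm. x $ i)"
  by (intro smooth_on_bounded_linear bounded_linear_vec_nth)

lemma smooth_on_mono: "smooth_on S f \<Longrightarrow> T \<subseteq> S \<Longrightarrow> smooth_on T f"
  by (auto simp: smooth_on_def intro: Ck_on_mono)

lemma smooth_on_cong:
  "open S \<Longrightarrow> (\<And>x. x \<in> S \<Longrightarrow> f x = g x) \<Longrightarrow> smooth_on S f \<longleftrightarrow> smooth_on S g"
  using Ck_on_cong[of S f g] by (simp add: smooth_on_def)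

lemma smooth_on_frechet_derivative:
  "smooth_on S f \<Longrightarrow> smooth_on S (\<lambda>x. frechet_derivative f (at x) v)"
  unfolding smooth_on_def by (metis Ck_on.simps(2))

lemma smooth_on_pderiv: "smooth_on S f \<Longrightarrow> smooth_on S (pderiv f i)"
  using smooth_on_frechet_derivative[of S f "axis i 1"] by (simp add: pderiv_def[abs_def])

lemma smooth_on_differentiable: "smooth_on S f \<Longrightarrow> x \<in> S \<Longrightarrow> f differentiable (at x)"
  unfolding smooth_on_def by (metis Ck_on.simps(2))

lemma smooth_on_has_derivative:
  "smooth_on S f \<Longrightarrow> x \<in> S \<Longrightarrow> (f has_derivative frechet_derivative f (at x)) (at x)"
  using smooth_on_differentiable frechet_derivative_works by blast

lemma smooth_on_continuous_on: "smooth_on S f \<Longrightarrow> continuous_on S f"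
  unfolding smooth_on_def by (metis Ck_on.simps(1))

lemma smooth_on_det:
  fixes A :: "'a::real_normed_vector \<Rightarrow> real ^ 'm ^ 'm"
  assumes "open S" "\<And>i j. smooth_on S (\<lambda>x. A x $ i $ j)"
  shows "smooth_on S (\<lambda>x. det (A x))"
  unfolding det_def
  by (intro smooth_on_sum smooth_on_mult smooth_on_prod smooth_on_const assms)

subsection \<open>Partial derivatives\<close>

lemma has_derivative_imp_pderiv: "(f has_derivative D) (at x) \<Longrightarrow> pderiv f i x = D (axis i 1)"
  unfolding pderiv_def by (metis frechet_derivative_at)

lemma pderiv_const [simp]: "pderiv (\<lambda>x. c) i x = 0"
  by (simp add: pderiv_def)

lemma pderiv_add:
  "f differentiable (at x) \<Longrightarrow> g differentiable (at x) \<Longrightarrow>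
    pderiv (\<lambda>x. f x + g x) i x = pderiv f i x + pderiv g i x"
  unfolding frechet_derivative_works
  by (subst has_derivative_imp_pderiv, erule (1) has_derivative_add) (simp add: pderiv_def)

lemma pderiv_diff:
  "f differentiable (at x) \<Longrightarrow> g differentiable (at x) \<Longrightarrow>
    pderiv (\<lambda>x. f x - g x) i x = pderiv f i x - pderiv g i x"
  unfolding frechet_derivative_works
  by (subst has_derivative_imp_pderiv, erule (1) has_derivative_diff) (simp add: pderiv_def)

lemma pderiv_mult:
  "f differentiable (at x) \<Longrightarrow> g differentiable (at x) \<Longrightarrow>
    pderiv (\<lambda>x. f x * g x) i x = f x * pderiv g i x + pderiv f i x * g x"
  unfolding frechet_derivative_works
  by (subst has_derivative_imp_pderiv, erule (1) has_derivative_mult) (simp add: pderiv_def)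

lemma pderiv_cmult:
  "g differentiable (at x) \<Longrightarrow> pderiv (\<lambda>x. c * g x) i x = c * pderiv g i x"
  by (simp add: pderiv_mult)

lemma pderiv_sum:
  "(\<And>a. a \<in> A \<Longrightarrow> f a differentiable (at x)) \<Longrightarrow>
    pderiv (\<lambda>x. \<Sum>a\<in>A. f a x) i x = (\<Sum>a\<in>A. pderiv (f a) i x)"
  by (induction A rule: infinite_finite_induct) (auto simp: pderiv_add)

lemma pderiv_cong_open:
  "open S \<Longrightarrow> x \<in> S \<Longrightarrow> (\<And>z. z \<in> S \<Longrightarrow> f z = g z) \<Longrightarrow> pderiv f i x = pderiv g i x"
  unfolding pderiv_def using frechet_derivative_cong_open by metis

lemma vec_eq_sum_axis: "v = (\<Sum>i\<in>UNIV. v $ i *\<^sub>R axis i 1)" for v :: "real ^ 'm"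
  using basis_expansion[of v] by (simp add: scalar_mult_eq_scaleR)

lemma frechet_derivative_eq_sum_pderiv:
  assumes "f differentiable (at x)"
  shows "frechet_derivative f (at x) v = (\<Sum>i\<in>UNIV. v $ i * pderiv f i x)"
proof -
  interpret linear "frechet_derivative f (at x)"
    using linear_frechet_derivative[OF assms] .
  show ?thesis
    by (subst vec_eq_sum_axis[of v]) (simp add: sum scale pderiv_def)
qed

text \<open>Both mixed derivatives are limits of the same second difference quotient.\<close>

lemma second_difference:
  fixes f :: "'a::real_normed_vector \<Rightarrow> real"
  assumes "0 < h"
    and d1: "\<And>s t. 0 \<le> s \<Longrightarrow> s \<le> h \<Longrightarrow> 0 \<le> t \<Longrightarrow> t \<le> h \<Longrightarrow>
        f differentiable (at (x + s *\<^sub>R u + t *\<^sub>R v))"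
    and d2: "\<And>s t. 0 \<le> s \<Longrightarrow> s \<le> h \<Longrightarrow> 0 \<le> t \<Longrightarrow> t \<le> h \<Longrightarrow>
        (\<lambda>z. frechet_derivative f (at z) u) differentiable (at (x + s *\<^sub>R u + t *\<^sub>R v))"
  obtains s t where "0 < s" "s < h" "0 < t" "t < h"
    "f (x + h *\<^sub>R u + h *\<^sub>R v) - f (x + h *\<^sub>R u) - f (x + h *\<^sub>R v) + f x
      = h * h * frechet_derivative (\<lambda>z. frechet_derivative f (at z) u) (at (x + s *\<^sub>R u + t *\<^sub>R v)) v"
proof -
  let ?fu = "\<lambda>z. frechet_derivative f (at z) u"
  have der: "((\<lambda>s. k (a + s *\<^sub>R w)) has_real_derivative frechet_derivative k (at (a + s *\<^sub>R w)) w) (at s)"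
    if "k differentiable (at (a + s *\<^sub>R w))" for k :: "'a \<Rightarrow> real" and a w s
  proof -
    have k: "(k has_derivative frechet_derivative k (at (a + s *\<^sub>R w))) (at (a + s *\<^sub>R w))"
      using that frechet_derivative_works by blast
    have a: "((\<lambda>s. a + s *\<^sub>R w) has_derivative (\<lambda>r. r *\<^sub>R w)) (at s)"
      by (auto intro!: derivative_eq_intros)
    have "((\<lambda>s. k (a + s *\<^sub>R w)) has_derivative (\<lambda>r. frechet_derivative k (at (a + s *\<^sub>R w)) (r *\<^sub>R w))) (at s)"
      using diff_chain_at[OF a k] by (simp add: o_def)
    then show ?thesis
      using linear_frechet_derivative[OF that]
      by (simp add: has_field_derivative_def linear_scale mult.commute[of _ "frechet_derivative k _ w"])
  qed
  have 1: "((\<lambda>s. f ((x + h *\<^sub>R v) + s *\<^sub>R u) - f (x + s *\<^sub>R u)) has_real_derivative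
      ?fu ((x + h *\<^sub>R v) + s *\<^sub>R u) - ?fu (x + s *\<^sub>R u)) (at s)" if "0 \<le> s" "s \<le> h" for s
    using d1[of s h] d1[of s 0] that \<open>0 < h\<close>
    by (intro DERIV_diff der) (simp_all add: add_ac)
  obtain s where s: "0 < s" "s < h"
    "(f ((x + h *\<^sub>R v) + h *\<^sub>R u) - f (x + h *\<^sub>R u)) - (f ((x + h *\<^sub>R v) + 0 *\<^sub>R u) - f (x + 0 *\<^sub>R u))
      = (h - 0) * (?fu ((x + h *\<^sub>R v) + s *\<^sub>R u) - ?fu (x + s *\<^sub>R u))"
    using MVT2[OF \<open>0 < h\<close> 1] by blast
  have 2: "((\<lambda>t. ?fu ((x + s *\<^sub>R u) + t *\<^sub>R v)) has_real_derivative
      frechet_derivative ?fu (at ((x + s *\<^sub>R u) + t *\<^sub>R v)) v) (at t)" if "0 \<le> t" "t \<le> h" for t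
    using d2[of s t] that s by (intro der) simp
  obtain t where t: "0 < t" "t < h"
    "?fu ((x + s *\<^sub>R u) + h *\<^sub>R v) - ?fu ((x + s *\<^sub>R u) + 0 *\<^sub>R v)
      = (h - 0) * frechet_derivative ?fu (at ((x + s *\<^sub>R u) + t *\<^sub>R v)) v"
    using MVT2[OF \<open>0 < h\<close> 2] by blast
  show ?thesis
    by (rule that[OF s(1,2) t(1,2)]) (use s(3) t(3) in \<open>simp add: add_ac algebra_simps\<close>)
qed

lemma smooth_on_mixed_derivatives_commute:
  fixes f :: "'a::real_normed_vector \<Rightarrow> real"
  assumes "open S" "smooth_on S f" "x \<in> S"
  shows "frechet_derivative (\<lambda>z. frechet_derivative f (at z) u) (at x) v
       = frechet_derivative (\<lambda>z. frechet_derivative f (at z) v) (at x) u" (is "?A x = ?B x")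
proof (rule ccontr)
  assume neq: "?A x \<noteq> ?B x"
  let ?e = "\<bar>?A x - ?B x\<bar> / 2"
  have e: "?e > 0" using neq by simp
  have "continuous_on S ?A" "continuous_on S ?B"
    by (intro smooth_on_continuous_on smooth_on_frechet_derivative assms)+
  then have "isCont ?A x" "isCont ?B x"
    using assms continuous_on_eq_continuous_at by blast+
  then obtain da db where da: "da > 0" "\<And>z. dist z x < da \<Longrightarrow> dist (?A z) (?A x) < ?e"
    and db: "db > 0" "\<And>z. dist z x < db \<Longrightarrow> dist (?B z) (?B x) < ?e"
    using e unfolding continuous_at_eps_delta by metis
  obtain dc where dc: "dc > 0" "ball x dc \<subseteq> S"
    using assms open_contains_ball by blast
  define d where "d = min da (min db dc)"
  have d: "d > 0" "d \<le> da" "d \<le> db" "d \<le> dc" using da db dc by (auto simp: d_def)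
  define c where "c = norm u + norm v + 1"
  have c: "c > 0" by (auto simp: c_def intro!: add_nonneg_pos)
  \<comment> \<open>This size keeps all points of the parallelogram with sides h u and h v at
    distance at most d / 2 from x.\<close>
  define h where "h = d / (2 * c)"
  have h: "h > 0" using d c by (auto simp: h_def)
  have near: "dist (x + s *\<^sub>R u + t *\<^sub>R v) x < d" if "0 \<le> s" "s \<le> h" "0 \<le> t" "t \<le> h" for s t
  proof -
    have "dist (x + s *\<^sub>R u + t *\<^sub>R v) x \<le> s * norm u + t * norm v"
      using that norm_triangle_ineq[of "s *\<^sub>R u" "t *\<^sub>R v"] by (simp add: dist_norm add.assoc)
    also have "\<dots> \<le> h * norm u + h * norm v"
      using that by (intro add_mono mult_right_mono) auto
    also have "\<dots> \<le> h * c"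
      using h by (simp add: c_def algebra_simps)
    also have "\<dots> = d / 2"
      using c by (simp add: h_def)
    also have "\<dots> < d" using d by simp
    finally show ?thesis .
  qed
  have inS: "x + s *\<^sub>R u + t *\<^sub>R v \<in> S" if "0 \<le> s" "s \<le> h" "0 \<le> t" "t \<le> h" for s t
    using near[OF that] dc d by (auto simp: mem_ball dist_commute subset_eq)
  obtain s t where st: "0 < s" "s < h" "0 < t" "t < h"
    "f (x + h *\<^sub>R u + h *\<^sub>R v) - f (x + h *\<^sub>R u) - f (x + h *\<^sub>R v) + f x
      = h * h * ?A (x + s *\<^sub>R u + t *\<^sub>R v)"
    by (rule second_difference[OF h, of f x u v])
      (auto intro!: inS smooth_on_differentiable[of S] smooth_on_frechet_derivative assms)
  have sw: "x + s *\<^sub>R v + t *\<^sub>R u = x + t *\<^sub>R u + s *\<^sub>R v" for s t by simp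
  obtain s' t' where st': "0 < s'" "s' < h" "0 < t'" "t' < h"
    "f (x + h *\<^sub>R v + h *\<^sub>R u) - f (x + h *\<^sub>R v) - f (x + h *\<^sub>R u) + f x
      = h * h * ?B (x + s' *\<^sub>R v + t' *\<^sub>R u)"
    by (rule second_difference[OF h, of f x v u])
      (unfold sw, auto intro!: inS smooth_on_differentiable[of S] smooth_on_frechet_derivative assms)
  have "h * h * ?A (x + s *\<^sub>R u + t *\<^sub>R v) = h * h * ?B (x + t' *\<^sub>R u + s' *\<^sub>R v)"
    using st(5) st'(5) unfolding sw by linarith
  then have "?A (x + s *\<^sub>R u + t *\<^sub>R v) = ?B (x + t' *\<^sub>R u + s' *\<^sub>R v)"
    using h by simp
  moreover have "dist (?A (x + s *\<^sub>R u + t *\<^sub>R v)) (?A x) < ?e"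
    using near[of s t] st d by (intro da) auto
  moreover have "dist (?B (x + t' *\<^sub>R u + s' *\<^sub>R v)) (?B x) < ?e"
    using near[of t' s'] st' d by (intro db) auto
  ultimately show False
    unfolding dist_real_def by argo
qed

lemma pderiv_commute:
  "open S \<Longrightarrow> smooth_on S f \<Longrightarrow> x \<in> S \<Longrightarrow> pderiv (pderiv f i) j x = pderiv (pderiv f j) i x"
  using smooth_on_mixed_derivatives_commute[of S f x "axis i 1" "axis j 1"]
  by (simp add: pderiv_def[abs_def])

section \<open>The divergence theorem for compactly supported fields\<close>

text \<open>By translation invariance of Lebesgue measure the difference quotient of f in direction
  e has integral zero for every step size, and dominated convergence carries this over to the
  derivative.\<close>

lemma integral_directional_derivative_zero:
  fixes f :: "'a::euclidean_space \<Rightarrow> real"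
  assumes der: "\<And>x. (f has_derivative D x) (at x)"
    and cont: "continuous_on UNIV (\<lambda>x. D x e)"
    and K: "compact K" "\<And>x. x \<notin> K \<Longrightarrow> f x = 0" "\<And>x. x \<notin> K \<Longrightarrow> D x e = 0"
  shows "integrable lborel (\<lambda>x. D x e)" "(LINT x|lborel. D x e) = 0"
proof -
  have ind: "integrable lborel g" if "continuous_on UNIV g" "\<And>x. x \<notin> K \<Longrightarrow> g x = 0" for g :: "'a \<Rightarrow> real"
  proof -
    have "g = (\<lambda>x. indicator K x *\<^sub>R g x)"
    proof
      show "g x = indicator K x *\<^sub>R g x" for x
        using that(2)[of x] by (cases "x \<in> K") auto
    qed
    then show ?thesis
      using borel_integrable_compact[OF K(1) continuous_on_subset[OF that(1)]] by simp
  qed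
  have cf: "continuous_on UNIV f"
    by (rule continuous_at_imp_continuous_on) (use has_derivative_continuous[OF der] in blast)
  have f: "integrable lborel f" by (rule ind[OF cf K(2)])
  show int: "integrable lborel (\<lambda>x. D x e)" by (rule ind[OF cont K(3)])
  have "bounded ((\<lambda>x. D x e) ` K)"
    using cont K(1) by (intro compact_imp_bounded compact_continuous_image) (auto intro: continuous_on_subset)
  then obtain B where B: "B > 0" "\<And>x. x \<in> K \<Longrightarrow> \<bar>D x e\<bar> \<le> B"
    unfolding bounded_pos by auto
  have B': "\<bar>D x e\<bar> \<le> B" for x
    using B K(3)[of x] by (cases "x \<in> K") auto
  obtain R where R: "R > 0" "\<And>x. x \<in> K \<Longrightarrow> norm x \<le> R"
    using compact_imp_bounded[OF K(1)] unfolding bounded_pos by auto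
  define q where "q m x = (f (x + (1 / real (Suc m)) *\<^sub>R e) - f x) * real (Suc m)" for m x
  have sc: "((\<lambda>s. f (x + s *\<^sub>R e)) has_real_derivative D (x + s *\<^sub>R e) e) (at s)" for x s
  proof -
    have a: "((\<lambda>s. x + s *\<^sub>R e) has_derivative (\<lambda>r. r *\<^sub>R e)) (at s)"
      by (auto intro!: derivative_eq_intros)
    have "((\<lambda>s. f (x + s *\<^sub>R e)) has_derivative (\<lambda>r. D (x + s *\<^sub>R e) (r *\<^sub>R e))) (at s)"
      using diff_chain_at[OF a der] by (simp add: o_def)
    then show ?thesis
      using has_derivative_linear[OF der, of "x + s *\<^sub>R e"]
      by (simp add: has_field_derivative_def linear_scale mult.commute[of _ "D _ e"])
  qed
  have qeq: "\<exists>s. 0 < s \<and> s < 1 / real (Suc m) \<and> q m x = D (x + s *\<^sub>R e) e" for m x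
  proof -
    have "0 < 1 / real (Suc m)" by simp
    from MVT2[OF this sc] obtain s where "0 < s" "s < 1 / real (Suc m)"
      "f (x + (1 / real (Suc m)) *\<^sub>R e) - f (x + 0 *\<^sub>R e)
        = (1 / real (Suc m) - 0) * D (x + s *\<^sub>R e) e" by blast
    then show ?thesis
      by (intro exI[of _ s]) (simp add: q_def field_simps)
  qed
  have shift: "integrable lborel (\<lambda>x. f (x + c))" "(LINT x|lborel. f (x + c)) = (LINT x|lborel. f x)" for c
  proof -
    have m: "f \<in> borel_measurable lborel" using f by auto
    have l: "distr lborel lborel ((+) c) = lborel"
      using lborel_distr_plus[of c] by (simp cong: distr_cong)
    have "integrable (distr lborel lborel ((+) c)) f"
      unfolding l by (rule f)
    then show "integrable lborel (\<lambda>x. f (x + c))"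
      using m by (subst (asm) integrable_distr_eq) (auto simp: add.commute)
    have "(LINT x|distr lborel lborel ((+) c). f x) = (LINT x|lborel. f (c + x))"
      using m by (subst integral_distr) auto
    then show "(LINT x|lborel. f (x + c)) = (LINT x|lborel. f x)"
      unfolding l by (simp add: add.commute)
  qed
  have q0: "(LINT x|lborel. q m x) = 0" for m
    unfolding q_def by (simp add: shift f)
  \<comment> \<open>A difference quotient with step at most 1 is a value of the derivative at a
    point within \<open>norm e\<close> of x. Hence it is bounded by \<open>B\<close> and vanishes
    once \<open>norm x\<close> exceeds \<open>R + norm e\<close>.\<close>
  let ?w = "\<lambda>x. indicator (cball 0 (R + norm e)) x *\<^sub>R B"
  have "(\<lambda>m. LINT x|lborel. q m x) \<longlonglongrightarrow> (LINT x|lborel. D x e)"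
  proof (rule integral_dominated_convergence[where w = ?w])
    show "integrable lborel ?w"
      by (intro borel_integrable_compact) auto
    show "(\<lambda>x. D x e) \<in> borel_measurable lborel" using int by auto
    show "q m \<in> borel_measurable lborel" for m
      unfolding q_def using shift f by (intro borel_measurable_times borel_measurable_diff) auto
    show "AE x in lborel. (\<lambda>m. q m x) \<longlonglongrightarrow> D x e"
    proof (rule AE_I2)
      fix x
      have "((\<lambda>s. (f (x + s *\<^sub>R e) - f (x + 0 *\<^sub>R e)) / (s - 0)) \<longlongrightarrow> D x e) (at 0)"
        using sc[of x 0] by (simp add: has_field_derivative_iff)
      moreover have "filterlim (\<lambda>m. 1 / real (Suc m)) (at 0) sequentially"
        unfolding filterlim_at
        using LIMSEQ_inverse_real_of_nat by (auto simp: inverse_eq_divide)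
      ultimately have "(\<lambda>m. (f (x + (1 / real (Suc m)) *\<^sub>R e) - f (x + 0 *\<^sub>R e)) / (1 / real (Suc m) - 0))
          \<longlonglongrightarrow> D x e"
        by (rule filterlim_compose)
      then show "(\<lambda>m. q m x) \<longlonglongrightarrow> D x e"
        by (simp add: q_def)
    qed
    show "AE x in lborel. norm (q m x) \<le> ?w x" for m
    proof (rule AE_I2)
      fix x
      obtain s where s: "0 < s" "s < 1 / real (Suc m)" "q m x = D (x + s *\<^sub>R e) e"
        using qeq by blast
      show "norm (q m x) \<le> ?w x"
      proof (cases "norm x \<le> R + norm e")
        case True
        then show ?thesis using B' s by (simp add: indicator_def)
      next
        case False
        have "1 / real (Suc m) \<le> 1" by simp
        then have "s * norm e \<le> norm e"
          using s by (intro mult_left_le_one_le norm_ge_zero) linarith+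
        then have "norm (x + s *\<^sub>R e) > R"
          using norm_triangle_ineq4[of "x + s *\<^sub>R e" "s *\<^sub>R e"] False s by simp
        then have "x + s *\<^sub>R e \<notin> K" using R by force
        then show ?thesis using K(3) s B by (simp add: indicator_def)
      qed
    qed
  qed
  then show "(LINT x|lborel. D x e) = 0"
    by (simp only: q0 LIMSEQ_const_iff)
qed

text \<open>The extension of Z by zero is differentiable everywhere, because the open sets
  \<open>S\<close> and \<open>- K\<close> cover the space, and the extension is Z on the first and 0
  on the second.\<close>

lemma integral_pderiv_zero:
  fixes Z :: "'n::finite point \<Rightarrow> real"
  assumes "open S" "smooth_on S Z" "compact K" "K \<subseteq> S" "\<And>x. x \<in> S - K \<Longrightarrow> Z x = 0"
  shows "set_integrable lborel S (pderiv Z i)" "(LINT x:S|lborel. pderiv Z i x) = 0"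
proof -
  define f where "f x = (if x \<in> S then Z x else 0)" for x
  define D where "D x = (if x \<in> S then frechet_derivative Z (at x) else (\<lambda>_. 0))" for x
  have opn: "open (- K)" using assms(3) by (simp add: compact_imp_closed open_Compl)
  have fK: "f x = 0" if "x \<notin> K" for x using that assms(5) by (auto simp: f_def)
  have ZK: "(Z has_derivative (\<lambda>_. 0)) (at x)" if "x \<in> S" "x \<notin> K" for x
    by (rule has_derivative_transform_within_open[of "\<lambda>_. 0" _ _ _ "S - K"])
      (use that assms opn in \<open>auto simp: open_Diff compact_imp_closed\<close>)
  have DK: "D x = (\<lambda>_. 0)" if "x \<notin> K" for x
    using ZK[of x] that frechet_derivative_at by (fastforce simp: D_def)
  have der: "(f has_derivative D x) (at x)" for x
  proof (cases "x \<in> S")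
    case True
    then have "(Z has_derivative D x) (at x)"
      using smooth_on_has_derivative[OF assms(2)] by (simp add: D_def)
    then show ?thesis
      by (rule has_derivative_transform_within_open[OF _ assms(1) True]) (simp add: f_def)
  next
    case False
    then have "x \<in> - K" using assms(4) by auto
    have "(f has_derivative (\<lambda>_. 0)) (at x)"
      by (rule has_derivative_transform_within_open[of "\<lambda>_. 0" _ _ _ "- K", OF _ opn \<open>x \<in> - K\<close>])
        (simp_all add: fK)
    then show ?thesis using False by (simp add: D_def)
  qed
  have "continuous_on S (\<lambda>x. D x (axis i 1))"
    using smooth_on_continuous_on[OF smooth_on_frechet_derivative[OF assms(2)], of "axis i 1"]
    by (simp add: D_def cong: continuous_on_cong)
  moreover have "continuous_on (- K) (\<lambda>x. D x (axis i 1))"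
    by (rule continuous_on_eq[of _ "\<lambda>_. 0"]) (auto simp: DK)
  moreover have "S \<union> - K = UNIV" using assms(4) by auto
  ultimately have cont: "continuous_on UNIV (\<lambda>x. D x (axis i 1))"
    using continuous_on_open_Un[OF assms(1) opn, of "\<lambda>x. D x (axis i 1)"] by simp
  note main = integral_directional_derivative_zero[OF der cont assms(3) fK]
  have eq: "indicator S x *\<^sub>R pderiv Z i x = D x (axis i 1)" for x
    by (simp add: D_def pderiv_def indicator_def)
  show "set_integrable lborel S (pderiv Z i)" "(LINT x:S|lborel. pderiv Z i x) = 0"
    unfolding set_integrable_def set_lebesgue_integral_def eq using main by (simp_all add: DK)
qed

text \<open>The estimate turns a bound that is uniform on a bounded open set, such as a multiple of
  t^2, into a bound of the same order for the integral.\<close>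

lemma set_integrable_bounded_continuous:
  fixes f :: "'a::euclidean_space \<Rightarrow> real"
  assumes "open S" "bounded S" "continuous_on S f" "\<And>x. x \<in> S \<Longrightarrow> \<bar>f x\<bar> \<le> B"
  shows "set_integrable lborel S f"
    and "\<bar>LINT x:S|lborel. f x\<bar> \<le> B * measure lborel S"
proof -
  have fin: "emeasure lborel S < \<infinity>" using assms(2) by (rule emeasure_bounded_finite)
  have c: "integrable lborel (\<lambda>x. indicator S x *\<^sub>R B)"
    using fin assms(1) by (intro integrable_scaleR_left integrable_real_indicator) auto
  show s: "set_integrable lborel S f"
    unfolding set_integrable_def
  proof (rule Bochner_Integration.integrable_bound[OF c])
    show "(\<lambda>x. indicator S x *\<^sub>R f x) \<in> borel_measurable lborel"
      using borel_measurable_continuous_on_indicator[of S f] assms by simp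
    show "AE x in lborel. norm (indicator S x *\<^sub>R f x) \<le> norm (indicator S x *\<^sub>R B)"
    proof (rule AE_I2)
      show "norm (indicator S x *\<^sub>R f x) \<le> norm (indicator S x *\<^sub>R B)" for x
        using assms(4)[of x] by (cases "x \<in> S") auto
    qed
  qed
  have "\<bar>LINT x:S|lborel. f x\<bar> \<le> (LINT x|lborel. norm (indicator S x *\<^sub>R f x))"
    unfolding set_lebesgue_integral_def real_norm_def[symmetric] by (rule integral_norm_bound)
  also have "\<dots> \<le> (LINT x|lborel. indicator S x *\<^sub>R B)"
  proof (rule integral_mono[OF integrable_norm[OF s[unfolded set_integrable_def]] c])
    show "norm (indicator S x *\<^sub>R f x) \<le> indicator S x *\<^sub>R B" for x
      using assms(4)[of x] by (cases "x \<in> S") auto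
  qed
  also have "\<dots> = B * measure lborel S"
    using assms(1) fin by simp
  finally show "\<bar>LINT x:S|lborel. f x\<bar> \<le> B * measure lborel S" .
qed

section \<open>Linear algebra\<close>

lemma matrix_inv_inverse:
  fixes A :: "real ^ 'm ^ 'm"
  assumes "det A \<noteq> 0"
  shows "A ** matrix_inv A = mat 1" "matrix_inv A ** A = mat 1"
proof -
  have "\<exists>B. A ** B = mat 1 \<and> B ** A = mat 1"
    using assms by (simp add: invertible_det_nz[symmetric] invertible_def)
  then have "A ** matrix_inv A = mat 1 \<and> matrix_inv A ** A = mat 1"
    unfolding matrix_inv_def by (rule someI_ex)
  then show "A ** matrix_inv A = mat 1" "matrix_inv A ** A = mat 1" by auto
qed

lemma matrix_inv_sum:
  fixes A :: "real ^ 'm ^ 'm"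
  assumes "det A \<noteq> 0"
  shows "(\<Sum>l\<in>UNIV. A $ i $ l * matrix_inv A $ l $ j) = (if i = j then 1 else 0)"
    and "(\<Sum>l\<in>UNIV. matrix_inv A $ i $ l * A $ l $ j) = (if i = j then 1 else 0)"
  using arg_cong[OF matrix_inv_inverse(1)[OF assms], of "\<lambda>B. B $ i $ j"]
    arg_cong[OF matrix_inv_inverse(2)[OF assms], of "\<lambda>B. B $ i $ j"]
  by (simp_all add: matrix_matrix_mult_def mat_def)

lemma matrix_inv_eqI:
  fixes A :: "real ^ 'm ^ 'm"
  assumes "A ** B = mat 1"
  shows "matrix_inv A = B"
proof -
  have "det A * det B = 1"
    using assms by (metis det_I det_mul)
  then have "det A \<noteq> 0" by auto
  then have "matrix_inv A = (matrix_inv A ** A) ** B"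
    by (metis assms matrix_mul_assoc matrix_mul_rid)
  then show ?thesis
    by (simp add: matrix_inv_inverse(2)[OF \<open>det A \<noteq> 0\<close>])
qed

lemma matrix_inv_symmetric:
  fixes A :: "real ^ 'm ^ 'm"
  assumes "det A \<noteq> 0" "\<And>i j. A $ i $ j = A $ j $ i"
  shows "matrix_inv A $ i $ j = matrix_inv A $ j $ i"
proof -
  have A: "transpose A = A" using assms(2) by (simp add: vec_eq_iff transpose_def)
  have "A ** transpose (matrix_inv A) = transpose (matrix_inv A ** transpose A)"
    by (simp add: matrix_transpose_mul)
  also have "\<dots> = mat 1"
    by (simp add: A matrix_inv_inverse(2)[OF assms(1)] transpose_mat)
  finally have "matrix_inv A = transpose (matrix_inv A)" by (rule matrix_inv_eqI)
  from arg_cong[OF this, of "\<lambda>B. B $ i $ j"] show ?thesis by (simp add: transpose_def)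
qed

text \<open>Each entry of the inverse becomes a quotient of determinants, hence a rational function
  of the entries of A. Smoothness and Lipschitz bounds pass to the inverse metric in this
  form.\<close>

lemma matrix_inv_cramer:
  fixes A :: "real ^ 'm ^ 'm"
  assumes "det A \<noteq> 0"
  shows "matrix_inv A $ k $ l = det (\<chi> i j. if j = k then axis l 1 $ i else A $ i $ j) / det A"
proof -
  have "A *v column l (matrix_inv A) = axis l 1"
    using matrix_inv_sum(1)[OF assms]
    by (auto simp: vec_eq_iff matrix_vector_mult_def column_def axis_def)
  then have "column l (matrix_inv A)
      = (\<chi> k. det (\<chi> i j. if j = k then axis l 1 $ i else A $ i $ j) / det A)"
    by (rule cramer[OF assms, THEN iffD1])
  from arg_cong[OF this, of "\<lambda>v. v $ k"] show ?thesis by (simp add: column_def)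
qed

text \<open>The coefficients of w in the basis of rows of A are those of w times the inverse of A;
  Cramer's rule for rows reads off the i-th one.\<close>

lemma det_replace_row:
  fixes A :: "real ^ 'm ^ 'm"
  assumes "det A \<noteq> 0"
  shows "det (\<chi> k. if k = i then w else A $ k) = det A * (\<Sum>j\<in>UNIV. w $ j * matrix_inv A $ j $ i)"
proof -
  define x where "x = (\<chi> i. \<Sum>j\<in>UNIV. w $ j * matrix_inv A $ j $ i)"
  have "(\<Sum>l\<in>UNIV. x $ l *s row l A) $ m = w $ m" for m
  proof -
    have "(\<Sum>l\<in>UNIV. x $ l *s row l A) $ m
        = (\<Sum>l\<in>UNIV. \<Sum>j\<in>UNIV. w $ j * (matrix_inv A $ j $ l * A $ l $ m))"
      by (simp add: x_def row_def sum_distrib_right mult.assoc)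
    also have "\<dots> = (\<Sum>j\<in>UNIV. w $ j * (\<Sum>l\<in>UNIV. matrix_inv A $ j $ l * A $ l $ m))"
      by (subst sum.swap) (simp add: sum_distrib_left)
    also have "\<dots> = w $ m"
      by (simp add: matrix_inv_sum(2)[OF assms] if_distrib[of "(*) _"] cong: if_cong)
    finally show ?thesis .
  qed
  then have "(\<Sum>l\<in>UNIV. x $ l *s row l A) = w" by (simp add: vec_eq_iff)
  moreover have "row k A = A $ k" for k by (simp add: row_def vec_eq_iff)
  ultimately show ?thesis
    using cramer_lemma_transpose[of i x A] by (simp add: x_def cong: if_cong)
qed

text \<open>Jacobi's formula. The product rule in the Leibniz expansion gives, for each row, the
  determinant with that row replaced by its derivative; \<open>det_replace_row\<close> evaluates
  it.\<close>

lemma has_derivative_det: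
  fixes A :: "'a::real_normed_vector \<Rightarrow> real ^ 'm ^ 'm"
  assumes der: "\<And>i j. ((\<lambda>z. A z $ i $ j) has_derivative dA i j) (at x)" and nz: "det (A x) \<noteq> 0"
  shows "((\<lambda>z. det (A z)) has_derivative
    (\<lambda>v. det (A x) * (\<Sum>i\<in>UNIV. \<Sum>j\<in>UNIV. matrix_inv (A x) $ j $ i * dA i j v))) (at x)"
proof -
  let ?P = "{p. p permutes (UNIV :: 'm set)}"
  have "((\<lambda>z. \<Sum>p\<in>?P. of_int (sign p) * (\<Prod>i\<in>UNIV. A z $ i $ p i)) has_derivative
    (\<lambda>v. \<Sum>p\<in>?P. of_int (sign p) * (\<Sum>i\<in>UNIV. dA i (p i) v * (\<Prod>k\<in>UNIV - {i}. A x $ k $ p k)))) (at x)"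
    by (intro has_derivative_sum has_derivative_mult_right has_derivative_prod der)
  moreover have "(\<Sum>p\<in>?P. of_int (sign p) * (\<Sum>i\<in>UNIV. dA i (p i) v * (\<Prod>k\<in>UNIV - {i}. A x $ k $ p k)))
     = det (A x) * (\<Sum>i\<in>UNIV. \<Sum>j\<in>UNIV. matrix_inv (A x) $ j $ i * dA i j v)" for v
  proof -
    have row: "(\<Prod>k\<in>UNIV. (\<chi> k. if k = i then (\<chi> j. dA i j v) else A x $ k) $ k $ p k)
        = dA i (p i) v * (\<Prod>k\<in>UNIV - {i}. A x $ k $ p k)" for i :: 'm and p
      by (subst prod.remove[of _ i]) (auto intro!: prod.cong)
    have "(\<Sum>p\<in>?P. of_int (sign p) * (\<Sum>i\<in>UNIV. dA i (p i) v * (\<Prod>k\<in>UNIV - {i}. A x $ k $ p k)))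
      = (\<Sum>i\<in>UNIV. det (\<chi> k. if k = i then (\<chi> j. dA i j v) else A x $ k))"
      unfolding det_def row sum_distrib_left by (rule sum.swap)
    also have "\<dots> = det (A x) * (\<Sum>i\<in>UNIV. \<Sum>j\<in>UNIV. matrix_inv (A x) $ j $ i * dA i j v)"
      by (simp add: det_replace_row[OF nz] sum_distrib_left mult_ac)
    finally show ?thesis .
  qed
  ultimately show ?thesis
    by (simp add: det_def[symmetric])
qed

lemma sum_option: "(\<Sum>i\<in>UNIV. f i) = f None + (\<Sum>i\<in>UNIV. f (Some i))"
  for f :: "'b::finite option \<Rightarrow> 'c::comm_monoid_add"
  by (simp add: UNIV_option_conv sum.reindex inj_on_def)

lemma prod_option: "(\<Prod>i\<in>UNIV. f i) = f None * (\<Prod>i\<in>UNIV. f (Some i))"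
  for f :: "'b::finite option \<Rightarrow> 'c::comm_monoid_mult"
  by (simp add: UNIV_option_conv prod.reindex inj_on_def)

section \<open>Bilinear forms and orthonormal frames\<close>

lemma bilinear_eq_sum:
  fixes b :: "real ^ 'm \<Rightarrow> real ^ 'm \<Rightarrow> real"
  assumes "bilinear b"
  shows "b v w = (\<Sum>i\<in>UNIV. \<Sum>j\<in>UNIV. v $ i * w $ j * b (axis i 1) (axis j 1))"
proof -
  have l: "linear (\<lambda>v. b v w)" "linear (b v)" for v w
    using assms by (auto simp: bilinear_def)
  have "b v w = (\<Sum>i\<in>UNIV. v $ i * b (axis i 1) w)"
    by (subst vec_eq_sum_axis[of v]) (simp add: linear_sum[OF l(1)] linear_scale[OF l(1)])
  also have "\<dots> = (\<Sum>i\<in>UNIV. v $ i * (\<Sum>j\<in>UNIV. w $ j * b (axis i 1) (axis j 1)))"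
    by (intro sum.cong refl arg_cong2[of _ _ _ _ "(*)"], subst vec_eq_sum_axis[of w])
      (simp add: linear_sum[OF l(2)] linear_scale[OF l(2)])
  finally show ?thesis by (simp add: sum_distrib_left mult.assoc)
qed

text \<open>Gram-Schmidt for a form that may be indefinite: a vector u with b u u different from 0
  is split off, and its orthogonal complement in V is again nondegenerate, of dimension one
  less.\<close>

lemma orthonormal_set_exists:
  fixes b :: "'a::euclidean_space \<Rightarrow> 'a \<Rightarrow> real"
  assumes "bilinear b" "\<And>v w. b v w = b w v" "subspace V" "nondegenerate_on V b"
  shows "\<exists>B. B \<subseteq> V \<and> finite B \<and> card B = dim V \<and> (\<forall>v\<in>B. \<bar>b v v\<bar> = 1) \<and>
    (\<forall>v\<in>B. \<forall>w\<in>B. v \<noteq> w \<longrightarrow> b v w = 0)"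
  using assms(3,4)
proof (induction "dim V" arbitrary: V)
  case 0
  then show ?case by (intro exI[of _ "{}"]) auto
next
  case (Suc d)
  note bl = bilinear_ladd[OF assms(1)] bilinear_radd[OF assms(1)] bilinear_lmul[OF assms(1)]
    bilinear_rmul[OF assms(1)] bilinear_lsub[OF assms(1)] bilinear_lzero[OF assms(1)]
  have "\<not> V \<subseteq> {0}"
    using Suc.hyps(2) dim_eq_0[of V] by linarith
  then obtain v0 where "v0 \<in> V" "v0 \<noteq> 0" by auto
  then obtain w0 where vw: "v0 \<in> V" "w0 \<in> V" "b v0 w0 \<noteq> 0"
    using Suc.prems(2) unfolding nondegenerate_on_def by blast
  \<comment> \<open>Polarization: the value of the quadratic form at \<open>v0 + w0\<close> differs
    from the sum of its values at v0 and w0 by twice b v0 w0, so the three cannot all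
    vanish.\<close>
  have "b v0 v0 \<noteq> 0 \<or> b w0 w0 \<noteq> 0 \<or> b (v0 + w0) (v0 + w0) \<noteq> 0"
    using vw assms(2)[of w0 v0] by (auto simp: bl)
  then obtain u where u: "u \<in> V" "b u u \<noteq> 0"
    using vw Suc.prems(1) by (metis subspace_add)
  define e where "e = (1 / sqrt \<bar>b u u\<bar>) *\<^sub>R u"
  have e: "e \<in> V" "\<bar>b e e\<bar> = 1"
  proof -
    show "e \<in> V" using u Suc.prems(1) by (simp add: e_def subspace_scale)
    have "b e e = b u u / (sqrt \<bar>b u u\<bar> * sqrt \<bar>b u u\<bar>)" by (simp add: e_def bl)
    then show "\<bar>b e e\<bar> = 1" using u by (simp add: abs_mult)
  qed
  define W where "W = {x \<in> V. b x e = 0}"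
  have W: "subspace W"
    using Suc.prems(1) unfolding W_def subspace_def by (auto simp: bl)
  have eW: "e \<notin> span W"
    using e W by (auto simp: span_eq_iff[THEN iffD2] W_def)
  have split: "x - (b x e / b e e) *\<^sub>R e \<in> W" if "x \<in> V" for x
    using that e Suc.prems(1) by (auto simp: W_def bl subspace_diff subspace_scale)
  have "V = span (insert e W)"
  proof
    show "V \<subseteq> span (insert e W)"
    proof
      fix x assume "x \<in> V"
      have "x = (b x e / b e e) *\<^sub>R e + (x - (b x e / b e e) *\<^sub>R e)" by simp
      then show "x \<in> span (insert e W)"
        using split[OF \<open>x \<in> V\<close>] by (metis insertI1 insertI2 span_add span_base span_scale)
    qed
    show "span (insert e W) \<subseteq> V"
      using e Suc.prems(1) by (intro span_minimal) (auto simp: W_def)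
  qed
  then have "dim V = dim W + 1"
    using eW by (metis dim_insert dim_span)
  then have dW: "d = dim W" using Suc.hyps(2) by simp
  have "nondegenerate_on W b"
    unfolding nondegenerate_on_def
  proof (intro ballI impI)
    fix v assume v: "v \<in> W" "v \<noteq> 0"
    then obtain w where w: "w \<in> V" "b v w \<noteq> 0"
      using Suc.prems(2) by (auto simp: nondegenerate_on_def W_def)
    have "b v (w - (b w e / b e e) *\<^sub>R e) = b v w"
      using v by (simp add: bl bilinear_rsub[OF assms(1)] W_def)
    then show "\<exists>w\<in>W. b v w \<noteq> 0"
      using split[OF w(1)] w(2) by metis
  qed
  from Suc.hyps(1)[OF dW W this] obtain B where B: "B \<subseteq> W" "finite B" "card B = dim W"
    "\<forall>v\<in>B. \<bar>b v v\<bar> = 1" "\<forall>v\<in>B. \<forall>w\<in>B. v \<noteq> w \<longrightarrow> b v w = 0"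
    by blast
  have "e \<notin> B" using eW B(1) span_superset by blast
  moreover have "b v e = 0" "b e v = 0" if "v \<in> B" for v
    using that B(1) assms(2)[of e v] by (auto simp: W_def)
  ultimately show ?case
    using B e dW Suc.hyps(2) by (intro exI[of _ "insert e B"]) (auto simp: W_def)
qed

text \<open>\<open>S_mix\<close> picks its frame by \<open>SOME\<close>; existence is what makes the
  chosen frame orthonormal.\<close>

lemma leaf_frame_exists:
  fixes g :: "'n::finite tensor2"
  assumes "bilinear (g x)" "\<And>v w. g x v w = g x w v" "nondegenerate_on leaf_tangent (g x)"
  shows "\<exists>E. leaf_frame g x E"
proof -
  have eq: "leaf_tangent = {v :: 'n point. axis None 1 \<bullet> v = 0}"
    by (simp add: leaf_tangent_def inner_axis')
  have "dim (leaf_tangent :: 'n point set) = CARD('n)"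
    unfolding eq by (subst dim_hyperplane) (auto simp: axis_eq_0_iff)
  moreover have "subspace (leaf_tangent :: 'n point set)"
    by (simp add: eq subspace_hyperplane)
  ultimately have "\<exists>B. B \<subseteq> (leaf_tangent :: 'n point set) \<and> finite B \<and> card B = CARD('n) \<and>
      (\<forall>v\<in>B. \<bar>g x v v\<bar> = 1) \<and> (\<forall>v\<in>B. \<forall>w\<in>B. v \<noteq> w \<longrightarrow> g x v w = 0)"
    using orthonormal_set_exists[OF assms(1,2) _ assms(3)] by simp
  then obtain B where B: "B \<subseteq> (leaf_tangent :: 'n point set)" "finite B" "card B = CARD('n)"
    "\<forall>v\<in>B. \<bar>g x v v\<bar> = 1" "\<forall>v\<in>B. \<forall>w\<in>B. v \<noteq> w \<longrightarrow> g x v w = 0"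
    by blast
  then obtain E where "bij_betw E (UNIV :: 'n set) B"
    using finite_same_card_bij[of "UNIV :: 'n set" B] by auto
  then have E: "E a \<in> B" "a \<noteq> b \<Longrightarrow> E a \<noteq> E b" for a b
    by (auto simp: bij_betw_def inj_on_def)
  have "leaf_frame g x E"
    unfolding leaf_frame_def
  proof (intro conjI allI impI)
    show "E a \<in> leaf_tangent" "\<bar>g x (E a) (E a)\<bar> = 1" for a
      using E(1)[of a] B by auto
    show "g x (E a) (E b) = 0" if "a \<noteq> b" for a b
      using E(1)[of a] E(1)[of b] E(2)[OF that] B(5) by auto
  qed
  then show ?thesis by (rule exI[of _ E])
qed

text \<open>The matrix Q with columns \<open>e \<mu>\<close> has a left inverse L, obtained by
  lowering the index with G and multiplying by the sign; L Q = 1 is the orthonormality. For square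
  matrices Q L = 1 follows, which collapses the sum over the frame to the coordinate trace.\<close>

lemma trace_orthonormal:
  fixes A G :: "real ^ 'm ^ 'm" and e :: "'m \<Rightarrow> real ^ 'm"
  assumes orth: "\<And>\<mu> \<nu>. (\<Sum>i\<in>UNIV. \<Sum>j\<in>UNIV. e \<mu> $ i * e \<nu> $ j * G $ i $ j) = (if \<mu> = \<nu> then \<eta> \<mu> else 0)"
    and \<eta>: "\<And>\<mu>. \<eta> \<mu> * \<eta> \<mu> = 1"
  shows "(\<Sum>\<mu>\<in>UNIV. \<eta> \<mu> * (\<Sum>k\<in>UNIV. \<Sum>j\<in>UNIV. (\<Sum>i\<in>UNIV. e \<mu> $ i * A $ i $ k) * e \<mu> $ j * G $ k $ j))
    = (\<Sum>k\<in>UNIV. A $ k $ k)"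
proof -
  define Q :: "real ^ 'm ^ 'm" where "Q = (\<chi> k \<mu>. e \<mu> $ k)"
  define L :: "real ^ 'm ^ 'm" where "L = (\<chi> \<mu> k. \<eta> \<mu> * (\<Sum>j\<in>UNIV. e \<mu> $ j * G $ k $ j))"
  have "(L ** Q) $ \<mu> $ \<nu> = (mat 1 :: real ^ 'm ^ 'm) $ \<mu> $ \<nu>" for \<mu> \<nu>
  proof -
    have "(L ** Q) $ \<mu> $ \<nu> = \<eta> \<mu> * (\<Sum>k\<in>UNIV. \<Sum>j\<in>UNIV. e \<nu> $ k * e \<mu> $ j * G $ k $ j)"
      by (simp add: matrix_matrix_mult_def L_def Q_def sum_distrib_left sum_distrib_right mult_ac)
    then show ?thesis
      unfolding orth by (simp add: \<eta> mat_def)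
  qed
  then have "L ** Q = mat 1" by (simp add: vec_eq_iff)
  then have "Q ** L = mat 1" using matrix_left_right_inverse by blast
  then have QL: "(\<Sum>\<mu>\<in>UNIV. Q $ i $ \<mu> * L $ \<mu> $ k) = (if i = k then 1 else 0)" for i k
    by (simp add: matrix_matrix_mult_def mat_def vec_eq_iff)
  have "(\<Sum>\<mu>\<in>UNIV. \<eta> \<mu> * (\<Sum>k\<in>UNIV. \<Sum>j\<in>UNIV. (\<Sum>i\<in>UNIV. e \<mu> $ i * A $ i $ k) * e \<mu> $ j * G $ k $ j))
    = (\<Sum>\<mu>\<in>UNIV. \<Sum>k\<in>UNIV. \<Sum>i\<in>UNIV. A $ i $ k * (Q $ i $ \<mu> * L $ \<mu> $ k))"
  proof (rule sum.cong[OF refl])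
    fix \<mu>
    have "(\<Sum>j\<in>UNIV. (\<Sum>i\<in>UNIV. e \<mu> $ i * A $ i $ k) * e \<mu> $ j * G $ k $ j)
      = (\<Sum>i\<in>UNIV. e \<mu> $ i * A $ i $ k) * (\<Sum>j\<in>UNIV. e \<mu> $ j * G $ k $ j)" for k
      by (simp add: sum_distrib_left mult.assoc)
    then have eq: "\<eta> \<mu> * (\<Sum>k\<in>UNIV. \<Sum>j\<in>UNIV. (\<Sum>i\<in>UNIV. e \<mu> $ i * A $ i $ k) * e \<mu> $ j * G $ k $ j)
      = (\<Sum>k\<in>UNIV. (\<Sum>i\<in>UNIV. e \<mu> $ i * A $ i $ k) * L $ \<mu> $ k)"
      by (simp add: L_def sum_distrib_left mult_ac)
    show "\<eta> \<mu> * (\<Sum>k\<in>UNIV. \<Sum>j\<in>UNIV. (\<Sum>i\<in>UNIV. e \<mu> $ i * A $ i $ k) * e \<mu> $ j * G $ k $ j)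
      = (\<Sum>k\<in>UNIV. \<Sum>i\<in>UNIV. A $ i $ k * (Q $ i $ \<mu> * L $ \<mu> $ k))"
      unfolding eq by (simp add: Q_def sum_distrib_left mult_ac)
  qed
  also have "\<dots> = (\<Sum>k\<in>UNIV. \<Sum>\<mu>\<in>UNIV. \<Sum>i\<in>UNIV. A $ i $ k * (Q $ i $ \<mu> * L $ \<mu> $ k))"
    by (rule sum.swap)
  also have "\<dots> = (\<Sum>k\<in>UNIV. \<Sum>i\<in>UNIV. \<Sum>\<mu>\<in>UNIV. A $ i $ k * (Q $ i $ \<mu> * L $ \<mu> $ k))"
    by (intro sum.cong refl sum.swap)
  also have "\<dots> = (\<Sum>k\<in>UNIV. \<Sum>i\<in>UNIV. A $ i $ k * (if i = k then 1 else 0))"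
    by (simp add: sum_distrib_left[symmetric] QL)
  also have "\<dots> = (\<Sum>k\<in>UNIV. A $ k $ k)"
    by (simp add: if_distrib[of "(*) _"] cong: if_cong)
  finally show ?thesis .
qed

section \<open>Mixed scalar curvature of a codimension-one foliation\<close>

text \<open>Component k of the covariant derivative of N in direction i, without the customary minus
  sign. With this convention the mean curvature is the divergence of N.\<close>

definition shape :: "'n::finite tensor2 \<Rightarrow> 'n option \<Rightarrow> 'n option \<Rightarrow> 'n point \<Rightarrow> real" where
  "shape g i k x = pderiv (\<lambda>z. unit_normal g z $ k) i x
     + (\<Sum>j\<in>UNIV. christoffel g x k i j * unit_normal g x $ j)"

definition mean_curv :: "'n::finite tensor2 \<Rightarrow> 'n point \<Rightarrow> real" where
  "mean_curv g x = (\<Sum>k\<in>UNIV. shape g k k x)"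

definition accel :: "'n::finite tensor2 \<Rightarrow> 'n option \<Rightarrow> 'n point \<Rightarrow> real" where
  "accel g k x = (\<Sum>i\<in>UNIV. unit_normal g x $ i * shape g i k x)"

definition vol_density :: "'n::finite tensor2 \<Rightarrow> 'n point \<Rightarrow> real" where
  "vol_density g x = sqrt \<bar>det (gram g x)\<bar>"

text \<open>The vector density of \<open>\<nabla>\<^sub>N N - H N + 2 (n - 1) c N\<close>. The first
  two terms come from the Ricci identity; the last one absorbs the term \<open>2 (n - 1) c H\<close>
  that arises when c is split off from A, because H is the divergence of N.\<close>

definition flux :: "'n::finite tensor2 \<Rightarrow> real \<Rightarrow> 'n option \<Rightarrow> 'n point \<Rightarrow> real" where
  "flux g c k x = vol_density g x * (accel g k x - unit_normal g x $ k * mean_curv g x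
     + 2 * (real CARD('n) - 1) * c * unit_normal g x $ k)"

text \<open>The leaf block of T. It carries the whole remainder, since every covariant derivative of
  N is tangent to the leaves (\<open>shape_None\<close>).\<close>

definition leaf_shape_dev :: "'n::finite tensor2 \<Rightarrow> real \<Rightarrow> 'n \<Rightarrow> 'n \<Rightarrow> 'n point \<Rightarrow> real" where
  "leaf_shape_dev g c i k x = shape g (Some i) (Some k) x - (if i = k then c else 0)"

lemma sum_antisym_zero:
  fixes f :: "'i \<Rightarrow> 'i \<Rightarrow> real"
  assumes "\<And>i j. f i j = - f j i"
  shows "(\<Sum>i\<in>A. \<Sum>j\<in>A. f i j) = 0"
proof -
  have "(\<Sum>i\<in>A. \<Sum>j\<in>A. f i j) = (\<Sum>i\<in>A. \<Sum>j\<in>A. - f i j)"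
    by (subst sum.swap, intro sum.cong refl, rule assms)
  then show ?thesis by (simp add: sum_negf)
qed

text \<open>
  The contracted Ricci identity \<open>Ric(N,N) = div(\<nabla>\<^sub>N N) - N(div N) - tr((\<nabla>N)\<^sup>2)\<close>, in components.
\<close>

lemma contracted_ricci_identity:
  fixes n :: "'i::finite \<Rightarrow> real" and \<Gamma> ddn :: "'i \<Rightarrow> 'i \<Rightarrow> 'i \<Rightarrow> real"
    and d\<Gamma> :: "'i \<Rightarrow> 'i \<Rightarrow> 'i \<Rightarrow> 'i \<Rightarrow> real" and dn M :: "'i \<Rightarrow> 'i \<Rightarrow> real"
  assumes M: "\<And>i k. M i k = dn i k + (\<Sum>j\<in>UNIV. \<Gamma> k i j * n j)"
    and sym: "\<And>k i j. \<Gamma> k i j = \<Gamma> k j i" "\<And>l i k. ddn l i k = ddn i l k"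
  shows "(\<Sum>k\<in>UNIV. (\<Sum>i\<in>UNIV. \<Sum>j\<in>UNIV. d\<Gamma> k k i j * n i * n j)
        + (\<Sum>m\<in>UNIV. \<Gamma> k k m * (\<Sum>i\<in>UNIV. \<Sum>j\<in>UNIV. \<Gamma> m i j * n i * n j))
        - (\<Sum>i\<in>UNIV. n i * (\<Sum>j\<in>UNIV. d\<Gamma> i k k j * n j))
        - (\<Sum>i\<in>UNIV. \<Sum>m\<in>UNIV. \<Gamma> k i m * n i * (\<Sum>j\<in>UNIV. \<Gamma> m k j * n j)))
    = (\<Sum>k\<in>UNIV. (\<Sum>i\<in>UNIV. dn k i * M i k
          + n i * (ddn k i k + (\<Sum>j\<in>UNIV. d\<Gamma> k k i j * n j + \<Gamma> k i j * dn k j)))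
        + (\<Sum>j\<in>UNIV. \<Gamma> k k j * (\<Sum>i\<in>UNIV. n i * M i j)))
      - (\<Sum>l\<in>UNIV. n l * (\<Sum>k\<in>UNIV. ddn l k k + (\<Sum>j\<in>UNIV. d\<Gamma> l k k j * n j + \<Gamma> k k j * dn l j)))
      - (\<Sum>i\<in>UNIV. \<Sum>k\<in>UNIV. M i k * M k i)"
    (is "?L = ?R1 - ?R2 - ?R3")
proof -
  define B where "B i k = (\<Sum>j\<in>UNIV. \<Gamma> k i j * n j)" for i k
  \<comment> \<open>The sums \<open>T1\<close> to \<open>T4\<close> contain no derivative of n, the
    sums \<open>A1\<close> to \<open>A4\<close> do. The left-hand side is T1 + T2 - T3 - T4, and on
    the right-hand side all the A cancel.\<close>
  define T1 where "T1 = (\<Sum>k\<in>UNIV. \<Sum>i\<in>UNIV. \<Sum>j\<in>UNIV. d\<Gamma> k k i j * n i * n j)"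
  define T2 where "T2 = (\<Sum>k\<in>UNIV. \<Sum>m\<in>UNIV. \<Gamma> k k m * (\<Sum>i\<in>UNIV. n i * B i m))"
  define T3 where "T3 = (\<Sum>k\<in>UNIV. \<Sum>i\<in>UNIV. n i * (\<Sum>j\<in>UNIV. d\<Gamma> i k k j * n j))"
  define T4 where "T4 = (\<Sum>i\<in>UNIV. \<Sum>k\<in>UNIV. B i k * B k i)"
  define A1 where "A1 = (\<Sum>k\<in>UNIV. \<Sum>i\<in>UNIV. dn k i * M i k)"
  define A2 where "A2 = (\<Sum>k\<in>UNIV. \<Sum>i\<in>UNIV. n i * ddn k i k)"
  define A3 where "A3 = (\<Sum>i\<in>UNIV. \<Sum>k\<in>UNIV. dn i k * B k i)"
  define A4 where "A4 = (\<Sum>k\<in>UNIV. \<Sum>m\<in>UNIV. \<Gamma> k k m * (\<Sum>i\<in>UNIV. n i * dn i m))"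
  have MB: "M i k = dn i k + B i k" for i k by (simp add: M B_def)
  have "(\<Sum>k\<in>UNIV. \<Sum>m\<in>UNIV. \<Gamma> k k m * (\<Sum>i\<in>UNIV. \<Sum>j\<in>UNIV. \<Gamma> m i j * n i * n j)) = T2"
    unfolding T2_def B_def by (simp add: sum_distrib_left mult_ac)
  moreover have "(\<Sum>k\<in>UNIV. \<Sum>i\<in>UNIV. \<Sum>m\<in>UNIV. \<Gamma> k i m * n i * (\<Sum>j\<in>UNIV. \<Gamma> m k j * n j)) = T4"
  proof -
    have "(\<Sum>i\<in>UNIV. \<Sum>m\<in>UNIV. \<Gamma> k i m * n i * (\<Sum>j\<in>UNIV. \<Gamma> m k j * n j)) = (\<Sum>m\<in>UNIV. B m k * B k m)" for k
    proof (subst sum.swap, rule sum.cong[OF refl])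
      fix m
      have "(\<Sum>i\<in>UNIV. \<Gamma> k i m * n i) = B m k" by (simp add: B_def sym(1)[of k _ m])
      then show "(\<Sum>i\<in>UNIV. \<Gamma> k i m * n i * (\<Sum>j\<in>UNIV. \<Gamma> m k j * n j)) = B m k * B k m"
        by (simp add: sum_distrib_right[symmetric] B_def[of k m, symmetric])
    qed
    then show ?thesis by (simp add: T4_def mult.commute)
  qed
  ultimately have L: "?L = T1 + T2 - T3 - T4"
    by (simp add: sum.distrib sum_subtractf T1_def T3_def)
  have "(\<Sum>k\<in>UNIV. \<Sum>i\<in>UNIV. n i * (\<Sum>j\<in>UNIV. d\<Gamma> k k i j * n j)) = T1"
    by (simp add: T1_def sum_distrib_left mult_ac)
  moreover have "(\<Sum>k\<in>UNIV. \<Sum>i\<in>UNIV. n i * (\<Sum>j\<in>UNIV. \<Gamma> k i j * dn k j)) = A3"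
  proof -
    have "(\<Sum>i\<in>UNIV. n i * (\<Sum>j\<in>UNIV. \<Gamma> k i j * dn k j)) = (\<Sum>j\<in>UNIV. dn k j * B j k)" for k
      unfolding B_def sum_distrib_left
      by (subst sum.swap) (simp add: sym(1)[of k] mult_ac)
    then show ?thesis by (simp add: A3_def)
  qed
  moreover have "(\<Sum>k\<in>UNIV. \<Sum>j\<in>UNIV. \<Gamma> k k j * (\<Sum>i\<in>UNIV. n i * M i j)) = A4 + T2"
    by (simp add: MB A4_def T2_def distrib_left sum.distrib)
  ultimately have R1: "?R1 = A1 + A2 + T1 + A3 + A4 + T2"
    by (simp add: sum.distrib distrib_left A1_def A2_def)
  have "(\<Sum>l\<in>UNIV. n l * (\<Sum>k\<in>UNIV. ddn l k k)) = A2"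
    unfolding A2_def sum_distrib_left by (subst sum.swap) (simp add: sym(2))
  moreover have "(\<Sum>l\<in>UNIV. n l * (\<Sum>k\<in>UNIV. \<Sum>j\<in>UNIV. d\<Gamma> l k k j * n j)) = T3"
    unfolding T3_def sum_distrib_left by (rule sum.swap)
  moreover have "(\<Sum>l\<in>UNIV. n l * (\<Sum>k\<in>UNIV. \<Sum>j\<in>UNIV. \<Gamma> k k j * dn l j)) = A4"
  proof -
    have "(\<Sum>l\<in>UNIV. n l * (\<Sum>k\<in>UNIV. \<Sum>j\<in>UNIV. \<Gamma> k k j * dn l j))
      = (\<Sum>l\<in>UNIV. \<Sum>k\<in>UNIV. \<Sum>j\<in>UNIV. \<Gamma> k k j * (n l * dn l j))"
      by (simp add: sum_distrib_left mult_ac)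
    also have "\<dots> = (\<Sum>k\<in>UNIV. \<Sum>l\<in>UNIV. \<Sum>j\<in>UNIV. \<Gamma> k k j * (n l * dn l j))"
      by (rule sum.swap)
    also have "\<dots> = (\<Sum>k\<in>UNIV. \<Sum>j\<in>UNIV. \<Sum>l\<in>UNIV. \<Gamma> k k j * (n l * dn l j))"
      by (intro sum.cong refl sum.swap)
    finally show ?thesis by (simp add: A4_def sum_distrib_left)
  qed
  ultimately have R2: "?R2 = A2 + T3 + A4"
    by (simp add: sum.distrib distrib_left)
  have "(\<Sum>i\<in>UNIV. \<Sum>k\<in>UNIV. M i k * M k i)
      = (\<Sum>i\<in>UNIV. \<Sum>k\<in>UNIV. dn k i * M i k) + (\<Sum>i\<in>UNIV. \<Sum>k\<in>UNIV. dn i k * B k i) + T4"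
    by (simp add: T4_def sum.distrib[symmetric] MB algebra_simps)
  moreover have "(\<Sum>i\<in>UNIV. \<Sum>k\<in>UNIV. dn k i * M i k) = A1"
    unfolding A1_def by (rule sum.swap)
  ultimately have R3: "?R3 = A1 + A3 + T4"
    by (simp add: A3_def)
  show ?thesis unfolding L R1 R2 R3 by simp
qed

section \<open>Covariant derivatives of the unit normal in coordinates\<close>

lemma nabla_component:
  "nabla g X Y x $ k = frechet_derivative (\<lambda>z. Y z $ k) (at x) (X x)
     + (\<Sum>i\<in>UNIV. \<Sum>j\<in>UNIV. christoffel g x k i j * X x $ i * Y x $ j)"
  by (simp add: nabla_def)

lemma divergence_eq:
  "divergence g X x = (\<Sum>k\<in>UNIV. pderiv (\<lambda>z. X z $ k) k x)
     + (\<Sum>k\<in>UNIV. \<Sum>j\<in>UNIV. christoffel g x k k j * X x $ j)"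
proof -
  have "(\<Sum>i\<in>UNIV. \<Sum>j\<in>UNIV. christoffel g x k i j * (axis k 1 :: real ^ 'a option) $ i * X x $ j)
      = (\<Sum>j\<in>UNIV. christoffel g x k k j * X x $ j)" for k
  proof -
    have "(\<Sum>i\<in>UNIV. \<Sum>j\<in>UNIV. christoffel g x k i j * (axis k 1 :: real ^ 'a option) $ i * X x $ j)
      = (\<Sum>i\<in>UNIV. if i = k then \<Sum>j\<in>UNIV. christoffel g x k i j * X x $ j else 0)"
      by (intro sum.cong) (auto simp: axis_def)
    then show ?thesis by simp
  qed
  then show ?thesis
    unfolding divergence_def nabla_component pderiv_def by (simp add: sum.distrib)
qed

text \<open>The condition \<open>inv_pos\<close> says that dx_0 has positive square length, i.e.
  that the normal is spacelike; the leaves may have any signature. Both the model on the whole space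
  and the varied metrics on \<Omega> are instances.\<close>

locale foliated_metric =
  fixes V :: "'n::finite point set" and g :: "'n tensor2"
  assumes open_V: "open V"
    and bilin: "x \<in> V \<Longrightarrow> bilinear (g x)"
    and sym: "x \<in> V \<Longrightarrow> g x v w = g x w v"
    and smooth: "smooth_on V (\<lambda>x. g x v w)"
    and det_nz: "x \<in> V \<Longrightarrow> det (gram g x) \<noteq> 0"
    and inv_pos: "x \<in> V \<Longrightarrow> matrix_inv (gram g x) $ None $ None > 0"
begin

abbreviation "G i j z \<equiv> gram g z $ i $ j"
abbreviation "P i j z \<equiv> matrix_inv (gram g z) $ i $ j"
abbreviation "\<Gamma> k i j z \<equiv> christoffel g z k i j"
abbreviation "N k z \<equiv> unit_normal g z $ k"

lemma g_eq: "x \<in> V \<Longrightarrow> g x v w = (\<Sum>i\<in>UNIV. \<Sum>j\<in>UNIV. v $ i * w $ j * G i j x)"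
  using bilinear_eq_sum[OF bilin] by (simp add: gram_def)

lemma G_sym: "x \<in> V \<Longrightarrow> G i j x = G j i x"
  using sym by (simp add: gram_def)

lemma P_sym: "x \<in> V \<Longrightarrow> P i j x = P j i x"
  using matrix_inv_symmetric det_nz G_sym by metis

lemma G_smooth: "smooth_on V (\<lambda>z. G i j z)"
  using smooth by (simp add: gram_def)

lemma det_smooth: "smooth_on V (\<lambda>z. det (gram g z))"
  using open_V G_smooth by (rule smooth_on_det)

lemma P_smooth: "smooth_on V (\<lambda>z. P k l z)"
proof -
  have "smooth_on V (\<lambda>z. (\<chi> i j. if j = k then axis l 1 $ i else G i j z) $ i $ j)" for i j
    by (cases "j = k") (simp_all add: G_smooth)
  then have "smooth_on V (\<lambda>z. det (\<chi> i j. if j = k then axis l 1 $ i else G i j z) / det (gram g z))"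
    by (intro smooth_on_divide smooth_on_det open_V det_nz G_smooth)
  then show ?thesis
    by (subst smooth_on_cong[OF open_V matrix_inv_cramer[OF det_nz]])
qed

lemma G_diff: "x \<in> V \<Longrightarrow> (\<lambda>z. G i j z) differentiable (at x)"
  using G_smooth smooth_on_differentiable by blast

lemma P_diff: "x \<in> V \<Longrightarrow> (\<lambda>z. P i j z) differentiable (at x)"
  using P_smooth smooth_on_differentiable by blast

lemma dG_sym: "x \<in> V \<Longrightarrow> pderiv (\<lambda>z. G i j z) m x = pderiv (\<lambda>z. G j i z) m x"
  by (rule pderiv_cong_open[OF open_V _ G_sym])

text \<open>Differentiating G P = 1. Only first derivatives of G and undifferentiated entries of P
  remain, which is the form that the Lipschitz estimates use.\<close>

lemma pderiv_P:
  assumes "x \<in> V"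
  shows "pderiv (\<lambda>z. P k j z) m x = - (\<Sum>a\<in>UNIV. \<Sum>b\<in>UNIV. P k a x * pderiv (\<lambda>z. G a b z) m x * P b j x)"
proof -
  have 0: "(\<Sum>l\<in>UNIV. G a l x * pderiv (\<lambda>z. P l j z) m x) = - (\<Sum>l\<in>UNIV. pderiv (\<lambda>z. G a l z) m x * P l j x)" for a
  proof -
    have "pderiv (\<lambda>z. \<Sum>l\<in>UNIV. G a l z * P l j z) m x = pderiv (\<lambda>z. if a = j then 1 else 0) m x"
      by (rule pderiv_cong_open[OF open_V assms matrix_inv_sum(1)[OF det_nz]])
    moreover have "pderiv (\<lambda>z. \<Sum>l\<in>UNIV. G a l z * P l j z) m x
        = (\<Sum>l\<in>UNIV. G a l x * pderiv (\<lambda>z. P l j z) m x + pderiv (\<lambda>z. G a l z) m x * P l j x)"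
      by (subst pderiv_sum) (auto intro!: sum.cong pderiv_mult G_diff P_diff differentiable_mult assms)
    ultimately show ?thesis by (simp add: sum.distrib)
  qed
  have "(\<Sum>a\<in>UNIV. P k a x * (\<Sum>l\<in>UNIV. G a l x * pderiv (\<lambda>z. P l j z) m x))
      = (\<Sum>l\<in>UNIV. (\<Sum>a\<in>UNIV. P k a x * G a l x) * pderiv (\<lambda>z. P l j z) m x)"
    unfolding sum_distrib_left sum_distrib_right by (subst sum.swap) (simp add: mult.assoc)
  also have "\<dots> = pderiv (\<lambda>z. P k j z) m x"
    by (simp add: matrix_inv_sum(2)[OF det_nz[OF assms]] if_distrib[of "\<lambda>t. t * _"] cong: if_cong)
  finally have "pderiv (\<lambda>z. P k j z) m x
      = (\<Sum>a\<in>UNIV. P k a x * (\<Sum>l\<in>UNIV. G a l x * pderiv (\<lambda>z. P l j z) m x))" ..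
  also have "\<dots> = - (\<Sum>a\<in>UNIV. \<Sum>b\<in>UNIV. P k a x * pderiv (\<lambda>z. G a b z) m x * P b j x)"
    unfolding 0 by (simp add: sum_negf sum_distrib_left mult.assoc)
  finally show ?thesis .
qed

text \<open>This column is the gradient of x_0.\<close>

lemma g_column:
  assumes "x \<in> V"
  shows "g x (column None (matrix_inv (gram g x))) w = w $ None"
proof -
  have "g x (column None (matrix_inv (gram g x))) w
      = (\<Sum>j\<in>UNIV. w $ j * (\<Sum>i\<in>UNIV. G j i x * P i None x))"
    unfolding g_eq[OF assms] column_def sum_distrib_left
    by (subst sum.swap) (simp add: G_sym[OF assms] mult_ac)
  also have "\<dots> = w $ None"
    by (simp add: matrix_inv_sum(1)[OF det_nz[OF assms]] if_distrib[of "(*) _"] cong: if_cong)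
  finally show ?thesis .
qed

lemma normal_space_iff:
  assumes "x \<in> V"
  shows "v \<in> normal_space g x \<longleftrightarrow> (\<exists>c. v = c *\<^sub>R column None (matrix_inv (gram g x)))"
proof
  assume v: "v \<in> normal_space g x"
  define q where "q j = (\<Sum>i\<in>UNIV. v $ i * G i j x)" for j
  have gq: "g x v w = (\<Sum>j\<in>UNIV. w $ j * q j)" for w
    unfolding g_eq[OF assms] q_def by (subst sum.swap) (simp add: sum_distrib_left mult_ac)
  have "q (Some i) = 0" for i
  proof -
    have "(axis (Some i) 1 :: 'n point) \<in> leaf_tangent" by (simp add: leaf_tangent_def axis_def)
    then have "g x v (axis (Some i) 1) = 0" using v by (auto simp: normal_space_def)
    then show ?thesis by (simp add: gq axis_def if_distrib[of "\<lambda>t. t * _"] cong: if_cong)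
  qed
  then have q: "q j = (if j = None then q None else 0)" for j by (cases j) auto
  have "v $ k = q None * P k None x" for k
  proof -
    have "v $ k = (\<Sum>i\<in>UNIV. v $ i * (\<Sum>j\<in>UNIV. G i j x * P j k x))"
      by (simp add: matrix_inv_sum(1)[OF det_nz[OF assms]] if_distrib[of "(*) _"] cong: if_cong)
    also have "\<dots> = (\<Sum>j\<in>UNIV. q j * P j k x)"
      unfolding q_def sum_distrib_left sum_distrib_right by (subst sum.swap) (simp add: mult_ac)
    also have "\<dots> = q None * P None k x"
      by (subst q) (simp add: if_distrib[of "\<lambda>t. t * _"] cong: if_cong)
    finally show ?thesis using P_sym[OF assms] by simp
  qed
  then show "\<exists>c. v = c *\<^sub>R column None (matrix_inv (gram g x))"
    by (intro exI[of _ "q None"]) (simp add: vec_eq_iff column_def)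
next
  assume "\<exists>c. v = c *\<^sub>R column None (matrix_inv (gram g x))"
  then obtain c where c: "v = c *\<^sub>R column None (matrix_inv (gram g x))" by blast
  show "v \<in> normal_space g x"
    by (simp add: normal_space_def c bilinear_lmul[OF bilin[OF assms]] g_column[OF assms] leaf_tangent_def)
qed

text \<open>The gradient of x_0 is normal to the leaves and has square length
  \<open>P None None x\<close>. This is also its x_0-component, and its positivity settles the
  orientation.\<close>

lemma unit_normal_eq:
  assumes "x \<in> V"
  shows "unit_normal g x = (1 / sqrt (P None None x)) *\<^sub>R column None (matrix_inv (gram g x))"
  unfolding unit_normal_def
proof (rule the_equality)
  let ?p = "P None None x" and ?w = "column None (matrix_inv (gram g x))"
  note p = inv_pos[OF assms]
  have w: "?w $ None = ?p" by (simp add: column_def)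
  have gc: "g x (c *\<^sub>R ?w) (c *\<^sub>R ?w) = c * c * ?p" for c
    by (simp add: bilinear_lmul[OF bilin[OF assms]] bilinear_rmul[OF bilin[OF assms]] g_column[OF assms] w)
  show "(1 / sqrt ?p) *\<^sub>R ?w \<in> normal_space g x \<and>
      \<bar>g x ((1 / sqrt ?p) *\<^sub>R ?w) ((1 / sqrt ?p) *\<^sub>R ?w)\<bar> = 1 \<and> 0 < ((1 / sqrt ?p) *\<^sub>R ?w) $ None"
    unfolding gc normal_space_iff[OF assms] using p by (auto simp: column_def)
  fix v assume v: "v \<in> normal_space g x \<and> \<bar>g x v v\<bar> = 1 \<and> 0 < v $ None"
  then obtain c where c: "v = c *\<^sub>R ?w" unfolding normal_space_iff[OF assms] by blast
  have "c > 0" using v p by (simp add: c column_def zero_less_mult_iff)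
  have "c * c * ?p = 1" using v p unfolding c gc by (simp add: abs_mult)
  moreover have "(c * sqrt ?p)\<^sup>2 = c * c * ?p"
    using p by (simp add: power_mult_distrib power2_eq_square[of c])
  ultimately have "(c * sqrt ?p)\<^sup>2 = 1" by simp
  then have "c * sqrt ?p = 1" using \<open>c > 0\<close> p by (simp add: power2_eq_1_iff)
      (smt (verit) mult_pos_pos real_sqrt_gt_zero)
  then have "c = 1 / sqrt ?p" using p by (simp add: field_simps)
  then show "v = (1 / sqrt ?p) *\<^sub>R ?w" using c by simp
qed

lemma N_eq: "x \<in> V \<Longrightarrow> N k x = P k None x / sqrt (P None None x)"
  by (simp add: unit_normal_eq column_def)

lemma g_N:
  assumes "x \<in> V"
  shows "g x (unit_normal g x) w = w $ None / sqrt (P None None x)"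
  by (simp add: unit_normal_eq[OF assms] bilinear_lmul[OF bilin[OF assms]] g_column[OF assms])

lemma normal_sign_eq: "x \<in> V \<Longrightarrow> normal_sign g x = 1"
  using inv_pos[of x] by (simp add: normal_sign_def g_N N_eq)

text \<open>The absolute value matches the form of \<open>smooth_on_sqrt_abs\<close> and
  \<open>lip_on_sqrt_abs\<close>, which cover quantities of either sign.\<close>

lemma N_eq': "x \<in> V \<Longrightarrow> N k x = P k None x / sqrt \<bar>P None None x\<bar>"
  using inv_pos[of x] by (simp add: N_eq)

lemma N_smooth: "smooth_on V (\<lambda>z. N k z)"
proof -
  have "P None None z \<noteq> 0" if "z \<in> V" for z
    using inv_pos[OF that] by simp
  then have "smooth_on V (\<lambda>z. P k None z / sqrt \<bar>P None None z\<bar>)"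
    by (intro smooth_on_divide smooth_on_sqrt_abs P_smooth open_V) auto
  then show ?thesis
    by (subst smooth_on_cong[OF open_V N_eq'])
qed

lemma christoffel_smooth: "smooth_on V (\<lambda>z. \<Gamma> k i j z)"
  unfolding christoffel_def
  by (intro smooth_on_divide smooth_on_sum smooth_on_mult smooth_on_add smooth_on_diff
      P_smooth smooth_on_pderiv G_smooth open_V smooth_on_const) auto

lemma christoffel_sym:
  assumes "x \<in> V"
  shows "\<Gamma> k i j x = \<Gamma> k j i x"
  unfolding christoffel_def dG_sym[OF assms, of i j] by (simp add: add.commute)

lemma shape_smooth: "smooth_on V (\<lambda>z. shape g i k z)"
  unfolding shape_def
  by (intro smooth_on_add smooth_on_sum smooth_on_mult christoffel_smooth N_smooth open_V smooth_on_pderiv)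

lemma mean_curv_smooth: "smooth_on V (mean_curv g)"
  unfolding mean_curv_def[abs_def] by (intro smooth_on_sum shape_smooth open_V)

lemma accel_smooth: "smooth_on V (accel g k)"
  unfolding accel_def[abs_def] by (intro smooth_on_sum smooth_on_mult shape_smooth N_smooth open_V)

lemma vol_density_smooth: "smooth_on V (vol_density g)"
  unfolding vol_density_def[abs_def] by (intro smooth_on_sqrt_abs det_smooth det_nz open_V)

lemma flux_smooth: "smooth_on V (flux g c k)"
  unfolding flux_def[abs_def]
  by (intro smooth_on_mult smooth_on_add smooth_on_diff smooth_on_const vol_density_smooth
      accel_smooth mean_curv_smooth N_smooth open_V)

lemma pderiv_N:
  assumes "x \<in> V"
  shows "pderiv (\<lambda>z. N k z) i x = pderiv (\<lambda>z. P k None z) i x / sqrt (P None None x)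
    - P k None x * pderiv (\<lambda>z. P None None z) i x / (2 * P None None x * sqrt (P None None x))"
proof -
  note p = inv_pos[OF assms]
  have "((\<lambda>z. P k None z) has_derivative frechet_derivative (\<lambda>z. P k None z) (at x)) (at x)"
    "((\<lambda>z. P None None z) has_derivative frechet_derivative (\<lambda>z. P None None z) (at x)) (at x)"
    using P_diff[OF assms] frechet_derivative_works by blast+
  from has_derivative_divide[OF this(1) has_derivative_sqrt_abs[OF this(2)]] p
  have "((\<lambda>z. P k None z / sqrt \<bar>P None None z\<bar>) has_derivative (\<lambda>v.
      - P k None x * (inverse (sqrt \<bar>P None None x\<bar>) *
        (frechet_derivative (\<lambda>z. P None None z) (at x) v * inverse (P None None x) * sqrt \<bar>P None None x\<bar> / 2)
        * inverse (sqrt \<bar>P None None x\<bar>))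
      + frechet_derivative (\<lambda>z. P k None z) (at x) v / sqrt \<bar>P None None x\<bar>)) (at x)"
    by simp
  from has_derivative_transform_within_open[OF this open_V assms N_eq'[symmetric]]
  have "((\<lambda>z. N k z) has_derivative (\<lambda>v.
      - P k None x * (inverse (sqrt \<bar>P None None x\<bar>) *
        (frechet_derivative (\<lambda>z. P None None z) (at x) v * inverse (P None None x) * sqrt \<bar>P None None x\<bar> / 2)
        * inverse (sqrt \<bar>P None None x\<bar>))
      + frechet_derivative (\<lambda>z. P k None z) (at x) v / sqrt \<bar>P None None x\<bar>)) (at x)" .
  from has_derivative_imp_pderiv[OF this, of i] p show ?thesis
    by (simp add: pderiv_def field_simps)
qed

text \<open>Compatibility of the connection with the inverse metric, for a diagonal entry. One of
  the three terms of the Christoffel symbol gives the derivative of the inverse by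
  \<open>pderiv_P\<close>; the other two form an antisymmetric double sum.\<close>

lemma christoffel_sum_inv:
  assumes "x \<in> V"
  shows "(\<Sum>j\<in>UNIV. \<Gamma> l i j x * P j l x) = - pderiv (\<lambda>z. P l l z) i x / 2"
proof -
  let ?d = "\<lambda>m a b. pderiv (\<lambda>z. G a b z) m x"
  have "(\<Sum>j\<in>UNIV. \<Gamma> l i j x * P j l x)
      = (\<Sum>j\<in>UNIV. \<Sum>m\<in>UNIV. P l m x * ?d i j m * P j l x) / 2
        + (\<Sum>j\<in>UNIV. \<Sum>m\<in>UNIV. P l m x * P j l x * (?d j i m - ?d m i j)) / 2"
    unfolding christoffel_def sum_divide_distrib sum_distrib_right sum.distrib[symmetric]
    by (intro sum.cong refl) (simp add: field_simps)
  also have "(\<Sum>j\<in>UNIV. \<Sum>m\<in>UNIV. P l m x * P j l x * (?d j i m - ?d m i j)) = 0"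
    by (rule sum_antisym_zero) (simp add: P_sym[OF assms, of l] algebra_simps)
  also have "(\<Sum>j\<in>UNIV. \<Sum>m\<in>UNIV. P l m x * ?d i j m * P j l x) = - pderiv (\<lambda>z. P l l z) i x"
    unfolding pderiv_P[OF assms] minus_minus
    by (subst sum.swap, intro sum.cong refl) (simp add: dG_sym[OF assms])
  finally show ?thesis by simp
qed

text \<open>N has constant length, so its covariant derivatives are tangent to the leaves. In
  components, the derivative of \<open>sqrt (P None None x)\<close>, the x_0-component of N, cancels
  the Christoffel term.\<close>

lemma shape_None:
  assumes "x \<in> V"
  shows "shape g i None x = 0"
proof -
  note p = inv_pos[OF assms]
  have "(\<Sum>j\<in>UNIV. \<Gamma> None i j x * N j x) = - pderiv (\<lambda>z. P None None z) i x / (2 * sqrt (P None None x))"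
    using christoffel_sum_inv[OF assms, of None i] p
    by (simp add: N_eq[OF assms] sum_divide_distrib[symmetric])
  then show ?thesis
    unfolding shape_def pderiv_N[OF assms] using p by (simp add: field_simps)
qed

text \<open>Up to the factor \<open>vol_density g x\<close>, both sides are half the trace of the
  inverse of G times the derivative of G: the left one by Jacobi's formula, the right one because
  the remaining Christoffel terms are antisymmetric.\<close>

lemma pderiv_vol_density:
  assumes "x \<in> V"
  shows "pderiv (vol_density g) j x = vol_density g x * (\<Sum>k\<in>UNIV. \<Gamma> k k j x)"
proof -
  let ?d = "\<lambda>m a b. pderiv (\<lambda>z. G a b z) m x"
  have "((\<lambda>z. det (gram g z)) has_derivative (\<lambda>v. det (gram g x) * (\<Sum>a\<in>UNIV. \<Sum>b\<in>UNIV.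
      P b a x * frechet_derivative (\<lambda>z. G a b z) (at x) v))) (at x)"
    by (rule has_derivative_det[where A = "gram g" and
          dA = "\<lambda>a b. frechet_derivative (\<lambda>z. G a b z) (at x)", OF _ det_nz[OF assms]])
      (use G_diff[OF assms] in \<open>simp add: frechet_derivative_works\<close>)
  from has_derivative_imp_pderiv[OF has_derivative_sqrt_abs[OF this det_nz[OF assms]], of j]
  have 1: "pderiv (vol_density g) j x = vol_density g x * (\<Sum>a\<in>UNIV. \<Sum>b\<in>UNIV. P b a x * ?d j a b) / 2"
    using det_nz[OF assms] by (simp add: vol_density_def[abs_def] pderiv_def)
  have "(\<Sum>k\<in>UNIV. \<Gamma> k k j x) = (\<Sum>a\<in>UNIV. \<Sum>b\<in>UNIV. P b a x * ?d j a b) / 2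
      + (\<Sum>a\<in>UNIV. \<Sum>b\<in>UNIV. P b a x * (?d a j b - ?d b a j)) / 2"
    unfolding christoffel_def sum_divide_distrib sum.distrib[symmetric]
    by (intro sum.cong refl) (simp add: field_simps P_sym[OF assms])
  also have "(\<Sum>a\<in>UNIV. \<Sum>b\<in>UNIV. P b a x * (?d a j b - ?d b a j)) = 0"
    by (rule sum_antisym_zero) (simp add: P_sym[OF assms] dG_sym[OF assms] algebra_simps)
  finally have "(\<Sum>k\<in>UNIV. \<Gamma> k k j x) = (\<Sum>a\<in>UNIV. \<Sum>b\<in>UNIV. P b a x * ?d j a b) / 2" by simp
  then show ?thesis unfolding 1 by (simp only: times_divide_eq_right)
qed

lemma N_diff: "x \<in> V \<Longrightarrow> (\<lambda>z. N k z) differentiable (at x)"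
  using N_smooth smooth_on_differentiable by blast

lemma nabla_N:
  assumes "x \<in> V"
  shows "nabla g (unit_normal g) (unit_normal g) x $ k = accel g k x"
proof -
  have "nabla g (unit_normal g) (unit_normal g) x $ k
      = (\<Sum>i\<in>UNIV. N i x * pderiv (\<lambda>z. N k z) i x)
        + (\<Sum>i\<in>UNIV. \<Sum>j\<in>UNIV. \<Gamma> k i j x * N i x * N j x)"
    unfolding nabla_component frechet_derivative_eq_sum_pderiv[OF N_diff[OF assms]] ..
  also have "\<dots> = accel g k x"
    by (simp add: accel_def shape_def distrib_left sum.distrib sum_distrib_left mult_ac)
  finally show ?thesis .
qed

lemma H_tilde_eq: "x \<in> V \<Longrightarrow> H_tilde g x $ k = accel g k x"
  by (simp add: H_tilde_def normal_sign_eq nabla_N)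

lemma divergence_H_tilde:
  assumes "x \<in> V"
  shows "divergence g (H_tilde g) x
    = (\<Sum>k\<in>UNIV. pderiv (accel g k) k x) + (\<Sum>k\<in>UNIV. \<Sum>j\<in>UNIV. \<Gamma> k k j x * accel g j x)"
proof -
  have "pderiv (\<lambda>z. H_tilde g z $ k) k x = pderiv (accel g k) k x" for k
    by (rule pderiv_cong_open[OF open_V assms H_tilde_eq])
  then show ?thesis by (simp add: divergence_eq H_tilde_eq[OF assms])
qed

end

section \<open>Curvature in components and the mixed scalar curvature as a trace\<close>

lemma sum_axis_mult:
  "(\<Sum>i\<in>UNIV. (axis l 1 :: real ^ 'm) $ i * f i) = f l"
  "(\<Sum>i\<in>UNIV. f i * (axis l 1 :: real ^ 'm) $ i) = f l"
  by (simp_all add: axis_def if_distrib[of "\<lambda>t. t * _"] if_distrib[of "(*) _"] cong: if_cong)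

context foliated_metric
begin

lemma christoffel_diff: "x \<in> V \<Longrightarrow> (\<lambda>z. \<Gamma> k i j z) differentiable (at x)"
  using christoffel_smooth smooth_on_differentiable by blast

lemma nabla_const_fields:
  "nabla g (\<lambda>_. u) (\<lambda>_. v) z $ m = (\<Sum>i\<in>UNIV. \<Sum>j\<in>UNIV. \<Gamma> m i j z * u $ i * v $ j)"
  by (simp add: nabla_component)

lemma frechet_derivative_nabla_const:
  assumes "x \<in> V"
  shows "frechet_derivative (\<lambda>z. nabla g (\<lambda>_. u) (\<lambda>_. v) z $ m) (at x) w
    = (\<Sum>l\<in>UNIV. w $ l * (\<Sum>i\<in>UNIV. \<Sum>j\<in>UNIV. pderiv (\<lambda>z. \<Gamma> m i j z) l x * u $ i * v $ j))"
proof -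
  have d: "(\<lambda>z. \<Gamma> m i j z * u $ i * v $ j) differentiable (at x)" for i j
    by (intro differentiable_mult christoffel_diff[OF assms] differentiable_const)
  have p: "pderiv (\<lambda>z. \<Gamma> m i j z * u $ i * v $ j) l x = pderiv (\<lambda>z. \<Gamma> m i j z) l x * u $ i * v $ j" for i j l
    using christoffel_diff[OF assms] by (simp add: pderiv_mult)
  have d': "(\<lambda>z. \<Sum>j\<in>UNIV. \<Gamma> m i j z * u $ i * v $ j) differentiable (at x)" for i
    using d by (intro differentiable_sum) auto
  have d'': "(\<lambda>z. \<Sum>i\<in>UNIV. \<Sum>j\<in>UNIV. \<Gamma> m i j z * u $ i * v $ j) differentiable (at x)"
    using d' by (intro differentiable_sum) auto
  have "pderiv (\<lambda>z. \<Sum>i\<in>UNIV. \<Sum>j\<in>UNIV. \<Gamma> m i j z * u $ i * v $ j) l x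
      = (\<Sum>i\<in>UNIV. \<Sum>j\<in>UNIV. pderiv (\<lambda>z. \<Gamma> m i j z) l x * u $ i * v $ j)" for l
    by (subst pderiv_sum, rule d', intro sum.cong refl, subst pderiv_sum, rule d, intro sum.cong refl p)
  then show ?thesis
    unfolding nabla_const_fields frechet_derivative_eq_sum_pderiv[OF d''] by simp
qed

lemma curvature_component:
  assumes "x \<in> V"
  shows "curvature g x u v w $ k
    = (\<Sum>l\<in>UNIV. u $ l * (\<Sum>i\<in>UNIV. \<Sum>j\<in>UNIV. pderiv (\<lambda>z. \<Gamma> k i j z) l x * v $ i * w $ j))
      + (\<Sum>i\<in>UNIV. \<Sum>m\<in>UNIV. \<Gamma> k i m x * u $ i * (\<Sum>a\<in>UNIV. \<Sum>b\<in>UNIV. \<Gamma> m a b x * v $ a * w $ b))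
      - (\<Sum>l\<in>UNIV. v $ l * (\<Sum>i\<in>UNIV. \<Sum>j\<in>UNIV. pderiv (\<lambda>z. \<Gamma> k i j z) l x * u $ i * w $ j))
      - (\<Sum>i\<in>UNIV. \<Sum>m\<in>UNIV. \<Gamma> k i m x * v $ i * (\<Sum>a\<in>UNIV. \<Sum>b\<in>UNIV. \<Gamma> m a b x * u $ a * w $ b))"
  unfolding curvature_def vector_minus_component nabla_component[of g "\<lambda>_. u" "nabla g (\<lambda>_. v) (\<lambda>_. w)"]
    nabla_component[of g "\<lambda>_. v" "nabla g (\<lambda>_. u) (\<lambda>_. w)"]
    frechet_derivative_nabla_const[OF assms]
  unfolding nabla_const_fields by simp

lemma linear_curvature:
  assumes "x \<in> V"
  shows "linear (\<lambda>u. curvature g x u v w $ k)"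
  unfolding curvature_component[OF assms]
  by (rule linearI) (simp_all add: algebra_simps sum.distrib sum_distrib_left)

lemma curvature_eq_sum:
  assumes "x \<in> V"
  shows "curvature g x u v w $ k = (\<Sum>l\<in>UNIV. u $ l * curvature g x (axis l 1) v w $ k)"
  using linear_sum[OF linear_curvature[OF assms], of "\<lambda>l. u $ l *\<^sub>R axis l 1" UNIV]
  by (simp add: vec_eq_sum_axis[symmetric] linear_scale[OF linear_curvature[OF assms]])

lemma curvature_axis_trace:
  assumes "x \<in> V"
  shows "curvature g x (axis k 1) v v $ k
    = (\<Sum>i\<in>UNIV. \<Sum>j\<in>UNIV. pderiv (\<lambda>z. \<Gamma> k i j z) k x * v $ i * v $ j)
      + (\<Sum>m\<in>UNIV. \<Gamma> k k m x * (\<Sum>i\<in>UNIV. \<Sum>j\<in>UNIV. \<Gamma> m i j x * v $ i * v $ j))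
      - (\<Sum>i\<in>UNIV. v $ i * (\<Sum>j\<in>UNIV. pderiv (\<lambda>z. \<Gamma> k k j z) i x * v $ j))
      - (\<Sum>i\<in>UNIV. \<Sum>m\<in>UNIV. \<Gamma> k i m x * v $ i * (\<Sum>j\<in>UNIV. \<Gamma> m k j x * v $ j))"
proof -
  have 1: "(\<Sum>i\<in>UNIV. \<Sum>m\<in>UNIV. \<Gamma> k i m x * (axis k 1 :: 'n point) $ i * F m)
      = (\<Sum>m\<in>UNIV. \<Gamma> k k m x * F m)" for F
  proof -
    have "(\<Sum>i\<in>UNIV. \<Sum>m\<in>UNIV. \<Gamma> k i m x * (axis k 1 :: 'n point) $ i * F m)
      = (\<Sum>i\<in>UNIV. (axis k 1 :: 'n point) $ i * (\<Sum>m\<in>UNIV. \<Gamma> k i m x * F m))"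
      by (simp add: sum_distrib_left mult_ac)
    then show ?thesis by (simp only: sum_axis_mult)
  qed
  have 2: "(\<Sum>i\<in>UNIV. \<Sum>j\<in>UNIV. f i j * (axis k 1 :: 'n point) $ i * v $ j) = (\<Sum>j\<in>UNIV. f k j * v $ j)" for f
  proof -
    have "(\<Sum>i\<in>UNIV. \<Sum>j\<in>UNIV. f i j * (axis k 1 :: 'n point) $ i * v $ j)
      = (\<Sum>i\<in>UNIV. (axis k 1 :: 'n point) $ i * (\<Sum>j\<in>UNIV. f i j * v $ j))"
      by (simp add: sum_distrib_left mult_ac)
    then show ?thesis by (simp only: sum_axis_mult)
  qed
  show ?thesis
    unfolding curvature_component[OF assms] 1 2 sum_axis_mult ..
qed

text \<open>A leaf vector orthogonal to its leaf is a multiple of the gradient of x_0, and that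
  gradient has a positive x_0-component.\<close>

lemma leaf_nondegenerate:
  assumes "x \<in> V"
  shows "nondegenerate_on leaf_tangent (g x)"
  unfolding nondegenerate_on_def
proof (intro ballI impI, rule ccontr)
  fix v assume v: "v \<in> leaf_tangent" "v \<noteq> 0" "\<not> (\<exists>w\<in>leaf_tangent. g x v w \<noteq> 0)"
  then obtain c where c: "v = c *\<^sub>R column None (matrix_inv (gram g x))"
    using normal_space_iff[OF assms, of v] by (auto simp: normal_space_def)
  then have "c * P None None x = 0"
    using v(1) by (simp add: leaf_tangent_def column_def)
  then show False using c v(2) inv_pos[OF assms] by simp
qed

text \<open>A leaf frame completed by N is an orthonormal frame, and the summand for N vanishes as
  R(N,N) = 0. So the sum of sectional curvatures is the trace of the endomorphism taking u to
  R(u,N)N, which may be computed in the coordinate frame.\<close>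

lemma S_mix_eq_trace:
  assumes "x \<in> V"
  shows "S_mix g x = (\<Sum>k\<in>UNIV. curvature g x (axis k 1) (unit_normal g x) (unit_normal g x) $ k)"
proof -
  define E where "E = (SOME E. leaf_frame g x E)"
  have "leaf_frame g x E"
    unfolding E_def
    using leaf_frame_exists[where g = g and x = x, OF bilin[OF assms] sym[OF assms] leaf_nondegenerate[OF assms]]
    by (rule someI_ex)
  then have E: "E a $ None = 0" "\<bar>g x (E a) (E a)\<bar> = 1" "a \<noteq> b \<Longrightarrow> g x (E a) (E b) = 0" for a b
    by (auto simp: leaf_frame_def leaf_tangent_def)
  let ?n = "unit_normal g x"
  have n: "g x ?n ?n = 1" using normal_sign_eq[OF assms] by (simp add: normal_sign_def)
  have nE: "g x ?n (E a) = 0" "g x (E a) ?n = 0" for a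
    using E(1) by (simp_all add: sym[OF assms, of "E a"] g_N[OF assms])
  define e where "e \<mu> = (case \<mu> of None \<Rightarrow> ?n | Some a \<Rightarrow> E a)" for \<mu>
  define \<eta> where "\<eta> \<mu> = g x (e \<mu>) (e \<mu>)" for \<mu>
  have abs\<eta>: "\<bar>\<eta> \<mu>\<bar> = 1" for \<mu>
    by (cases \<mu>) (simp_all add: \<eta>_def e_def n E)
  have \<eta>: "\<eta> \<mu> * \<eta> \<mu> = 1" for \<mu>
    using abs\<eta>[of \<mu>] by (metis abs_mult_self_eq mult_1)
  have orth: "g x (e \<mu>) (e \<nu>) = (if \<mu> = \<nu> then \<eta> \<mu> else 0)" for \<mu> \<nu>
    by (cases \<mu>; cases \<nu>) (auto simp: \<eta>_def e_def nE E)
  define A :: "real ^ 'n option ^ 'n option" where "A = (\<chi> l k. curvature g x (axis l 1) ?n ?n $ k)"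
  have tr: "\<eta> \<mu> * g x (curvature g x (e \<mu>) ?n ?n) (e \<mu>)
    = \<eta> \<mu> * (\<Sum>k\<in>UNIV. \<Sum>j\<in>UNIV. (\<Sum>i\<in>UNIV. e \<mu> $ i * A $ i $ k) * e \<mu> $ j * gram g x $ k $ j)" for \<mu>
    unfolding g_eq[OF assms, of "curvature g x (e \<mu>) ?n ?n"]
    by (simp add: A_def curvature_eq_sum[OF assms, of "e \<mu>"])
  have "(\<Sum>\<mu>\<in>UNIV. \<eta> \<mu> * g x (curvature g x (e \<mu>) ?n ?n) (e \<mu>)) = (\<Sum>k\<in>UNIV. A $ k $ k)"
    unfolding tr by (rule trace_orthonormal[OF _ \<eta>]) (simp only: g_eq[OF assms, symmetric] orth)
  moreover have "curvature g x ?n ?n ?n = 0"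
    by (simp add: curvature_def)
  then have "g x (curvature g x (e None) ?n ?n) (e None) = 0"
    by (simp add: e_def bilinear_lzero[OF bilin[OF assms]])
  moreover have "sectional g x (E a) ?n = \<eta> (Some a) * g x (curvature g x (e (Some a)) ?n ?n) (e (Some a))" for a
  proof -
    \<comment> \<open>A leaf vector may be timelike; the sign \<open>\<eta> (Some a)\<close>
      reproduces the denominator of the sectional curvature, which is 1 or -1.\<close>
    have "g x (E a) (E a) = 1 \<or> g x (E a) (E a) = - 1"
      using E(2)[of a] by linarith
    then show ?thesis
      by (auto simp: sectional_def \<eta>_def e_def n nE)
  qed
  ultimately show ?thesis
    by (simp add: S_mix_def E_def[symmetric] Let_def sum_option A_def)
qed

section \<open>The Ricci identity and the divergence form of the mixed scalar curvature\<close>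

lemma shape_diff: "x \<in> V \<Longrightarrow> (\<lambda>z. shape g i k z) differentiable (at x)"
  using shape_smooth smooth_on_differentiable by blast

lemma pderiv_shape:
  assumes "x \<in> V"
  shows "pderiv (\<lambda>z. shape g i k z) l x = pderiv (pderiv (\<lambda>z. N k z) i) l x
    + (\<Sum>j\<in>UNIV. pderiv (\<lambda>z. \<Gamma> k i j z) l x * N j x + \<Gamma> k i j x * pderiv (\<lambda>z. N j z) l x)"
proof -
  have d: "(\<lambda>z. \<Gamma> k i j z * N j z) differentiable (at x)" for j
    by (intro differentiable_mult christoffel_diff N_diff assms)
  have "pderiv (\<lambda>z. N k z) i differentiable (at x)"
    using smooth_on_differentiable[OF smooth_on_pderiv[OF N_smooth] assms] .
  moreover have "(\<lambda>z. \<Sum>j\<in>UNIV. \<Gamma> k i j z * N j z) differentiable (at x)"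
    using d by (intro differentiable_sum) auto
  ultimately show ?thesis
    unfolding shape_def
    by (simp add: pderiv_add pderiv_sum d pderiv_mult christoffel_diff[OF assms] N_diff[OF assms] add.commute)
qed

lemma S_mix_ricci:
  assumes "x \<in> V"
  shows "S_mix g x = (\<Sum>k\<in>UNIV. pderiv (accel g k) k x) + (\<Sum>k\<in>UNIV. \<Sum>j\<in>UNIV. \<Gamma> k k j x * accel g j x)
    - (\<Sum>l\<in>UNIV. N l x * pderiv (mean_curv g) l x) - (\<Sum>i\<in>UNIV. \<Sum>k\<in>UNIV. shape g i k x * shape g k i x)"
proof -
  have a: "pderiv (accel g k) k x = (\<Sum>i\<in>UNIV. pderiv (\<lambda>z. N i z) k x * shape g i k x
      + N i x * pderiv (\<lambda>z. shape g i k z) k x)" for k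
  proof -
    have "(\<lambda>z. N i z * shape g i k z) differentiable (at x)" for i
      by (intro differentiable_mult shape_diff N_diff assms)
    then show ?thesis
      unfolding accel_def[abs_def]
      by (simp add: pderiv_sum pderiv_mult N_diff[OF assms] shape_diff[OF assms] add.commute)
  qed
  have h: "pderiv (mean_curv g) l x = (\<Sum>k\<in>UNIV. pderiv (\<lambda>z. shape g k k z) l x)" for l
    unfolding mean_curv_def[abs_def] by (simp add: pderiv_sum shape_diff[OF assms])
  have c: "pderiv (pderiv (\<lambda>z. N k z) i) l x = pderiv (pderiv (\<lambda>z. N k z) l) i x" for k i l
    by (rule pderiv_commute[OF open_V N_smooth assms])
  show ?thesis
    unfolding S_mix_eq_trace[OF assms] curvature_axis_trace[OF assms] a h pderiv_shape[OF assms] accel_def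
    by (subst contracted_ricci_identity[where M = "\<lambda>i k. shape g i k x"
          and dn = "\<lambda>i k. pderiv (\<lambda>z. N k z) i x" and ddn = "\<lambda>l i k. pderiv (pderiv (\<lambda>z. N k z) i) l x"])
      (simp_all add: shape_def christoffel_sym[OF assms] c sum.distrib)
qed

text \<open>Weighting a field by the density turns the covariant divergence into the ordinary one,
  to which the divergence theorem for Lebesgue measure applies.\<close>

lemma divergence_density:
  assumes "x \<in> V" "\<And>k. X k differentiable (at x)"
  shows "(\<Sum>k\<in>UNIV. pderiv (\<lambda>z. vol_density g z * X k z) k x)
    = vol_density g x * ((\<Sum>k\<in>UNIV. pderiv (X k) k x) + (\<Sum>k\<in>UNIV. \<Sum>j\<in>UNIV. \<Gamma> k k j x * X j x))"
proof -
  have "vol_density g differentiable (at x)"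
    using smooth_on_differentiable[OF vol_density_smooth assms(1)] .
  then have "(\<Sum>k\<in>UNIV. pderiv (\<lambda>z. vol_density g z * X k z) k x)
    = (\<Sum>j\<in>UNIV. vol_density g x * pderiv (X j) j x + vol_density g x * ((\<Sum>k\<in>UNIV. \<Gamma> k k j x) * X j x))"
    using assms(2) by (simp add: pderiv_mult pderiv_vol_density[OF assms(1)] mult_ac)
  also have "\<dots> = vol_density g x * ((\<Sum>j\<in>UNIV. pderiv (X j) j x) + (\<Sum>j\<in>UNIV. \<Sum>k\<in>UNIV. \<Gamma> k k j x * X j x))"
    by (simp add: sum.distrib distrib_left sum_distrib_left sum_distrib_right)
  also have "(\<Sum>j\<in>UNIV. \<Sum>k\<in>UNIV. \<Gamma> k k j x * X j x) = (\<Sum>k\<in>UNIV. \<Sum>j\<in>UNIV. \<Gamma> k k j x * X j x)"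
    by (rule sum.swap)
  finally show ?thesis .
qed

lemma divergence_N:
  assumes "x \<in> V"
  shows "(\<Sum>k\<in>UNIV. pderiv (\<lambda>z. N k z) k x) + (\<Sum>k\<in>UNIV. \<Sum>j\<in>UNIV. \<Gamma> k k j x * N j x) = mean_curv g x"
  by (simp add: mean_curv_def shape_def sum.distrib)

lemma mean_curv_leaf: "x \<in> V \<Longrightarrow> mean_curv g x = (\<Sum>i\<in>UNIV. shape g (Some i) (Some i) x)"
  by (simp add: mean_curv_def sum_option shape_None)

text \<open>Expansion of A = T + c id. The leaf block suffices because the column
  \<open>None\<close> of \<open>shape\<close> vanishes, and tr T is rewritten as H - n c, which
  leaves H in the linear term.\<close>

lemma leaf_shape_dev_trace:
  fixes c :: real
  assumes "x \<in> V"
  shows "(mean_curv g x)\<^sup>2 - (\<Sum>i\<in>UNIV. \<Sum>k\<in>UNIV. shape g i k x * shape g k i x)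
    = (\<Sum>i\<in>UNIV. leaf_shape_dev g c i i x)\<^sup>2
      - (\<Sum>i\<in>UNIV. \<Sum>k\<in>UNIV. leaf_shape_dev g c i k x * leaf_shape_dev g c k i x)
      + 2 * (real CARD('n) - 1) * c * mean_curv g x - real CARD('n) * (real CARD('n) - 1) * c\<^sup>2"
proof -
  let ?n = "real CARD('n)" and ?M = "\<lambda>i k. shape g (Some i) (Some k) x"
  have 1: "(\<Sum>i\<in>UNIV. \<Sum>k\<in>UNIV. shape g i k x * shape g k i x) = (\<Sum>i\<in>UNIV. \<Sum>k\<in>UNIV. ?M i k * ?M k i)"
    by (simp add: sum_option shape_None[OF assms])
  have 2: "(\<Sum>i\<in>UNIV. leaf_shape_dev g c i i x) = mean_curv g x - ?n * c"
    by (simp add: leaf_shape_dev_def mean_curv_leaf[OF assms] sum_subtractf)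
  have "(\<Sum>k\<in>UNIV. leaf_shape_dev g c i k x * leaf_shape_dev g c k i x)
      = (\<Sum>k\<in>UNIV. ?M i k * ?M k i - (if i = k then 2 * c * ?M i i - c\<^sup>2 else 0))" for i
    by (intro sum.cong) (auto simp: leaf_shape_dev_def power2_eq_square algebra_simps)
  then have "(\<Sum>i\<in>UNIV. \<Sum>k\<in>UNIV. leaf_shape_dev g c i k x * leaf_shape_dev g c k i x)
      = (\<Sum>i\<in>UNIV. \<Sum>k\<in>UNIV. ?M i k * ?M k i) - (2 * c * mean_curv g x - ?n * c\<^sup>2)"
    by (simp add: sum_subtractf mean_curv_leaf[OF assms] sum_distrib_left)
  then show ?thesis
    unfolding 1 2 by (simp add: power2_eq_square algebra_simps)
qed

text \<open>As H = div N, the divergence of H N is \<open>N(H) + H\<^sup>2\<close>.\<close>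

lemma divergence_flux:
  fixes c :: real
  assumes "x \<in> V"
  shows "(\<Sum>k\<in>UNIV. pderiv (flux g c k) k x) = vol_density g x *
    (divergence g (H_tilde g) x - (\<Sum>l\<in>UNIV. N l x * pderiv (mean_curv g) l x)
      - (mean_curv g x)\<^sup>2 + 2 * (real CARD('n) - 1) * c * mean_curv g x)"
proof -
  let ?n = "real CARD('n)" and ?H = "mean_curv g" and ?r = "vol_density g"
  define X where "X k z = accel g k z - N k z * ?H z + 2 * (?n - 1) * c * N k z" for k z
  have d: "accel g k differentiable (at x)" "?H differentiable (at x)" for k
    using smooth_on_differentiable accel_smooth mean_curv_smooth assms by blast+
  have dX: "X k differentiable (at x)" for k
    unfolding X_def[abs_def] using N_diff[OF assms] d by simp
  have pX: "pderiv (X k) k x = pderiv (accel g k) k x - (N k x * pderiv ?H k x + pderiv (\<lambda>z. N k z) k x * ?H x)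
      + 2 * (?n - 1) * c * pderiv (\<lambda>z. N k z) k x" for k
    unfolding X_def[abs_def] using N_diff[OF assms] d by (simp add: pderiv_add pderiv_diff pderiv_mult)
  define dN where "dN = (\<Sum>k\<in>UNIV. pderiv (\<lambda>z. N k z) k x)"
  define gN where "gN = (\<Sum>k\<in>UNIV. \<Sum>j\<in>UNIV. \<Gamma> k k j x * N j x)"
  define dA where "dA = (\<Sum>k\<in>UNIV. pderiv (accel g k) k x)"
  define gA where "gA = (\<Sum>k\<in>UNIV. \<Sum>j\<in>UNIV. \<Gamma> k k j x * accel g j x)"
  define NH where "NH = (\<Sum>l\<in>UNIV. N l x * pderiv ?H l x)"
  have H: "?H x = dN + gN" using divergence_N[OF assms] by (simp add: dN_def gN_def)
  have sX: "(\<Sum>k\<in>UNIV. pderiv (X k) k x) = dA - NH - dN * ?H x + 2 * (?n - 1) * c * dN"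
    unfolding pX by (simp add: sum.distrib sum_subtractf dA_def NH_def dN_def sum_distrib_left sum_distrib_right)
  have gX: "(\<Sum>k\<in>UNIV. \<Sum>j\<in>UNIV. \<Gamma> k k j x * X j x) = gA - gN * ?H x + 2 * (?n - 1) * c * gN"
    unfolding X_def gA_def gN_def
    by (simp add: distrib_left right_diff_distrib sum.distrib sum_subtractf sum_distrib_left sum_distrib_right mult_ac)
  have "flux g c k = (\<lambda>z. ?r z * X k z)" for k
    by (simp add: flux_def[abs_def] X_def)
  then have "(\<Sum>k\<in>UNIV. pderiv (flux g c k) k x)
      = ?r x * (dA - NH - dN * ?H x + 2 * (?n - 1) * c * dN + (gA - gN * ?H x + 2 * (?n - 1) * c * gN))"
    using divergence_density[OF assms, of X] dX sX gX by simp
  also have "\<dots> = ?r x * (dA + gA - NH - (?H x)\<^sup>2 + 2 * (?n - 1) * c * ?H x)"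
    unfolding H by (simp add: power2_eq_square algebra_simps)
  finally show ?thesis
    by (simp only: divergence_H_tilde[OF assms] dA_def gA_def NH_def)
qed

text \<open>An identity for every constant c. It is applied with c = - y; the last summand, which
  contains only first derivatives of the metric, then vanishes to second order at the model.\<close>

lemma S_mix_density:
  fixes c :: real
  assumes "x \<in> V"
  shows "S_mix g x * vol_density g x = (\<Sum>k\<in>UNIV. pderiv (flux g c k) k x)
    - real CARD('n) * (real CARD('n) - 1) * c\<^sup>2 * vol_density g x
    + vol_density g x * ((\<Sum>i\<in>UNIV. leaf_shape_dev g c i i x)\<^sup>2
      - (\<Sum>i\<in>UNIV. \<Sum>k\<in>UNIV. leaf_shape_dev g c i k x * leaf_shape_dev g c k i x))"
proof -
  let ?n = "real CARD('n)" and ?H = "mean_curv g x"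
  define NH where "NH = (\<Sum>l\<in>UNIV. N l x * pderiv (mean_curv g) l x)"
  define D where "D = (\<Sum>i\<in>UNIV. leaf_shape_dev g c i i x)\<^sup>2
      - (\<Sum>i\<in>UNIV. \<Sum>k\<in>UNIV. leaf_shape_dev g c i k x * leaf_shape_dev g c k i x)"
  have S: "S_mix g x = divergence g (H_tilde g) x - NH
      - (?H\<^sup>2 - D - 2 * (?n - 1) * c * ?H + ?n * (?n - 1) * c\<^sup>2)"
    using S_mix_ricci[OF assms] leaf_shape_dev_trace[OF assms, of c] divergence_H_tilde[OF assms]
    unfolding NH_def D_def by linarith
  show ?thesis
    unfolding divergence_flux[OF assms] NH_def[symmetric] S D_def[symmetric] by (simp add: algebra_simps)
qed

end

section \<open>The model metric and its anisotropic rescalings\<close>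

text \<open>The sign of y enters through the direction of x_0: it decides whether the leaves shrink
  or expand along N.\<close>

definition wt :: "real \<Rightarrow> 'n option \<Rightarrow> real" where
  "wt y \<mu> = (case \<mu> of None \<Rightarrow> sgn y | Some _ \<Rightarrow> 1)"

definition cexp :: "real \<Rightarrow> 'n::finite option \<Rightarrow> 'n point \<Rightarrow> real" where
  "cexp y \<mu> x = exp (wt y \<mu> * x $ \<mu>)"

definition esum :: "real \<Rightarrow> 'n::finite point \<Rightarrow> real" where
  "esum y x = (\<Sum>\<mu>\<in>UNIV. cexp y \<mu> x)"

text \<open>In the unscaled model this is the length of the coordinate vector with index \<mu>,
  since \<open>dX\<^sub>\<mu> = \<plusminus>X\<^sub>\<mu> dx\<^sub>\<mu>\<close>.\<close>

definition theta :: "real \<Rightarrow> 'n::finite option \<Rightarrow> 'n point \<Rightarrow> real" where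
  "theta y \<mu> x = cexp y \<mu> x / (\<bar>y\<bar> * esum y x)"

text \<open>These factors multiply lengths, not metric coefficients, so the volume density changes
  by \<alpha> times the n-th power of \<beta>.\<close>

definition rescale :: "real \<Rightarrow> real \<Rightarrow> 'n option \<Rightarrow> real" where
  "rescale \<alpha> \<beta> \<mu> = (case \<mu> of None \<Rightarrow> \<alpha> | Some _ \<Rightarrow> \<beta>)"

text \<open>
  For \<open>\<alpha> = \<beta> = 1\<close> and \<open>X\<^sub>\<mu> = exp (\<plusminus>x\<^sub>\<mu>)\<close> this is the hyperbolic metric \<open>\<Sum> dX\<^sub>\<mu>\<^sup>2 / (y \<Sum> X\<^sub>\<mu>)\<^sup>2\<close> of a
  half-space whose boundary is equally inclined to all coordinate hyperplanes.
\<close>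

definition model :: "real \<Rightarrow> real \<Rightarrow> real \<Rightarrow> 'n::finite tensor2" where
  "model y \<alpha> \<beta> x v w = (\<Sum>\<mu>\<in>UNIV. (rescale \<alpha> \<beta> \<mu> * theta y \<mu> x)\<^sup>2 * v $ \<mu> * w $ \<mu>)"

definition log_pderiv :: "real \<Rightarrow> 'n option \<Rightarrow> 'n option \<Rightarrow> 'n::finite point \<Rightarrow> real" where
  "log_pderiv y \<mu> i x = wt y i * ((if i = \<mu> then 1 else 0) - cexp y i x / esum y x)"

lemma wt_simps [simp]: "wt y None = sgn y" "wt y (Some i) = 1"
  by (simp_all add: wt_def)

lemma cexp_pos [simp]: "cexp y \<mu> x > 0"
  by (simp add: cexp_def)

lemma esum_pos [simp]: "esum y x > 0"
  unfolding esum_def by (intro sum_pos) auto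

lemma cexp_neq_0 [simp]: "cexp y \<mu> x \<noteq> 0"
  by (simp add: cexp_def)

lemma esum_neq_0 [simp]: "esum y x \<noteq> 0"
  by (rule less_imp_neq[OF esum_pos, symmetric])

lemma cexp_smooth: "smooth_on UNIV (cexp y \<mu>)"
  unfolding cexp_def[abs_def]
  by (intro smooth_on_exp smooth_on_mult smooth_on_const smooth_on_component open_UNIV)

lemma esum_smooth: "smooth_on UNIV (esum y)"
  unfolding esum_def[abs_def] by (intro smooth_on_sum cexp_smooth open_UNIV)

lemma cexp_has_derivative: "(cexp y \<mu> has_derivative (\<lambda>v. wt y \<mu> * v $ \<mu> * cexp y \<mu> x)) (at x)"
proof -
  have "((\<lambda>x. wt y \<mu> * x $ \<mu>) has_derivative (\<lambda>v. wt y \<mu> * v $ \<mu>)) (at x)"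
    by (intro has_derivative_mult_right bounded_linear_imp_has_derivative bounded_linear_vec_nth)
  from DERIV_compose_FDERIV[OF DERIV_exp this] show ?thesis
    by (simp add: cexp_def[abs_def])
qed

lemma esum_has_derivative: "(esum y has_derivative (\<lambda>v. \<Sum>\<mu>\<in>UNIV. wt y \<mu> * v $ \<mu> * cexp y \<mu> x)) (at x)"
  unfolding esum_def[abs_def] by (intro has_derivative_sum cexp_has_derivative)

lemma pderiv_cexp: "pderiv (cexp y \<mu>) i x = (if i = \<mu> then wt y i * cexp y i x else 0)"
  unfolding has_derivative_imp_pderiv[OF cexp_has_derivative] by (simp add: axis_def)

lemma pderiv_esum: "pderiv (esum y) i x = wt y i * cexp y i x"
  using sum_axis_mult(1)[of i "\<lambda>\<mu>. wt y \<mu> * cexp y \<mu> x"]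
  unfolding has_derivative_imp_pderiv[OF esum_has_derivative] by (simp add: mult_ac)

lemma cexp_diff: "cexp y \<mu> differentiable (at x)"
  using cexp_has_derivative differentiable_def by blast

lemma esum_diff: "esum y differentiable (at x)"
  using esum_has_derivative differentiable_def by blast

lemma pderiv_quotient:
  assumes "f differentiable (at x)" "g differentiable (at x)" "g x \<noteq> 0"
  shows "pderiv (\<lambda>z. f z / g z) i x = (pderiv f i x * g x - f x * pderiv g i x) / (g x * g x)"
proof -
  have "(f has_derivative frechet_derivative f (at x)) (at x)" "(g has_derivative frechet_derivative g (at x)) (at x)"
    using assms frechet_derivative_works by blast+
  from has_derivative_imp_pderiv[OF has_derivative_divide'[OF this assms(3)], of i] show ?thesis
    by (simp add: pderiv_def)
qed

text \<open>The argument \<open>index_type\<close> carries the type of the coordinate indices, which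
  the real parameters do not determine.\<close>

locale model_params =
  fixes y \<alpha> \<beta> :: real and index_type :: "'n::finite itself"
  assumes y_nz: "y \<noteq> 0" and \<alpha>_pos: "\<alpha> > 0" and \<beta>_pos: "\<beta> > 0"
begin

abbreviation "\<theta> \<mu> x \<equiv> rescale \<alpha> \<beta> \<mu> * theta y \<mu> x"

lemma rescale_pos: "rescale \<alpha> \<beta> \<mu> > 0"
  using \<alpha>_pos \<beta>_pos by (simp add: rescale_def split: option.split)

lemma theta_pos: "theta y \<mu> x > 0"
  using y_nz by (simp add: theta_def)

lemma \<theta>_pos: "\<theta> \<mu> x > 0"
  by (intro mult_pos_pos rescale_pos theta_pos)

lemma theta_nz [simp]: "theta y \<mu> x \<noteq> 0"
  by (rule less_imp_neq[OF theta_pos, symmetric])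

lemma rescale_nz [simp]: "rescale \<alpha> \<beta> \<mu> \<noteq> 0"
  by (rule less_imp_neq[OF rescale_pos, symmetric])

lemma theta_smooth: "smooth_on UNIV (theta y \<mu>)"
  unfolding theta_def[abs_def]
  using y_nz by (intro smooth_on_divide smooth_on_mult smooth_on_const cexp_smooth esum_smooth open_UNIV) simp

lemma theta_diff: "theta y \<mu> differentiable (at x)"
  using theta_smooth smooth_on_differentiable by blast

lemma pderiv_theta: "pderiv (theta y \<mu>) i x = theta y \<mu> x * log_pderiv y \<mu> i x"
proof -
  have d: "(\<lambda>z. cexp y \<mu> z / esum y z) differentiable (at x)"
    by (intro differentiable_divide esum_diff cexp_diff) simp
  have eq: "theta y \<mu> = (\<lambda>z. (1 / \<bar>y\<bar>) * (cexp y \<mu> z / esum y z))"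
    by (simp add: theta_def[abs_def])
  have "pderiv (theta y \<mu>) i x = (1 / \<bar>y\<bar>) * pderiv (\<lambda>z. cexp y \<mu> z / esum y z) i x"
    unfolding eq by (rule pderiv_cmult[OF d])
  also have "pderiv (\<lambda>z. cexp y \<mu> z / esum y z) i x = (cexp y \<mu> x / esum y x) * log_pderiv y \<mu> i x"
    by (subst pderiv_quotient)
      (auto simp: cexp_diff esum_diff pderiv_cexp pderiv_esum log_pderiv_def field_simps)
  finally show ?thesis by (simp add: theta_def[of y \<mu> x])
qed

lemma gram_model: "gram (model y \<alpha> \<beta>) x = (\<chi> i j. if i = j then (\<theta> i x)\<^sup>2 else 0)"
  for x :: "'n point"
proof -
  have "model y \<alpha> \<beta> x (axis i 1) (axis j 1) = (if i = j then (\<theta> i x)\<^sup>2 else 0)" for i j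
  proof -
    have "model y \<alpha> \<beta> x (axis i 1) (axis j 1)
        = (\<Sum>\<mu>\<in>UNIV. (axis i 1 :: 'n point) $ \<mu> * ((\<theta> \<mu> x)\<^sup>2 * (axis j 1 :: 'n point) $ \<mu>))"
      by (simp add: model_def mult_ac)
    then show ?thesis by (simp only: sum_axis_mult) (simp add: axis_def)
  qed
  then show ?thesis by (simp add: gram_def vec_eq_iff)
qed

lemma gram_model_component: "gram (model y \<alpha> \<beta>) x $ i $ j = (if i = j then (\<theta> i x)\<^sup>2 else 0)"
  for x :: "'n point"
  by (simp add: gram_model)

lemma inv_gram_model:
  "matrix_inv (gram (model y \<alpha> \<beta>) x) = (\<chi> i j. if i = j then 1 / (\<theta> i x)\<^sup>2 else 0)"
  for x :: "'n point"
  by (rule matrix_inv_eqI)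
    (auto simp: gram_model matrix_matrix_mult_def mat_def vec_eq_iff if_distrib[of "(*) _"]
      if_distrib[of "\<lambda>t. t * _"] cong: if_cong)

lemma det_gram_model: "det (gram (model y \<alpha> \<beta>) x) = (\<Prod>\<mu>\<in>UNIV. \<theta> \<mu> x)\<^sup>2"
  for x :: "'n point"
proof -
  have "det (gram (model y \<alpha> \<beta>) x) = (\<Prod>\<mu>\<in>UNIV. (\<theta> \<mu> x)\<^sup>2)"
    by (subst det_diagonal) (simp_all add: gram_model)
  then show ?thesis by (simp add: prod_power_distrib)
qed

lemma vol_density_model: "vol_density (model y \<alpha> \<beta>) x = (\<Prod>\<mu>\<in>UNIV. \<theta> \<mu> x)"
  for x :: "'n point"
proof -
  have "(\<Prod>\<mu>\<in>UNIV. \<theta> \<mu> x) \<ge> 0"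
    by (intro prod_nonneg less_imp_le \<theta>_pos)
  then show ?thesis
    by (simp add: vol_density_def det_gram_model)
qed

lemma foliated_metric_model: "foliated_metric UNIV (model y \<alpha> \<beta> :: 'n tensor2)"
proof
  show "bilinear (model y \<alpha> \<beta> x)" for x :: "'n point"
    unfolding bilinear_def model_def
    by (auto intro!: linearI simp: algebra_simps sum.distrib sum_distrib_left)
  show "model y \<alpha> \<beta> x v w = model y \<alpha> \<beta> x w v" for x v w :: "'n point"
    by (simp add: model_def mult_ac)
  show "smooth_on UNIV (\<lambda>x. model y \<alpha> \<beta> x v w)" for v w :: "'n point"
    unfolding model_def
    by (intro smooth_on_sum smooth_on_mult smooth_on_power smooth_on_const theta_smooth open_UNIV)
  show "det (gram (model y \<alpha> \<beta>) x) \<noteq> 0" for x :: "'n point"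
    by (simp add: det_gram_model)
  show "0 < matrix_inv (gram (model y \<alpha> \<beta>) x) $ None $ None" for x :: "'n point"
    by (simp add: inv_gram_model)
qed simp

sublocale foliated_metric UNIV "model y \<alpha> \<beta> :: 'n tensor2"
  by (rule foliated_metric_model)

lemma pderiv_gram_model:
  "pderiv (\<lambda>z. G j k z) i x = (if j = k then 2 * (\<theta> j x)\<^sup>2 * log_pderiv y j i x else 0)"
  for x :: "'n point"
proof (cases "j = k")
  case True
  have "pderiv (\<lambda>z. \<theta> k z * \<theta> k z) i x = 2 * (\<theta> k x)\<^sup>2 * log_pderiv y k i x"
    by (simp add: pderiv_mult theta_diff pderiv_theta power2_eq_square algebra_simps)
  then show ?thesis using True by (simp add: gram_model power2_eq_square)
qed (simp add: gram_model)

lemma christoffel_model: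
  "\<Gamma> k i j x = ((if j = k then (\<theta> j x)\<^sup>2 * log_pderiv y j i x else 0)
     + (if i = k then (\<theta> i x)\<^sup>2 * log_pderiv y i j x else 0)
     - (if i = j then (\<theta> i x)\<^sup>2 * log_pderiv y i k x else 0)) / (\<theta> k x)\<^sup>2"
  for x :: "'n point"
  unfolding christoffel_def inv_gram_model pderiv_gram_model
  by (simp add: if_distrib[of "\<lambda>t. t * _"] cong: if_cong)

lemma christoffel_model_trace:
  "(\<Sum>k\<in>UNIV. \<Gamma> k k j x) = wt y j * (1 - (real CARD('n) + 1) * (cexp y j x / esum y x))"
  for x :: "'n point"
proof -
  have "\<Gamma> k k j x = log_pderiv y k j x" for k
    by (cases "k = j") (simp_all add: christoffel_model)
  then have "(\<Sum>k\<in>UNIV. \<Gamma> k k j x)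
      = wt y j * ((\<Sum>k\<in>UNIV. if j = k then 1 else 0) - (\<Sum>k\<in>(UNIV :: 'n option set). cexp y j x / esum y x))"
    by (simp only: log_pderiv_def sum_distrib_left[symmetric] sum_subtractf)
  then show ?thesis by simp
qed

lemma N_model: "N k x = (if k = None then 1 / \<theta> None x else 0)"
  for x :: "'n point"
  using \<theta>_pos[of None x] by (auto simp: N_eq inv_gram_model real_sqrt_divide power2_eq_square)

text \<open>The effect of the oblique boundary: \<open>esum\<close> depends on x_0 through X_0 only,
  and X_0 cancels against the length \<open>theta y None x\<close>. The derivative of ln esum along
  N is therefore constant, and up to sign it is the umbilicity factor.\<close>

lemma sgn_quotient: "sgn y * (cexp y None x / esum y x) / \<theta> None x = y / \<alpha>"
  for x :: "'n point"
  using y_nz \<alpha>_pos by (cases "y > 0") (simp_all add: rescale_def theta_def field_simps)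

lemma shape_model: "shape (model y \<alpha> \<beta>) (Some i) (Some k) x = (if i = k then - y / \<alpha> else 0)"
  for x :: "'n point"
proof -
  have "shape (model y \<alpha> \<beta>) (Some i) (Some k) x = \<Gamma> (Some k) (Some i) None x / \<theta> None x"
    by (simp add: shape_def N_model sum_option)
  also have "\<dots> = (if i = k then - (sgn y * (cexp y None x / esum y x) / \<theta> None x) else 0)"
    by (auto simp: christoffel_model log_pderiv_def)
  finally show ?thesis by (simp only: sgn_quotient) simp
qed

lemma mean_curv_model: "mean_curv (model y \<alpha> \<beta>) x = - (real CARD('n) * y / \<alpha>)"
  for x :: "'n point"
  by (simp add: mean_curv_leaf shape_model)

text \<open>The acceleration is minus the leaf gradient of the logarithm of
  \<open>theta y None\<close>: \<alpha> cancels, and raising the index contributes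
  \<open>1 / \<beta>\<^sup>2\<close>.\<close>

lemma accel_model:
  "accel (model y \<alpha> \<beta>) k x = (if k = None then 0 else y\<^sup>2 / \<beta>\<^sup>2 * (esum y x / cexp y k x))"
  for x :: "'n point"
proof (cases k)
  case None
  then show ?thesis by (simp add: accel_def shape_None)
next
  case (Some i)
  have "accel (model y \<alpha> \<beta>) k x = \<Gamma> k None None x / (\<theta> None x)\<^sup>2"
    using Some by (simp add: accel_def N_model sum_option shape_def power2_eq_square)
  also have "\<dots> = (cexp y k x / esum y x) / (\<theta> k x)\<^sup>2"
    using Some by (simp add: christoffel_model log_pderiv_def)
  also have "\<dots> = y\<^sup>2 / \<beta>\<^sup>2 * (esum y x / cexp y k x)"
    using Some y_nz \<beta>_pos by (simp add: rescale_def theta_def field_simps power2_eq_square)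
  finally show ?thesis using Some by simp
qed

text \<open>The terms \<open>esum y x / cexp y (Some i) x\<close> coming from the partial
  derivatives and from the Christoffel trace cancel. Each of the n leaf directions leaves the
  constant \<open>- n y\<^sup>2 / \<beta>\<^sup>2\<close>.\<close>

lemma divergence_H_tilde_model:
  "divergence (model y \<alpha> \<beta>) (H_tilde (model y \<alpha> \<beta>)) x = - ((real CARD('n) * y / \<beta>)\<^sup>2)"
  for x :: "'n point"
proof -
  let ?n = "real CARD('n)"
  have p: "pderiv (accel (model y \<alpha> \<beta>) (Some i)) (Some i) x
      = y\<^sup>2 / \<beta>\<^sup>2 * (1 - esum y x / cexp y (Some i) x)" for i
  proof -
    have d: "(\<lambda>z. esum y z / cexp y (Some i) z) differentiable (at x)"
      by (intro differentiable_divide esum_diff cexp_diff) simp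
    have eq: "accel (model y \<alpha> \<beta>) (Some i) = (\<lambda>z. y\<^sup>2 / \<beta>\<^sup>2 * (esum y z / cexp y (Some i) z))"
      by (simp add: accel_model fun_eq_iff)
    have "pderiv (accel (model y \<alpha> \<beta>) (Some i)) (Some i) x
        = y\<^sup>2 / \<beta>\<^sup>2 * pderiv (\<lambda>z. esum y z / cexp y (Some i) z) (Some i) x"
      unfolding eq by (rule pderiv_cmult[OF d])
    also have "pderiv (\<lambda>z. esum y z / cexp y (Some i) z) (Some i) x = 1 - esum y x / cexp y (Some i) x"
      by (subst pderiv_quotient) (simp_all add: esum_diff cexp_diff pderiv_esum pderiv_cexp field_simps)
    finally show ?thesis .
  qed
  have a0: "accel (model y \<alpha> \<beta>) None = (\<lambda>x :: 'n point. 0)"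
    by (simp add: accel_model fun_eq_iff)
  have "(\<Sum>k\<in>UNIV. \<Sum>j\<in>UNIV. \<Gamma> k k j x * accel (model y \<alpha> \<beta>) j x)
      = (\<Sum>j\<in>UNIV. (\<Sum>k\<in>UNIV. \<Gamma> k k j x) * accel (model y \<alpha> \<beta>) j x)"
    by (subst sum.swap) (simp add: sum_distrib_right)
  also have "\<dots> = (\<Sum>j\<in>UNIV. (1 - (?n + 1) * (cexp y (Some j) x / esum y x))
      * (y\<^sup>2 / \<beta>\<^sup>2 * (esum y x / cexp y (Some j) x)))"
    unfolding christoffel_model_trace by (simp add: sum_option accel_model)
  also have "\<dots> = (\<Sum>j\<in>UNIV. y\<^sup>2 / \<beta>\<^sup>2 * (esum y x / cexp y (Some j) x - (?n + 1)))"
  proof (rule sum.cong[OF refl])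
    have alg: "(1 - c * a) * (q * b) = q * (b - c)" if "a * b = 1" for a b c q :: real
    proof -
      have "(1 - c * a) * (q * b) = q * (b - c * (a * b))" by (simp add: algebra_simps)
      then show ?thesis using that by simp
    qed
    show "(1 - (?n + 1) * (cexp y (Some j) x / esum y x)) * (y\<^sup>2 / \<beta>\<^sup>2 * (esum y x / cexp y (Some j) x))
        = y\<^sup>2 / \<beta>\<^sup>2 * (esum y x / cexp y (Some j) x - (?n + 1))" for j
      by (rule alg) simp
  qed
  finally have "divergence (model y \<alpha> \<beta>) (H_tilde (model y \<alpha> \<beta>)) x
      = (\<Sum>j\<in>(UNIV :: 'n set). y\<^sup>2 / \<beta>\<^sup>2 * (1 - esum y x / cexp y (Some j) x)
          + y\<^sup>2 / \<beta>\<^sup>2 * (esum y x / cexp y (Some j) x - (?n + 1)))"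
    by (simp add: divergence_H_tilde sum_option[of "\<lambda>k. pderiv (accel (model y \<alpha> \<beta>) k) k x"] a0 p sum.distrib)
  also have "\<dots> = (\<Sum>j\<in>(UNIV :: 'n set). - (y\<^sup>2 / \<beta>\<^sup>2 * ?n))"
  proof (rule sum.cong[OF refl])
    have alg: "q * (1 - b) + q * (b - (c + 1)) = - (q * c)" for b c q :: real
      by (simp add: algebra_simps)
    show "y\<^sup>2 / \<beta>\<^sup>2 * (1 - esum y x / cexp y (Some j) x)
        + y\<^sup>2 / \<beta>\<^sup>2 * (esum y x / cexp y (Some j) x - (?n + 1)) = - (y\<^sup>2 / \<beta>\<^sup>2 * ?n)" for j
      by (rule alg)
  qed
  finally show ?thesis
    by (simp add: power2_eq_square)
qed

text \<open>H is the constant - n y / \<alpha>, so N(H) = 0 and \<open>divergence_flux\<close> with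
  c = - y leaves constants only. The three terms of the last factor come from 2 (n - 1) c H, from
  \<open>H\<^sup>2\<close> and from the divergence of H-tilde, in this order.\<close>

lemma divergence_flux_model:
  "(\<Sum>k\<in>UNIV. pderiv (flux (model y \<alpha> \<beta>) (- y) k) k x) = vol_density (model y \<alpha> \<beta>) x * (real CARD('n) * y\<^sup>2) *
     (2 * (real CARD('n) - 1) / \<alpha> - real CARD('n) / \<alpha>\<^sup>2 - real CARD('n) / \<beta>\<^sup>2)"
  for x :: "'n point"
proof -
  have "mean_curv (model y \<alpha> \<beta>) = (\<lambda>x :: 'n point. - (real CARD('n) * y / \<alpha>))"
    by (simp add: mean_curv_model fun_eq_iff)
  then show ?thesis
    using \<alpha>_pos \<beta>_pos
    by (subst divergence_flux)
      (simp_all add: divergence_H_tilde_model power_divide power_mult_distrib power2_eq_square field_simps)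
qed

lemma leaf_shape_dev_model:
  fixes x :: "'n point"
  assumes "\<alpha> = 1"
  shows "leaf_shape_dev (model y \<alpha> \<beta>) (- y) i k x = 0"
  using shape_model[of i k x] assms by (simp add: leaf_shape_dev_def)

end

lemma vol_density_model_rescale:
  fixes x :: "'a::finite point"
  assumes "y \<noteq> 0" "\<alpha> > 0" "\<beta> > 0"
  shows "vol_density (model y \<alpha> \<beta>) x = \<alpha> * \<beta> ^ CARD('a) * vol_density (model y 1 1) x"
proof -
  interpret a: model_params y \<alpha> \<beta> "TYPE('a)" using assms by unfold_locales
  interpret b: model_params y 1 1 "TYPE('a)" using assms by unfold_locales auto
  show ?thesis
    unfolding a.vol_density_model b.vol_density_model
    by (simp add: prod.distrib prod_option rescale_def)
qed

section \<open>Families that are uniformly Lipschitz at parameter zero\<close>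

text \<open>Values are compared with those at t = 0 only, which is all that a derivative at 0
  requires, and the notion is closed under the algebraic operations. Functions of t alone are
  treated with S = {()}.\<close>

definition lip_on :: "'b set \<Rightarrow> (real \<Rightarrow> 'b \<Rightarrow> real) \<Rightarrow> bool" where
  "lip_on S a \<longleftrightarrow> (\<exists>\<delta>>0. \<exists>K\<ge>0. \<forall>t x. \<bar>t\<bar> < \<delta> \<longrightarrow> x \<in> S \<longrightarrow> \<bar>a t x\<bar> \<le> K \<and> \<bar>a t x - a 0 x\<bar> \<le> K * \<bar>t\<bar>)"

definition quad_on :: "'b set \<Rightarrow> (real \<Rightarrow> 'b \<Rightarrow> real) \<Rightarrow> bool" where
  "quad_on S q \<longleftrightarrow> (\<exists>\<delta>>0. \<exists>K\<ge>0. \<forall>t x. \<bar>t\<bar> < \<delta> \<longrightarrow> x \<in> S \<longrightarrow> \<bar>q t x\<bar> \<le> K * t\<^sup>2)"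

lemma lip_onE:
  assumes "lip_on S a"
  obtains \<delta> K where "\<delta> > 0" "K \<ge> 0" "\<And>t x. \<bar>t\<bar> < \<delta> \<Longrightarrow> x \<in> S \<Longrightarrow> \<bar>a t x\<bar> \<le> K"
    "\<And>t x. \<bar>t\<bar> < \<delta> \<Longrightarrow> x \<in> S \<Longrightarrow> \<bar>a t x - a 0 x\<bar> \<le> K * \<bar>t\<bar>"
  using assms unfolding lip_on_def by blast

lemma lip_on_boundE:
  assumes "lip_on S a"
  obtains \<delta> K where "\<delta> > 0" "K \<ge> 0" "\<And>t x. \<bar>t\<bar> < \<delta> \<Longrightarrow> x \<in> S \<Longrightarrow> \<bar>a t x\<bar> \<le> K"
  by (rule lip_onE[OF assms]) blast

lemma lip_on_diffE:
  assumes "lip_on S a"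
  obtains \<delta> K where "\<delta> > 0" "K \<ge> 0"
    "\<And>t x. \<bar>t\<bar> < \<delta> \<Longrightarrow> x \<in> S \<Longrightarrow> \<bar>a t x - a 0 x\<bar> \<le> K * \<bar>t\<bar>"
  by (rule lip_onE[OF assms]) blast

lemma lip_onI:
  assumes "\<delta> > 0" "\<And>t x. \<bar>t\<bar> < \<delta> \<Longrightarrow> x \<in> S \<Longrightarrow> \<bar>a t x\<bar> \<le> A"
    "\<And>t x. \<bar>t\<bar> < \<delta> \<Longrightarrow> x \<in> S \<Longrightarrow> \<bar>a t x - a 0 x\<bar> \<le> B * \<bar>t\<bar>"
  shows "lip_on S a"
  unfolding lip_on_def
proof (rule exI[of _ \<delta>], intro conjI exI[of _ "max 0 (max A B)"] allI impI)
  fix t x assume *: "\<bar>t\<bar> < \<delta>" "x \<in> S"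
  show "\<bar>a t x\<bar> \<le> max 0 (max A B)" using assms(2)[OF *] by simp
  have "B * \<bar>t\<bar> \<le> max 0 (max A B) * \<bar>t\<bar>" by (intro mult_right_mono) auto
  then show "\<bar>a t x - a 0 x\<bar> \<le> max 0 (max A B) * \<bar>t\<bar>" using assms(3)[OF *] by linarith
qed (use assms(1) in auto)

lemma lip_on_stationary:
  assumes "\<And>x. x \<in> S \<Longrightarrow> \<bar>f x\<bar> \<le> K"
  shows "lip_on S (\<lambda>t. f)"
  by (rule lip_onI[of 1 _ _ K 0]) (use assms in auto)

lemma lip_on_const: "lip_on S (\<lambda>t x. c)"
  by (rule lip_on_stationary[of S "\<lambda>_. c" "\<bar>c\<bar>"]) simp

lemma lip_on_cong:
  assumes "lip_on S a" "\<epsilon> > 0" "\<And>t x. \<bar>t\<bar> < \<epsilon> \<Longrightarrow> x \<in> S \<Longrightarrow> a t x = b t x"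
  shows "lip_on S b"
proof -
  obtain \<delta> K where l: "\<delta> > 0" "K \<ge> 0" "\<And>t x. \<bar>t\<bar> < \<delta> \<Longrightarrow> x \<in> S \<Longrightarrow> \<bar>a t x\<bar> \<le> K"
    "\<And>t x. \<bar>t\<bar> < \<delta> \<Longrightarrow> x \<in> S \<Longrightarrow> \<bar>a t x - a 0 x\<bar> \<le> K * \<bar>t\<bar>"
    by (rule lip_onE[OF assms(1)]) blast
  show ?thesis
  proof (rule lip_onI[of "min \<delta> \<epsilon>" _ _ K K])
    fix t x assume "\<bar>t\<bar> < min \<delta> \<epsilon>" "x \<in> S"
    then show "\<bar>b t x\<bar> \<le> K" "\<bar>b t x - b 0 x\<bar> \<le> K * \<bar>t\<bar>"
      using l(3,4)[of t x] assms(2) assms(3)[of t x] assms(3)[of 0 x] by auto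
  qed (use l assms in auto)
qed

lemma lip_on_add:
  assumes "lip_on S a" "lip_on S b"
  shows "lip_on S (\<lambda>t x. a t x + b t x)"
proof -
  obtain \<delta> K where a: "\<delta> > 0" "K \<ge> 0" "\<And>t x. \<bar>t\<bar> < \<delta> \<Longrightarrow> x \<in> S \<Longrightarrow> \<bar>a t x\<bar> \<le> K"
    "\<And>t x. \<bar>t\<bar> < \<delta> \<Longrightarrow> x \<in> S \<Longrightarrow> \<bar>a t x - a 0 x\<bar> \<le> K * \<bar>t\<bar>"
    by (rule lip_onE[OF assms(1)]) blast
  obtain \<delta>' K' where b: "\<delta>' > 0" "K' \<ge> 0" "\<And>t x. \<bar>t\<bar> < \<delta>' \<Longrightarrow> x \<in> S \<Longrightarrow> \<bar>b t x\<bar> \<le> K'"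
    "\<And>t x. \<bar>t\<bar> < \<delta>' \<Longrightarrow> x \<in> S \<Longrightarrow> \<bar>b t x - b 0 x\<bar> \<le> K' * \<bar>t\<bar>"
    by (rule lip_onE[OF assms(2)]) blast
  show ?thesis
  proof (rule lip_onI[of "min \<delta> \<delta>'" _ _ "K + K'" "K + K'"])
    fix t x assume *: "\<bar>t\<bar> < min \<delta> \<delta>'" "x \<in> S"
    then show "\<bar>a t x + b t x\<bar> \<le> K + K'" using a(3)[of t x] b(3)[of t x] by auto
    show "\<bar>a t x + b t x - (a 0 x + b 0 x)\<bar> \<le> (K + K') * \<bar>t\<bar>"
      using * a(4)[of t x] b(4)[of t x] unfolding distrib_right by auto
  qed (use a b in auto)
qed

lemma lip_on_mult:
  assumes "lip_on S a" "lip_on S b"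
  shows "lip_on S (\<lambda>t x. a t x * b t x)"
proof -
  obtain \<delta> K where a: "\<delta> > 0" "K \<ge> 0" "\<And>t x. \<bar>t\<bar> < \<delta> \<Longrightarrow> x \<in> S \<Longrightarrow> \<bar>a t x\<bar> \<le> K"
    "\<And>t x. \<bar>t\<bar> < \<delta> \<Longrightarrow> x \<in> S \<Longrightarrow> \<bar>a t x - a 0 x\<bar> \<le> K * \<bar>t\<bar>"
    by (rule lip_onE[OF assms(1)]) blast
  obtain \<delta>' K' where b: "\<delta>' > 0" "K' \<ge> 0" "\<And>t x. \<bar>t\<bar> < \<delta>' \<Longrightarrow> x \<in> S \<Longrightarrow> \<bar>b t x\<bar> \<le> K'"
    "\<And>t x. \<bar>t\<bar> < \<delta>' \<Longrightarrow> x \<in> S \<Longrightarrow> \<bar>b t x - b 0 x\<bar> \<le> K' * \<bar>t\<bar>"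
    by (rule lip_onE[OF assms(2)]) blast
  show ?thesis
  proof (rule lip_onI[of "min \<delta> \<delta>'" _ _ "K * K'" "2 * (K * K')"])
    fix t x assume *: "\<bar>t\<bar> < min \<delta> \<delta>'" "x \<in> S"
    show "\<bar>a t x * b t x\<bar> \<le> K * K'"
      unfolding abs_mult using * a(2) a(3)[of t x] b(3)[of t x] by (intro mult_mono) auto
    have "\<bar>a t x * b t x - a 0 x * b 0 x\<bar> = \<bar>(a t x - a 0 x) * b t x + a 0 x * (b t x - b 0 x)\<bar>"
      by (simp add: algebra_simps)
    also have "\<dots> \<le> \<bar>a t x - a 0 x\<bar> * \<bar>b t x\<bar> + \<bar>a 0 x\<bar> * \<bar>b t x - b 0 x\<bar>"
      unfolding abs_mult[symmetric] by (rule abs_triangle_ineq)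
    also have "\<dots> \<le> (K * \<bar>t\<bar>) * K' + K * (K' * \<bar>t\<bar>)"
      using * a b a(3)[of 0 x] a(4)[of t x] b(3)[of t x] b(4)[of t x]
      by (intro add_mono mult_mono) auto
    finally show "\<bar>a t x * b t x - a 0 x * b 0 x\<bar> \<le> 2 * (K * K') * \<bar>t\<bar>" by (simp add: algebra_simps)
  qed (use a b in auto)
qed

lemma lip_on_uminus: "lip_on S a \<Longrightarrow> lip_on S (\<lambda>t x. - a t x)"
  using lip_on_mult[OF lip_on_const[of S "- 1"], of a] by simp

lemma lip_on_diff: "lip_on S a \<Longrightarrow> lip_on S b \<Longrightarrow> lip_on S (\<lambda>t x. a t x - b t x)"
  using lip_on_add[OF _ lip_on_uminus, of S a b] by simp

lemma lip_on_sum: "(\<And>i. i \<in> I \<Longrightarrow> lip_on S (a i)) \<Longrightarrow> lip_on S (\<lambda>t x. \<Sum>i\<in>I. a i t x)"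
  by (induction I rule: infinite_finite_induct) (simp_all add: lip_on_add lip_on_const)

lemma lip_on_prod: "(\<And>i. i \<in> I \<Longrightarrow> lip_on S (a i)) \<Longrightarrow> lip_on S (\<lambda>t x. \<Prod>i\<in>I. a i t x)"
  by (induction I rule: infinite_finite_induct) (simp_all add: lip_on_mult lip_on_const)

lemma lip_on_close:
  assumes "lip_on S a" "e > 0"
  obtains \<delta> where "\<delta> > 0" "\<And>t x. \<bar>t\<bar> < \<delta> \<Longrightarrow> x \<in> S \<Longrightarrow> \<bar>a t x - a 0 x\<bar> \<le> e"
proof -
  obtain \<delta> K where a: "\<delta> > 0" "K \<ge> 0"
    "\<And>t x. \<bar>t\<bar> < \<delta> \<Longrightarrow> x \<in> S \<Longrightarrow> \<bar>a t x - a 0 x\<bar> \<le> K * \<bar>t\<bar>"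
    by (rule lip_on_diffE[OF assms(1)]) blast
  show ?thesis
  proof (rule that[of "min \<delta> (e / (K + 1))"])
    fix t x assume *: "\<bar>t\<bar> < min \<delta> (e / (K + 1))" "x \<in> S"
    have "K * \<bar>t\<bar> \<le> (K + 1) * (e / (K + 1))"
      using * a by (intro mult_mono) auto
    also have "\<dots> = e" using a by simp
    finally show "\<bar>a t x - a 0 x\<bar> \<le> e" using a(3)[of t x] * by auto
  qed (use a assms in auto)
qed

text \<open>The lower bound is asked for at t = 0 only; \<open>lip_on_close\<close> preserves half
  of it for small t.\<close>

lemma lip_on_inverse:
  assumes "lip_on S a" "c > 0" "\<And>x. x \<in> S \<Longrightarrow> c \<le> \<bar>a 0 x\<bar>"
  shows "lip_on S (\<lambda>t x. inverse (a t x))"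
proof -
  obtain \<delta> K where a: "\<delta> > 0" "K \<ge> 0"
    "\<And>t x. \<bar>t\<bar> < \<delta> \<Longrightarrow> x \<in> S \<Longrightarrow> \<bar>a t x - a 0 x\<bar> \<le> K * \<bar>t\<bar>"
    by (rule lip_on_diffE[OF assms(1)]) blast
  obtain \<delta>' where d: "\<delta>' > 0" "\<And>t x. \<bar>t\<bar> < \<delta>' \<Longrightarrow> x \<in> S \<Longrightarrow> \<bar>a t x - a 0 x\<bar> \<le> c / 2"
    using lip_on_close[OF assms(1), of "c / 2"] assms(2) by auto
  have low: "\<bar>a t x\<bar> \<ge> c / 2" if "\<bar>t\<bar> < \<delta>'" "x \<in> S" for t x
    using d(2)[OF that] assms(3)[OF that(2)] by linarith
  have inv: "\<bar>inverse (a t x)\<bar> \<le> 2 / c" if "\<bar>t\<bar> < \<delta>'" "x \<in> S" for t x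
    using low[OF that] assms(2) le_imp_inverse_le[of "c / 2" "\<bar>a t x\<bar>"] by (simp add: abs_inverse)
  show ?thesis
  proof (rule lip_onI[of "min \<delta> \<delta>'" _ _ "2 / c" "(2 / c) * K * (2 / c)"])
    fix t x assume *: "\<bar>t\<bar> < min \<delta> \<delta>'" "x \<in> S"
    show "\<bar>inverse (a t x)\<bar> \<le> 2 / c" using inv * by auto
    have "a t x \<noteq> 0" "a 0 x \<noteq> 0"
      using low[of t x] low[of 0 x] * assms(2) d(1) by auto
    then have "inverse (a t x) - inverse (a 0 x) = - (inverse (a t x) * (a t x - a 0 x) * inverse (a 0 x))"
      by (rule inverse_diff_inverse)
    then have "\<bar>inverse (a t x) - inverse (a 0 x)\<bar>
        = \<bar>inverse (a t x)\<bar> * \<bar>a t x - a 0 x\<bar> * \<bar>inverse (a 0 x)\<bar>"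
      by (simp add: abs_mult)
    also have "\<dots> \<le> (2 / c) * (K * \<bar>t\<bar>) * (2 / c)"
      using * inv[of t x] inv[of 0 x] a(2) a(3)[of t x] assms(2) d(1) by (intro mult_mono) auto
    finally show "\<bar>inverse (a t x) - inverse (a 0 x)\<bar> \<le> (2 / c) * K * (2 / c) * \<bar>t\<bar>"
      by (simp add: mult_ac)
  qed (use a d in auto)
qed

lemma lip_on_divide:
  assumes "lip_on S a" "lip_on S b" "c > 0" "\<And>x. x \<in> S \<Longrightarrow> c \<le> \<bar>b 0 x\<bar>"
  shows "lip_on S (\<lambda>t x. a t x / b t x)"
  unfolding divide_inverse using assms by (intro lip_on_mult lip_on_inverse)

text \<open>The difference of two square roots is the difference of the radicands divided by the sum
  of the roots, and the root at t = 0 alone makes that sum at least \<open>sqrt c\<close>.\<close>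

lemma lip_on_sqrt_abs:
  assumes "lip_on S a" "c > 0" "\<And>x. x \<in> S \<Longrightarrow> c \<le> \<bar>a 0 x\<bar>"
  shows "lip_on S (\<lambda>t x. sqrt \<bar>a t x\<bar>)"
proof -
  obtain \<delta> K where a: "\<delta> > 0" "K \<ge> 0" "\<And>t x. \<bar>t\<bar> < \<delta> \<Longrightarrow> x \<in> S \<Longrightarrow> \<bar>a t x\<bar> \<le> K"
    "\<And>t x. \<bar>t\<bar> < \<delta> \<Longrightarrow> x \<in> S \<Longrightarrow> \<bar>a t x - a 0 x\<bar> \<le> K * \<bar>t\<bar>"
    by (rule lip_onE[OF assms(1)]) blast
  show ?thesis
  proof (rule lip_onI[of \<delta> _ _ "sqrt K" "K / sqrt c"])
    fix t x assume *: "\<bar>t\<bar> < \<delta>" "x \<in> S"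
    show "\<bar>sqrt \<bar>a t x\<bar>\<bar> \<le> sqrt K" using a(3)[OF *] by simp
    define u v where "u = sqrt \<bar>a t x\<bar>" and "v = sqrt \<bar>a 0 x\<bar>"
    have v: "sqrt c \<le> v" "0 < sqrt c" and u: "u \<ge> 0" using assms *(2) by (auto simp: u_def v_def)
    have "\<bar>u - v\<bar> * sqrt c \<le> \<bar>u - v\<bar> * (u + v)"
      using u v by (intro mult_left_mono) auto
    also have "u + v = \<bar>u + v\<bar>" using u v by linarith
    also have "\<bar>u - v\<bar> * \<bar>u + v\<bar> = \<bar>(u - v) * (u + v)\<bar>" by (simp only: abs_mult)
    also have "(u - v) * (u + v) = \<bar>a t x\<bar> - \<bar>a 0 x\<bar>"
      by (simp add: u_def v_def algebra_simps)
    also have "\<bar>\<bar>a t x\<bar> - \<bar>a 0 x\<bar>\<bar> \<le> K * \<bar>t\<bar>"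
      using a(4)[OF *] abs_triangle_ineq3[of "a t x" "a 0 x"] by linarith
    finally have "\<bar>u - v\<bar> \<le> K * \<bar>t\<bar> / sqrt c" using v by (simp add: pos_le_divide_eq)
    then show "\<bar>sqrt \<bar>a t x\<bar> - sqrt \<bar>a 0 x\<bar>\<bar> \<le> K / sqrt c * \<bar>t\<bar>" by (simp add: u_def v_def)
  qed (use a in auto)
qed

lemma lip_on_det:
  fixes A :: "real \<Rightarrow> 'b \<Rightarrow> real ^ 'm ^ 'm"
  assumes "\<And>i j. lip_on S (\<lambda>t x. A t x $ i $ j)"
  shows "lip_on S (\<lambda>t x. det (A t x))"
  unfolding det_def by (intro lip_on_sum lip_on_mult lip_on_prod lip_on_const assms)

lemma lip_on_matrix_inv:
  fixes A :: "real \<Rightarrow> 'b \<Rightarrow> real ^ 'm ^ 'm"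
  assumes A: "\<And>i j. lip_on S (\<lambda>t x. A t x $ i $ j)" and c: "c > 0" "\<And>x. x \<in> S \<Longrightarrow> c \<le> \<bar>det (A 0 x)\<bar>"
  shows "lip_on S (\<lambda>t x. matrix_inv (A t x) $ k $ l)"
proof -
  have ld: "lip_on S (\<lambda>t x. det (A t x))" by (intro lip_on_det A)
  obtain \<delta> where d: "\<delta> > 0" "\<And>t x. \<bar>t\<bar> < \<delta> \<Longrightarrow> x \<in> S \<Longrightarrow> \<bar>det (A t x) - det (A 0 x)\<bar> \<le> c / 2"
    using lip_on_close[OF ld, of "c / 2"] c(1) by auto
  have nz: "det (A t x) \<noteq> 0" if "\<bar>t\<bar> < \<delta>" "x \<in> S" for t x
    using d(2)[OF that] c(1) c(2)[OF that(2)] by linarith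
  have "lip_on S (\<lambda>t x. (\<chi> i j. if j = k then axis l 1 $ i else A t x $ i $ j) $ i $ j)" for i j
    by (cases "j = k") (simp_all add: A lip_on_const)
  then have "lip_on S (\<lambda>t x. det (\<chi> i j. if j = k then axis l 1 $ i else A t x $ i $ j) / det (A t x))"
    using c by (intro lip_on_divide[of S _ _ c] lip_on_det A)
  then show ?thesis
    by (rule lip_on_cong[OF _ d(1)]) (simp add: matrix_inv_cramer[OF nz])
qed

section \<open>Families of second order in t and first-order expansions\<close>

lemma quad_onE:
  assumes "quad_on S q"
  obtains \<delta> K where "\<delta> > 0" "K \<ge> 0" "\<And>t x. \<bar>t\<bar> < \<delta> \<Longrightarrow> x \<in> S \<Longrightarrow> \<bar>q t x\<bar> \<le> K * t\<^sup>2"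
  using assms unfolding quad_on_def by blast

lemma quad_on_cong:
  assumes "quad_on S a" "\<epsilon> > 0" "\<And>t x. \<bar>t\<bar> < \<epsilon> \<Longrightarrow> x \<in> S \<Longrightarrow> a t x = b t x"
  shows "quad_on S b"
proof -
  obtain \<delta> K where q: "\<delta> > 0" "K \<ge> 0" "\<And>t x. \<bar>t\<bar> < \<delta> \<Longrightarrow> x \<in> S \<Longrightarrow> \<bar>a t x\<bar> \<le> K * t\<^sup>2"
    by (rule quad_onE[OF assms(1)]) blast
  show ?thesis
    unfolding quad_on_def
    by (rule exI[of _ "min \<delta> \<epsilon>"], intro conjI exI[of _ K] allI impI)
      (use q assms(2) in \<open>auto simp: assms(3)[symmetric]\<close>)
qed

lemma quad_on_add:
  assumes "quad_on S a" "quad_on S b"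
  shows "quad_on S (\<lambda>t x. a t x + b t x)"
proof -
  obtain \<delta> K where a: "\<delta> > 0" "K \<ge> 0" "\<And>t x. \<bar>t\<bar> < \<delta> \<Longrightarrow> x \<in> S \<Longrightarrow> \<bar>a t x\<bar> \<le> K * t\<^sup>2"
    by (rule quad_onE[OF assms(1)]) blast
  obtain \<delta>' K' where b: "\<delta>' > 0" "K' \<ge> 0" "\<And>t x. \<bar>t\<bar> < \<delta>' \<Longrightarrow> x \<in> S \<Longrightarrow> \<bar>b t x\<bar> \<le> K' * t\<^sup>2"
    by (rule quad_onE[OF assms(2)]) blast
  show ?thesis
    unfolding quad_on_def
  proof (rule exI[of _ "min \<delta> \<delta>'"], intro conjI exI[of _ "K + K'"] allI impI)
    fix t x assume "\<bar>t\<bar> < min \<delta> \<delta>'" "x \<in> S"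
    then show "\<bar>a t x + b t x\<bar> \<le> (K + K') * t\<^sup>2"
      using a(3)[of t x] b(3)[of t x] unfolding distrib_right by auto
  qed (use a b in auto)
qed

lemma quad_on_lip_mult:
  assumes "lip_on S a" "quad_on S b"
  shows "quad_on S (\<lambda>t x. a t x * b t x)"
proof -
  obtain \<delta> K where a: "\<delta> > 0" "K \<ge> 0" "\<And>t x. \<bar>t\<bar> < \<delta> \<Longrightarrow> x \<in> S \<Longrightarrow> \<bar>a t x\<bar> \<le> K"
    by (rule lip_on_boundE[OF assms(1)]) blast
  obtain \<delta>' K' where b: "\<delta>' > 0" "K' \<ge> 0" "\<And>t x. \<bar>t\<bar> < \<delta>' \<Longrightarrow> x \<in> S \<Longrightarrow> \<bar>b t x\<bar> \<le> K' * t\<^sup>2"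
    by (rule quad_onE[OF assms(2)]) blast
  show ?thesis
    unfolding quad_on_def
  proof (rule exI[of _ "min \<delta> \<delta>'"], intro conjI exI[of _ "K * K'"] allI impI)
    fix t x assume "\<bar>t\<bar> < min \<delta> \<delta>'" "x \<in> S"
    then have "\<bar>a t x\<bar> * \<bar>b t x\<bar> \<le> K * (K' * t\<^sup>2)"
      using a b by (intro mult_mono) auto
    then show "\<bar>a t x * b t x\<bar> \<le> K * K' * t\<^sup>2" by (simp add: abs_mult mult_ac)
  qed (use a b in auto)
qed

lemma quad_on_cmult: "quad_on S b \<Longrightarrow> quad_on S (\<lambda>t x. c * b t x)"
  by (rule quad_on_lip_mult[OF lip_on_const])

lemma quad_on_diff: "quad_on S a \<Longrightarrow> quad_on S b \<Longrightarrow> quad_on S (\<lambda>t x. a t x - b t x)"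
  using quad_on_add[OF _ quad_on_cmult[of S b "- 1"], of a] by simp

lemma quad_on_zero: "quad_on S (\<lambda>t x. 0)"
  unfolding quad_on_def by (intro exI[of _ 1]) auto

lemma quad_on_sum: "(\<And>i. i \<in> I \<Longrightarrow> quad_on S (a i)) \<Longrightarrow> quad_on S (\<lambda>t x. \<Sum>i\<in>I. a i t x)"
  by (induction I rule: infinite_finite_induct) (simp_all add: quad_on_add quad_on_zero)

lemma quad_on_mult:
  assumes "lip_on S a" "lip_on S b" "\<And>x. x \<in> S \<Longrightarrow> a 0 x = 0" "\<And>x. x \<in> S \<Longrightarrow> b 0 x = 0"
  shows "quad_on S (\<lambda>t x. a t x * b t x)"
proof -
  obtain \<delta> K where a: "\<delta> > 0" "K \<ge> 0"
    "\<And>t x. \<bar>t\<bar> < \<delta> \<Longrightarrow> x \<in> S \<Longrightarrow> \<bar>a t x - a 0 x\<bar> \<le> K * \<bar>t\<bar>"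
    by (rule lip_on_diffE[OF assms(1)]) blast
  obtain \<delta>' K' where b: "\<delta>' > 0" "K' \<ge> 0"
    "\<And>t x. \<bar>t\<bar> < \<delta>' \<Longrightarrow> x \<in> S \<Longrightarrow> \<bar>b t x - b 0 x\<bar> \<le> K' * \<bar>t\<bar>"
    by (rule lip_on_diffE[OF assms(2)]) blast
  show ?thesis
    unfolding quad_on_def
  proof (rule exI[of _ "min \<delta> \<delta>'"], intro conjI exI[of _ "K * K'"] allI impI)
    fix t x assume "\<bar>t\<bar> < min \<delta> \<delta>'" "x \<in> S"
    then have "\<bar>a t x\<bar> * \<bar>b t x\<bar> \<le> (K * \<bar>t\<bar>) * (K' * \<bar>t\<bar>)"
      using a(2) a(3)[of t x] b(2) b(3)[of t x] assms(3,4)[of x] by (intro mult_mono) auto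
    also have "\<dots> = K * K' * t\<^sup>2" by (simp add: power2_eq_square mult_ac flip: abs_mult)
    finally show "\<bar>a t x * b t x\<bar> \<le> K * K' * t\<^sup>2" by (simp add: abs_mult)
  qed (use a b in auto)
qed

text \<open>f = 1 + u with an error of order t^2 and u = O(t), uniformly on S. The rescaling factors
  are only known to be Lipschitz at 0, so such expansions take the place of derivatives.\<close>

definition expansion_on :: "'b set \<Rightarrow> (real \<Rightarrow> 'b \<Rightarrow> real) \<Rightarrow> (real \<Rightarrow> 'b \<Rightarrow> real) \<Rightarrow> bool" where
  "expansion_on S f u \<longleftrightarrow> lip_on S f \<and> lip_on S u \<and> (\<forall>x\<in>S. u 0 x = 0) \<and> quad_on S (\<lambda>t x. f t x - 1 - u t x)"

lemma expansion_on_mult: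
  assumes "expansion_on S f u" "expansion_on S g v"
  shows "expansion_on S (\<lambda>t x. f t x * g t x) (\<lambda>t x. u t x + v t x)"
proof -
  note a = assms[unfolded expansion_on_def]
  \<comment> \<open>The error of the product, arranged so that each summand is a bounded factor
    times a quadratic error or a product of two terms of order t.\<close>
  have "quad_on S (\<lambda>t x. g t x * (f t x - 1 - u t x) + ((1 + u t x) * (g t x - 1 - v t x) + u t x * v t x))"
    using a by (intro quad_on_add quad_on_lip_mult quad_on_mult lip_on_add lip_on_const) auto
  then have "quad_on S (\<lambda>t x. f t x * g t x - 1 - (u t x + v t x))"
    by (rule quad_on_cong[of _ _ 1]) (simp_all add: algebra_simps)
  then show ?thesis
    using a unfolding expansion_on_def by (auto intro: lip_on_mult lip_on_add)
qed

lemma expansion_on_one: "expansion_on S (\<lambda>t x. 1) (\<lambda>t x. 0)"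
  by (auto simp: expansion_on_def quad_on_zero lip_on_const)

lemma expansion_on_power:
  assumes "expansion_on S f u"
  shows "expansion_on S (\<lambda>t x. f t x ^ k) (\<lambda>t x. real k * u t x)"
proof (induction k)
  case (Suc k)
  show ?case using expansion_on_mult[OF assms Suc.IH] by (simp add: algebra_simps)
qed (simp add: expansion_on_one)

lemma expansion_on_self:
  assumes "lip_on S f" "\<And>x. x \<in> S \<Longrightarrow> f 0 x = 1"
  shows "expansion_on S f (\<lambda>t x. f t x - 1)"
  using assms by (auto simp: expansion_on_def quad_on_zero intro!: lip_on_diff lip_on_const)

lemma expansion_on_inverse:
  assumes "lip_on S f" "\<And>x. x \<in> S \<Longrightarrow> f 0 x = 1" "\<epsilon> > 0" "\<And>t x. \<bar>t\<bar> < \<epsilon> \<Longrightarrow> x \<in> S \<Longrightarrow> f t x \<noteq> 0"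
  shows "expansion_on S (\<lambda>t x. inverse (f t x)) (\<lambda>t x. 1 - f t x)"
proof -
  have i: "lip_on S (\<lambda>t x. inverse (f t x))"
    using assms(1,2) by (intro lip_on_inverse[of _ _ 1]) auto
  \<comment> \<open>The error 1 / f - 1 - (1 - f) equals \<open>(f - 1)\<^sup>2 / f\<close>.\<close>
  have "quad_on S (\<lambda>t x. inverse (f t x) * ((f t x - 1) * (f t x - 1)))"
    using assms i by (intro quad_on_lip_mult quad_on_mult lip_on_diff lip_on_const) auto
  then have "quad_on S (\<lambda>t x. inverse (f t x) - 1 - (1 - f t x))"
    by (rule quad_on_cong[OF _ assms(3)]) (simp add: assms(4) field_simps)
  then show ?thesis
    using i assms(1,2) by (auto simp: expansion_on_def intro!: lip_on_diff lip_on_const)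
qed

section \<open>The total mixed scalar curvature of a family of metrics\<close>

lemma gram_cong: "g x = h x \<Longrightarrow> gram g x = gram h x"
  by (simp add: gram_def)

text \<open>The second and third quantity contain derivatives of the metric, hence the open set. The
  lemma identifies a modified variation with a rescaled model off the support, and the metric at t =
  0 with the model.\<close>

lemma flux_cong_open:
  assumes W: "open W" "x \<in> W" and eq: "\<And>z. z \<in> W \<Longrightarrow> g z = h z"
  shows "vol_density g x = vol_density h x" "flux g c k x = flux h c k x"
    "leaf_shape_dev g c i j x = leaf_shape_dev h c i j x"
proof -
  have gr: "gram g z = gram h z" if "z \<in> W" for z
    using eq[OF that] by (rule gram_cong)
  have n: "unit_normal g z = unit_normal h z" if "z \<in> W" for z
    using eq[OF that] by (simp add: unit_normal_def normal_space_def)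
  have "pderiv (\<lambda>z. gram g z $ a $ b) m z = pderiv (\<lambda>z. gram h z $ a $ b) m z" if "z \<in> W" for z a b m
    by (rule pderiv_cong_open[OF W(1) that]) (simp add: gr)
  then have "christoffel g z a b m = christoffel h z a b m" if "z \<in> W" for z a b m
    using that by (simp add: christoffel_def gr)
  moreover have "pderiv (\<lambda>z. unit_normal g z $ a) m z = pderiv (\<lambda>z. unit_normal h z $ a) m z" if "z \<in> W" for z a m
    by (rule pderiv_cong_open[OF W(1) that]) (simp add: n)
  ultimately have s: "shape g a b z = shape h a b z" if "z \<in> W" for z a b
    using that by (simp add: shape_def n)
  show v: "vol_density g x = vol_density h x"
    using W by (simp add: vol_density_def gr)
  show "leaf_shape_dev g c i j x = leaf_shape_dev h c i j x"
    using W by (simp add: leaf_shape_dev_def s)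
  show "flux g c k x = flux h c k x"
    unfolding flux_def v using W by (simp add: accel_def mean_curv_def s n)
qed

lemma integral_vol_eq: "integral_vol g \<Omega> h = (LINT x:\<Omega>|lborel. h x * vol_density g x)"
  by (simp add: integral_vol_def vol_density_def)

lemma continuous_positive_lower_bound:
  fixes f :: "'a::topological_space \<Rightarrow> real"
  assumes "compact S" "continuous_on S f" "\<And>x. x \<in> S \<Longrightarrow> f x > 0"
  obtains c where "c > 0" "\<And>x. x \<in> S \<Longrightarrow> c \<le> f x"
proof (cases "S = {}")
  case False
  then obtain x0 where "x0 \<in> S" "\<forall>x\<in>S. f x0 \<le> f x"
    using continuous_attains_inf[OF assms(1) _ assms(2)] by blast
  then show ?thesis using that[of "f x0"] assms(3) by blast
qed (use that[of 1] in auto)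

lemma has_derivative_zero_if_quadratic:
  fixes f :: "real \<Rightarrow> real"
  assumes "\<delta> > 0" "\<And>t. \<bar>t\<bar> < \<delta> \<Longrightarrow> \<bar>f t - f 0\<bar> \<le> K * t\<^sup>2"
  shows "(f has_real_derivative 0) (at 0)"
proof -
  have "((\<lambda>t. (f t - f 0) / (t - 0)) \<longlongrightarrow> 0) (at 0)"
  proof (rule Lim_null_comparison)
    have "eventually (\<lambda>t. \<bar>t\<bar> < \<delta> \<and> t \<noteq> 0) (at (0::real))"
      using assms(1) by (auto simp: eventually_at dist_real_def)
    then show "eventually (\<lambda>t. norm ((f t - f 0) / (t - 0)) \<le> K * \<bar>t\<bar>) (at 0)"
    proof eventually_elim
      case (elim t)
      then have "\<bar>f t - f 0\<bar> \<le> (K * \<bar>t\<bar>) * \<bar>t\<bar>"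
        using assms(2)[of t] by (simp add: power2_eq_square mult.assoc flip: abs_mult)
      then show ?case using elim by (simp add: pos_divide_le_eq)
    qed
    show "((\<lambda>t. K * \<bar>t\<bar>) \<longlongrightarrow> 0) (at 0)"
      by (auto intro!: tendsto_eq_intros)
  qed
  then show ?thesis by (simp add: has_field_derivative_iff)
qed

text \<open>At al = be = 1 the product is -2, hence the summand 2. With a = al - 1 and b = be - 1,
  its three parts are 2 (n - 1) (1 + n b), - n (1 + n b - a) and - n (1 + a + (n - 2) b) to first
  order; the coefficients n - n of a and 2 n (n - 1) - n^2 - n (n - 2) of b vanish.\<close>

lemma rescaling_stationary:
  fixes al be :: "real \<Rightarrow> real" and n :: nat
  assumes lip: "lip_on S (\<lambda>t _. al t)" "lip_on S (\<lambda>t _. be t)" and one: "al 0 = 1" "be 0 = 1"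
    and pos: "\<epsilon> > 0" "\<And>t. \<bar>t\<bar> < \<epsilon> \<Longrightarrow> al t > 0" "\<And>t. \<bar>t\<bar> < \<epsilon> \<Longrightarrow> be t > 0"
  shows "quad_on S (\<lambda>t _. al t * be t ^ n * (2 * (real n - 1) / al t - real n / (al t)\<^sup>2 - real n / (be t)\<^sup>2) + 2)"
proof -
  note ea = expansion_on_self[OF lip(1)] and eb = expansion_on_self[OF lip(2)]
  have nz: "al t \<noteq> 0" "be t \<noteq> 0" if "\<bar>t\<bar> < \<epsilon>" for t
    using pos(2,3)[OF that] by auto
  have ia: "expansion_on S (\<lambda>t _. inverse (al t)) (\<lambda>t _. 1 - al t)"
    by (rule expansion_on_inverse[OF lip(1) _ pos(1)]) (use one nz in auto)
  have ib: "expansion_on S (\<lambda>t _. inverse (be t)) (\<lambda>t _. 1 - be t)"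
    by (rule expansion_on_inverse[OF lip(2) _ pos(1)]) (use one nz in auto)
  have 1: "expansion_on S (\<lambda>t _. be t ^ n) (\<lambda>t _. real n * (be t - 1))"
    using one by (intro expansion_on_power eb) auto
  have 2: "expansion_on S (\<lambda>t _. be t ^ n * inverse (al t)) (\<lambda>t _. real n * (be t - 1) + (1 - al t))"
    by (rule expansion_on_mult[OF 1 ia])
  have 3: "expansion_on S (\<lambda>t _. al t * (be t ^ n * inverse (be t) ^ 2))
      (\<lambda>t _. (al t - 1) + (real n * (be t - 1) + real 2 * (1 - be t)))"
    using one by (intro expansion_on_mult[OF ea expansion_on_mult[OF 1 expansion_on_power[OF ib]]]) auto
  have "quad_on S (\<lambda>t _. 2 * (real n - 1) * (be t ^ n - 1 - real n * (be t - 1))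
      - real n * (be t ^ n * inverse (al t) - 1 - (real n * (be t - 1) + (1 - al t)))
      - real n * (al t * (be t ^ n * inverse (be t) ^ 2) - 1 - ((al t - 1) + (real n * (be t - 1) + real 2 * (1 - be t)))))"
    by (rule quad_on_diff[OF quad_on_diff[OF quad_on_cmult quad_on_cmult] quad_on_cmult])
      (use 1 2 3 in \<open>simp_all add: expansion_on_def\<close>)
  then show ?thesis
  proof (rule quad_on_cong[OF _ pos(1)])
    fix t x assume "\<bar>t\<bar> < \<epsilon>"
    then have e: "al t * be t ^ n * (2 * (real n - 1) / al t - real n / (al t)\<^sup>2 - real n / (be t)\<^sup>2)
        = 2 * (real n - 1) * be t ^ n - real n * (be t ^ n * inverse (al t)) - real n * (al t * (be t ^ n * inverse (be t) ^ 2))"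
      using nz by (simp add: field_simps power2_eq_square)
    show "2 * (real n - 1) * (be t ^ n - 1 - real n * (be t - 1))
      - real n * (be t ^ n * inverse (al t) - 1 - (real n * (be t - 1) + (1 - al t)))
      - real n * (al t * (be t ^ n * inverse (be t) ^ 2) - 1 - ((al t - 1) + (real n * (be t - 1) + real 2 * (1 - be t))))
      = al t * be t ^ n * (2 * (real n - 1) / al t - real n / (al t)\<^sup>2 - real n / (be t)\<^sup>2) + 2"
      unfolding e by (simp add: algebra_simps)
  qed
qed

text \<open>What both kinds of modified variations have in common: a volume-preserving family
  through the model that coincides off the compact set \<open>K t\<close> with a rescaled model.
  Regularity in t is only asked for as Lipschitz bounds on the metric, its first derivatives and the
  rescaling factors.\<close>

locale model_family =
  fixes y \<epsilon> :: real and \<Omega> :: "'n::finite point set" and gb :: "real \<Rightarrow> 'n tensor2"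
    and al be :: "real \<Rightarrow> real" and K :: "real \<Rightarrow> 'n point set"
  assumes y_nz: "y \<noteq> 0" and eps: "\<epsilon> > 0"
    and \<Omega>: "open \<Omega>" "compact (closure \<Omega>)"
    and bilin: "\<bar>t\<bar> < \<epsilon> \<Longrightarrow> x \<in> \<Omega> \<Longrightarrow> bilinear (gb t x)"
    and sym: "\<bar>t\<bar> < \<epsilon> \<Longrightarrow> x \<in> \<Omega> \<Longrightarrow> gb t x v w = gb t x w v"
    and smooth: "\<bar>t\<bar> < \<epsilon> \<Longrightarrow> smooth_on \<Omega> (\<lambda>x. gb t x v w)"
    and base: "x \<in> \<Omega> \<Longrightarrow> gb 0 x = model y 1 1 x"
    and lipG: "lip_on \<Omega> (\<lambda>t x. gram (gb t) x $ i $ j)"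
    and lipdG: "lip_on \<Omega> (\<lambda>t. pderiv (\<lambda>z. gram (gb t) z $ i $ j) m)"
    and lip_rescale: "lip_on {()} (\<lambda>t _. al t)" "lip_on {()} (\<lambda>t _. be t)" "al 0 = 1" "be 0 = 1"
    and rescale_positive: "\<bar>t\<bar> < \<epsilon> \<Longrightarrow> al t > 0" "\<bar>t\<bar> < \<epsilon> \<Longrightarrow> be t > 0"
    and K: "\<bar>t\<bar> < \<epsilon> \<Longrightarrow> compact (K t)" "\<bar>t\<bar> < \<epsilon> \<Longrightarrow> K t \<subseteq> \<Omega>"
      "\<bar>t\<bar> < \<epsilon> \<Longrightarrow> x \<in> \<Omega> - K t \<Longrightarrow> gb t x = model y (al t) (be t) x"
    and vol: "\<bar>t\<bar> < \<epsilon> \<Longrightarrow> Vol \<Omega> (gb t) = Vol \<Omega> (gb 0)"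
begin

lemma det_lower_bound:
  obtains c where "c > 0" "\<And>x. x \<in> \<Omega> \<Longrightarrow> c \<le> \<bar>det (gram (gb 0) x)\<bar>"
proof -
  interpret m: model_params y 1 1 "TYPE('n)" using y_nz by unfold_locales auto
  have "\<exists>c>0. \<forall>x\<in>closure \<Omega>. c \<le> det (gram (model y 1 1) x)"
  proof (rule continuous_positive_lower_bound[OF \<Omega>(2)])
    show "continuous_on (closure \<Omega>) (\<lambda>x. det (gram (model y 1 1) x))"
      using smooth_on_continuous_on[OF m.det_smooth] by (rule continuous_on_subset) simp
    show "det (gram (model y 1 1) x) > 0" for x :: "'n point"
      using m.det_nz[of x] by (simp add: m.det_gram_model zero_less_power2)
  qed blast
  then obtain c where c: "c > 0" "\<And>x. x \<in> closure \<Omega> \<Longrightarrow> c \<le> det (gram (model y 1 1) x)" by blast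
  have "c \<le> \<bar>det (gram (gb 0) x)\<bar>" if "x \<in> \<Omega>" for x
    using c(2)[of x] that closure_subset[of \<Omega>] gram_cong[of "gb 0" x "model y 1 1", OF base[OF that]] by auto
  then show ?thesis using that c(1) by blast
qed

lemma inv_lower_bound:
  obtains c where "c > 0" "\<And>x. x \<in> \<Omega> \<Longrightarrow> c \<le> matrix_inv (gram (gb 0) x) $ None $ None"
proof -
  interpret m: model_params y 1 1 "TYPE('n)" using y_nz by unfold_locales auto
  have "\<exists>c>0. \<forall>x\<in>closure \<Omega>. c \<le> matrix_inv (gram (model y 1 1) x) $ None $ None"
  proof (rule continuous_positive_lower_bound[OF \<Omega>(2)])
    show "continuous_on (closure \<Omega>) (\<lambda>x. matrix_inv (gram (model y 1 1) x) $ None $ None)"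
      using smooth_on_continuous_on[OF m.P_smooth] by (rule continuous_on_subset) simp
    show "matrix_inv (gram (model y 1 1) x) $ None $ None > 0" for x :: "'n point"
      by (rule m.inv_pos) simp
  qed blast
  then obtain c where c: "c > 0"
    "\<And>x. x \<in> closure \<Omega> \<Longrightarrow> c \<le> matrix_inv (gram (model y 1 1) x) $ None $ None" by blast
  have "c \<le> matrix_inv (gram (gb 0) x) $ None $ None" if "x \<in> \<Omega>" for x
    using c(2)[of x] that closure_subset[of \<Omega>] gram_cong[of "gb 0" x "model y 1 1", OF base[OF that]] by auto
  then show ?thesis using that c(1) by blast
qed

lemma lip_det: "lip_on \<Omega> (\<lambda>t x. det (gram (gb t) x))"
  by (rule lip_on_det[OF lipG])

lemma lip_inv: "lip_on \<Omega> (\<lambda>t x. matrix_inv (gram (gb t) x) $ i $ j)"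
proof -
  obtain c where "c > 0" "\<And>x. x \<in> \<Omega> \<Longrightarrow> c \<le> \<bar>det (gram (gb 0) x)\<bar>"
    using det_lower_bound by blast
  then show ?thesis by (intro lip_on_matrix_inv[of \<Omega> "\<lambda>t. gram (gb t)" c] lipG)
qed

lemma lip_vol_density: "lip_on \<Omega> (\<lambda>t. vol_density (gb t))"
proof -
  obtain c where "c > 0" "\<And>x. x \<in> \<Omega> \<Longrightarrow> c \<le> \<bar>det (gram (gb 0) x)\<bar>"
    using det_lower_bound by blast
  then show ?thesis
    unfolding vol_density_def[abs_def] by (intro lip_on_sqrt_abs[OF lip_det])
qed

text \<open>Nondegeneracy and the spacelike normal hold at t = 0 with uniform lower bounds, by
  compactness of the closure of \<Omega>; the Lipschitz bounds preserve half of each on a common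
  interval of t.\<close>

lemma foliated_metric_near_zero:
  obtains \<delta> where "0 < \<delta>" "\<delta> \<le> \<epsilon>" "\<And>t. \<bar>t\<bar> < \<delta> \<Longrightarrow> foliated_metric \<Omega> (gb t)"
proof -
  obtain c where c: "c > 0" "\<And>x. x \<in> \<Omega> \<Longrightarrow> c \<le> \<bar>det (gram (gb 0) x)\<bar>"
    using det_lower_bound by blast
  obtain c' where c': "c' > 0" "\<And>x. x \<in> \<Omega> \<Longrightarrow> c' \<le> matrix_inv (gram (gb 0) x) $ None $ None"
    using inv_lower_bound by blast
  obtain d where d: "d > 0" "\<And>t x. \<bar>t\<bar> < d \<Longrightarrow> x \<in> \<Omega> \<Longrightarrow> \<bar>det (gram (gb t) x) - det (gram (gb 0) x)\<bar> \<le> c / 2"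
    by (rule lip_on_close[OF lip_det, of "c / 2"]) (use c(1) in auto)
  obtain d' where d': "d' > 0" "\<And>t x. \<bar>t\<bar> < d' \<Longrightarrow> x \<in> \<Omega> \<Longrightarrow>
      \<bar>matrix_inv (gram (gb t) x) $ None $ None - matrix_inv (gram (gb 0) x) $ None $ None\<bar> \<le> c' / 2"
    by (rule lip_on_close[OF lip_inv, of "c' / 2" None None]) (use c'(1) in auto)
  show ?thesis
  proof (rule that[of "min \<epsilon> (min d d')"])
    fix t assume t: "\<bar>t\<bar> < min \<epsilon> (min d d')"
    show "foliated_metric \<Omega> (gb t)"
    proof
      show "det (gram (gb t) x) \<noteq> 0" if "x \<in> \<Omega>" for x
      proof -
        have "\<bar>det (gram (gb t) x) - det (gram (gb 0) x)\<bar> \<le> c / 2"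
          by (rule d(2)) (use t that in auto)
        then show ?thesis using c(1) c(2)[OF that] by linarith
      qed
      show "0 < matrix_inv (gram (gb t) x) $ None $ None" if "x \<in> \<Omega>" for x
      proof -
        have "\<bar>matrix_inv (gram (gb t) x) $ None $ None - matrix_inv (gram (gb 0) x) $ None $ None\<bar> \<le> c' / 2"
          by (rule d'(2)) (use t that in auto)
        then show ?thesis using c'(1) c'(2)[OF that] by linarith
      qed
    qed (use t in \<open>auto intro: bilin sym smooth \<Omega>\<close>)
  qed (use eps d d' in auto)
qed

text \<open>The shape operator involves the metric, its inverse and first derivatives. Derivatives
  of the inverse and of N are reduced to those of the metric by \<open>pderiv_P\<close> and
  \<open>pderiv_N\<close>, so that \<open>lipG\<close> and \<open>lipdG\<close> suffice.\<close>

lemma lip_leaf_shape_dev: "lip_on \<Omega> (\<lambda>t. leaf_shape_dev (gb t) c i k)"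
proof -
  let ?P = "\<lambda>i j t x. matrix_inv (gram (gb t) x) $ i $ j"
  let ?d = "\<lambda>a b m t x. pderiv (\<lambda>z. gram (gb t) z $ a $ b) m x"
  obtain \<delta> where \<delta>: "0 < \<delta>" "\<delta> \<le> \<epsilon>" "\<And>t. \<bar>t\<bar> < \<delta> \<Longrightarrow> foliated_metric \<Omega> (gb t)"
    using foliated_metric_near_zero by blast
  obtain c' where c': "c' > 0" "\<And>x. x \<in> \<Omega> \<Longrightarrow> c' \<le> ?P None None 0 x"
    using inv_lower_bound by blast
  then have c'': "\<And>x. x \<in> \<Omega> \<Longrightarrow> c' \<le> \<bar>?P None None 0 x\<bar>" by force
  have sq: "lip_on \<Omega> (\<lambda>t x. sqrt \<bar>?P None None t x\<bar>)"
    by (rule lip_on_sqrt_abs[OF lip_inv c'(1) c''])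
  have sqc: "sqrt c' > 0" "\<And>x. x \<in> \<Omega> \<Longrightarrow> sqrt c' \<le> \<bar>sqrt \<bar>?P None None 0 x\<bar>\<bar>"
    using c'(1) c'' by auto
  have N: "lip_on \<Omega> (\<lambda>t x. unit_normal (gb t) x $ k)" for k
    by (rule lip_on_cong[OF lip_on_divide[OF lip_inv[of k None] sq sqc] \<delta>(1)])
      (simp_all add: foliated_metric.N_eq'[OF \<delta>(3)])
  have dP: "lip_on \<Omega> (\<lambda>t. pderiv (\<lambda>z. ?P k j t z) m)" for k j m
  proof (rule lip_on_cong[OF _ \<delta>(1)])
    show "lip_on \<Omega> (\<lambda>t x. - (\<Sum>a\<in>UNIV. \<Sum>b\<in>UNIV. ?P k a t x * ?d a b m t x * ?P b j t x))"
      by (intro lip_on_uminus lip_on_sum lip_on_mult lip_inv lipdG)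
  qed (simp add: foliated_metric.pderiv_P[OF \<delta>(3)])
  have dN: "lip_on \<Omega> (\<lambda>t. pderiv (\<lambda>z. unit_normal (gb t) z $ k) m)" for k m
  proof (rule lip_on_cong[OF _ \<delta>(1)])
    let ?Q = "\<lambda>t x. 2 * ?P None None t x * sqrt \<bar>?P None None t x\<bar>"
    have "lip_on \<Omega> ?Q" by (intro lip_on_mult lip_inv sq lip_on_const)
    moreover have "2 * c' * sqrt c' > 0" using c'(1) sqc(1) by simp
    moreover have "2 * c' * sqrt c' \<le> \<bar>?Q 0 x\<bar>" if "x \<in> \<Omega>" for x
      unfolding abs_mult using c''[OF that] sqc(2)[OF that] c'(1)
      by (intro mult_mono) auto
    ultimately show "lip_on \<Omega> (\<lambda>t x. pderiv (\<lambda>z. ?P k None t z) m x / sqrt \<bar>?P None None t x\<bar>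
        - ?P k None t x * pderiv (\<lambda>z. ?P None None t z) m x / ?Q t x)"
      by (intro lip_on_diff lip_on_divide[OF dP sq sqc] lip_on_divide[OF lip_on_mult[OF lip_inv dP]])
    fix t x assume t: "\<bar>t\<bar> < \<delta>" "x \<in> \<Omega>"
    interpret f: foliated_metric \<Omega> "gb t" by (rule \<delta>(3)[OF t(1)])
    show "pderiv (\<lambda>z. ?P k None t z) m x / sqrt \<bar>?P None None t x\<bar>
        - ?P k None t x * pderiv (\<lambda>z. ?P None None t z) m x / ?Q t x
      = pderiv (\<lambda>z. unit_normal (gb t) z $ k) m x"
      using f.pderiv_N[OF t(2)] f.inv_pos[OF t(2)] by simp
  qed
  have ch: "lip_on \<Omega> (\<lambda>t x. christoffel (gb t) x k i j)" for k i j
  proof -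
    have "lip_on \<Omega> (\<lambda>t x. (1 / 2) * (\<Sum>l\<in>UNIV. ?P k l t x * (?d j l i t x + ?d i l j t x - ?d i j l t x)))"
      by (intro lip_on_mult lip_on_const lip_on_sum lip_on_diff lip_on_add lip_inv lipdG)
    then show ?thesis by (simp add: christoffel_def)
  qed
  show ?thesis
    unfolding leaf_shape_dev_def[abs_def] shape_def
    by (intro lip_on_diff lip_on_add lip_on_sum lip_on_mult dN ch N lip_on_const)
qed

definition remainder :: "real \<Rightarrow> 'n point \<Rightarrow> real" where
  "remainder t x = vol_density (gb t) x * ((\<Sum>i\<in>UNIV. leaf_shape_dev (gb t) (- y) i i x)\<^sup>2
      - (\<Sum>i\<in>UNIV. \<Sum>k\<in>UNIV. leaf_shape_dev (gb t) (- y) i k x * leaf_shape_dev (gb t) (- y) k i x))"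

text \<open>At t = 0 the leaves are umbilical with factor - y, so each entry of T vanishes there and
  each product of two entries is quadratic in t.\<close>

lemma quad_remainder: "quad_on \<Omega> remainder"
proof -
  interpret m: model_params y 1 1 "TYPE('n)" using y_nz by unfold_locales auto
  have z: "leaf_shape_dev (gb 0) (- y) i k x = 0" if "x \<in> \<Omega>" for i k x
    using flux_cong_open(3)[OF \<Omega>(1) that base] m.leaf_shape_dev_model by simp
  show ?thesis
    unfolding remainder_def[abs_def] power2_eq_square
    by (intro quad_on_lip_mult lip_vol_density quad_on_diff quad_on_sum quad_on_mult lip_on_sum lip_leaf_shape_dev)
      (simp_all add: z)
qed

lemma Vol_eq: "Vol \<Omega> (gb t) = (LINT x:\<Omega>|lborel. vol_density (gb t) x)"
  by (simp add: Vol_def integral_vol_eq)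

text \<open>The factor in parentheses collects the divergence of the flux, computed from the
  rescaled model, and the constant multiple of the volume, which volume preservation evaluates at t
  = 0. Continuity of \<open>remainder t\<close> is recorded for the integral estimate in
  \<open>J_stationary\<close>.\<close>

lemma J_expansion:
  obtains \<delta> where "0 < \<delta>" "\<delta> \<le> \<epsilon>" "\<And>t. \<bar>t\<bar> < \<delta> \<Longrightarrow> continuous_on \<Omega> (remainder t)"
    "\<And>t. \<bar>t\<bar> < \<delta> \<Longrightarrow> J \<Omega> (gb t) = Vol \<Omega> (gb 0) * (real CARD('n) * y\<^sup>2) *
       (al t * be t ^ CARD('n) * (2 * (real CARD('n) - 1) / al t - real CARD('n) / (al t)\<^sup>2 - real CARD('n) / (be t)\<^sup>2)
         - (real CARD('n) - 1)) + (LINT x:\<Omega>|lborel. remainder t x)"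
proof -
  let ?n = "real CARD('n)"
  interpret m: model_params y 1 1 "TYPE('n)" using y_nz by unfold_locales auto
  obtain \<delta> where \<delta>: "0 < \<delta>" "\<delta> \<le> \<epsilon>" "\<And>t. \<bar>t\<bar> < \<delta> \<Longrightarrow> foliated_metric \<Omega> (gb t)"
    using foliated_metric_near_zero by blast
  obtain d B where B: "d > 0" "B \<ge> 0" "\<And>t x. \<bar>t\<bar> < d \<Longrightarrow> x \<in> \<Omega> \<Longrightarrow> \<bar>vol_density (gb t) x\<bar> \<le> B"
    by (rule lip_on_boundE[OF lip_vol_density]) blast
  obtain d' B' where B': "d' > 0" "B' \<ge> 0" "\<And>t x. \<bar>t\<bar> < d' \<Longrightarrow> x \<in> \<Omega> \<Longrightarrow> \<bar>remainder t x\<bar> \<le> B' * t\<^sup>2"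
    by (rule quad_onE[OF quad_remainder]) blast
  have bd: "bounded \<Omega>" using \<Omega>(2) compact_imp_bounded bounded_subset closure_subset by blast
  have ct: "continuous_on \<Omega> (remainder t)" if "\<bar>t\<bar> < \<delta>" for t
  proof -
    interpret f: foliated_metric \<Omega> "gb t" by (rule \<delta>(3)[OF that])
    have "smooth_on \<Omega> (\<lambda>x. leaf_shape_dev (gb t) (- y) i k x)" for i k
      unfolding leaf_shape_dev_def by (intro smooth_on_diff f.shape_smooth smooth_on_const \<Omega>)
    then show ?thesis
      unfolding remainder_def[abs_def]
      by (intro smooth_on_continuous_on smooth_on_mult f.vol_density_smooth smooth_on_diff
          smooth_on_sum smooth_on_power \<Omega>)
  qed
  show ?thesis
  proof (rule that[of "min \<delta> (min d d')"])
    fix t assume t': "\<bar>t\<bar> < min \<delta> (min d d')"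
    then have t: "\<bar>t\<bar> < \<delta>" "\<bar>t\<bar> < d" "\<bar>t\<bar> < d'" "\<bar>t\<bar> < \<epsilon>" using \<delta>(2) by auto
    show "continuous_on \<Omega> (remainder t)" by (rule ct[OF t(1)])
    interpret f: foliated_metric \<Omega> "gb t" by (rule \<delta>(3)[OF t(1)])
    interpret f0: foliated_metric \<Omega> "gb 0" by (rule \<delta>(3)) (use \<delta>(1) in simp)
    interpret p: model_params y "al t" "be t" "TYPE('n)"
      using y_nz rescale_positive t(4) by unfold_locales auto
    \<comment> \<open>The divergence of the rescaled model's flux per unit of volume density of
      \<open>gb 0\<close>.\<close>
    define \<kappa> where "\<kappa> = ?n * y\<^sup>2 * (al t * be t ^ CARD('n) * (2 * (?n - 1) / al t - ?n / (al t)\<^sup>2 - ?n / (be t)\<^sup>2))"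
    \<comment> \<open>Neither flux has to vanish near the boundary of \<Omega>, but their difference
      does, so its divergence integrates to zero.\<close>
    define Z where "Z k x = flux (gb t) (- y) k x - flux (model y (al t) (be t)) (- y) k x" for k x
    have Zs: "smooth_on \<Omega> (Z k)" for k
      unfolding Z_def[abs_def]
      by (intro smooth_on_diff f.flux_smooth smooth_on_mono[OF p.flux_smooth] \<Omega>) simp
    have Z0: "Z k x = 0" if "x \<in> \<Omega> - K t" for k x
    proof -
      have "open (\<Omega> - K t)" using K(1)[OF t(4)] \<Omega>(1) by (simp add: open_Diff compact_imp_closed)
      from flux_cong_open(2)[OF this that K(3)[OF t(4)]] show ?thesis by (simp add: Z_def)
    qed
    note Zi = integral_pderiv_zero[OF \<Omega>(1) Zs K(1)[OF t(4)] K(2)[OF t(4)] Z0]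
    have pt: "S_mix (gb t) x * vol_density (gb t) x = (\<Sum>k\<in>UNIV. pderiv (Z k) k x)
        + (\<kappa> * vol_density (gb 0) x - ?n * (?n - 1) * y\<^sup>2 * vol_density (gb t) x + remainder t x)" if "x \<in> \<Omega>" for x
    proof -
      have vd: "vol_density (model y (al t) (be t)) x = al t * be t ^ CARD('n) * vol_density (gb 0) x"
        using vol_density_model_rescale[OF y_nz rescale_positive[OF t(4)], of x]
          flux_cong_open(1)[OF \<Omega>(1) that base] by simp
      have "pderiv (Z k) k x = pderiv (flux (gb t) (- y) k) k x - pderiv (flux (model y (al t) (be t)) (- y) k) k x" for k
        unfolding Z_def[abs_def]
        by (intro pderiv_diff smooth_on_differentiable[OF f.flux_smooth that] smooth_on_differentiable[OF p.flux_smooth]) simp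
      then have "(\<Sum>k\<in>UNIV. pderiv (Z k) k x) = (\<Sum>k\<in>UNIV. pderiv (flux (gb t) (- y) k) k x)
          - (\<Sum>k\<in>UNIV. pderiv (flux (model y (al t) (be t)) (- y) k) k x)"
        by (simp add: sum_subtractf)
      moreover have "(\<Sum>k\<in>UNIV. pderiv (flux (model y (al t) (be t)) (- y) k) k x) = \<kappa> * vol_density (gb 0) x"
        unfolding p.divergence_flux_model vd \<kappa>_def by (simp only: mult_ac)
      ultimately have "(\<Sum>k\<in>UNIV. pderiv (flux (gb t) (- y) k) k x)
          = (\<Sum>k\<in>UNIV. pderiv (Z k) k x) + \<kappa> * vol_density (gb 0) x"
        by simp
      then show ?thesis
        using f.S_mix_density[OF that, of "- y"] by (simp add: remainder_def)
    qed
    have iv: "set_integrable lborel \<Omega> (vol_density (gb t))"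
      by (rule set_integrable_bounded_continuous(1)[OF \<Omega>(1) bd smooth_on_continuous_on[OF f.vol_density_smooth] B(3)[OF t(2)]])
    have i0: "set_integrable lborel \<Omega> (vol_density (gb 0))"
      by (rule set_integrable_bounded_continuous(1)[OF \<Omega>(1) bd smooth_on_continuous_on[OF f0.vol_density_smooth] B(3)])
        (use B(1) in auto)
    have ir: "set_integrable lborel \<Omega> (remainder t)"
      by (rule set_integrable_bounded_continuous(1)[OF \<Omega>(1) bd ct[OF t(1)] B'(3)[OF t(3)]])
    have iZ: "set_integrable lborel \<Omega> (\<lambda>x. \<Sum>k\<in>UNIV. pderiv (Z k) k x)"
      "(LINT x:\<Omega>|lborel. (\<Sum>k\<in>UNIV. pderiv (Z k) k x)) = 0"
    proof -
      show "set_integrable lborel \<Omega> (\<lambda>x. \<Sum>k\<in>UNIV. pderiv (Z k) k x)"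
        unfolding set_integrable_def scaleR_sum_right
        by (intro Bochner_Integration.integrable_sum Zi(1)[unfolded set_integrable_def])
      have i: "integrable lborel (\<lambda>x. indicator \<Omega> x *\<^sub>R pderiv (Z k) k x)" for k
        using Zi(1) unfolding set_integrable_def .
      have e: "(LINT x|lborel. indicator \<Omega> x *\<^sub>R pderiv (Z k) k x) = 0" for k
        using Zi(2) unfolding set_lebesgue_integral_def .
      have "(LINT x|lborel. (\<Sum>k\<in>UNIV. indicator \<Omega> x *\<^sub>R pderiv (Z k) k x))
          = (\<Sum>k\<in>UNIV. LINT x|lborel. indicator \<Omega> x *\<^sub>R pderiv (Z k) k x)"
        by (rule Bochner_Integration.integral_sum[OF i])
      then show "(LINT x:\<Omega>|lborel. (\<Sum>k\<in>UNIV. pderiv (Z k) k x)) = 0"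
        unfolding set_lebesgue_integral_def scaleR_sum_right e by simp
    qed
    have "J \<Omega> (gb t) = (LINT x:\<Omega>|lborel. (\<Sum>k\<in>UNIV. pderiv (Z k) k x)
        + (\<kappa> * vol_density (gb 0) x - ?n * (?n - 1) * y\<^sup>2 * vol_density (gb t) x + remainder t x))"
      unfolding J_def integral_vol_eq using \<Omega>(1) by (intro set_lebesgue_integral_cong) (auto simp: pt)
    also have "\<dots> = \<kappa> * Vol \<Omega> (gb 0) - ?n * (?n - 1) * y\<^sup>2 * Vol \<Omega> (gb t) + (LINT x:\<Omega>|lborel. remainder t x)"
      using iv i0 ir iZ by (simp add: set_integral_add set_integral_diff Vol_eq)
    also have "\<dots> = Vol \<Omega> (gb 0) * (?n * y\<^sup>2) *
       (al t * be t ^ CARD('n) * (2 * (?n - 1) / al t - ?n / (al t)\<^sup>2 - ?n / (be t)\<^sup>2) - (?n - 1))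
       + (LINT x:\<Omega>|lborel. remainder t x)"
      unfolding vol[OF t(4)] \<kappa>_def by (simp only: algebra_simps)
    finally show "J \<Omega> (gb t) = Vol \<Omega> (gb 0) * (?n * y\<^sup>2) *
       (al t * be t ^ CARD('n) * (2 * (?n - 1) / al t - ?n / (al t)\<^sup>2 - ?n / (be t)\<^sup>2) - (?n - 1))
       + (LINT x:\<Omega>|lborel. remainder t x)" .
  qed (use \<delta> B(1) B'(1) in auto)
qed

lemma J_stationary: "((\<lambda>t. J \<Omega> (gb t)) has_real_derivative 0) (at 0)"
proof -
  let ?n = "real CARD('n)"
  define k where "k t = al t * be t ^ CARD('n) * (2 * (?n - 1) / al t - ?n / (al t)\<^sup>2 - ?n / (be t)\<^sup>2)" for t
  obtain \<delta> where \<delta>: "0 < \<delta>" "\<delta> \<le> \<epsilon>" "\<And>t. \<bar>t\<bar> < \<delta> \<Longrightarrow> continuous_on \<Omega> (remainder t)"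
    "\<And>t. \<bar>t\<bar> < \<delta> \<Longrightarrow> J \<Omega> (gb t) = Vol \<Omega> (gb 0) * (?n * y\<^sup>2) * (k t - (?n - 1)) + (LINT x:\<Omega>|lborel. remainder t x)"
    using J_expansion unfolding k_def by blast
  have "quad_on {()} (\<lambda>t _. k t + 2)"
    unfolding k_def using rescale_positive by (intro rescaling_stationary[OF lip_rescale eps])
  then obtain d A where A: "d > 0" "A \<ge> 0" "\<And>t x. \<bar>t\<bar> < d \<Longrightarrow> x \<in> {()} \<Longrightarrow> \<bar>k t + 2\<bar> \<le> A * t\<^sup>2"
    by (rule quad_onE) blast
  obtain d' B where B: "d' > 0" "B \<ge> 0" "\<And>t x. \<bar>t\<bar> < d' \<Longrightarrow> x \<in> \<Omega> \<Longrightarrow> \<bar>remainder t x\<bar> \<le> B * t\<^sup>2"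
    by (rule quad_onE[OF quad_remainder]) blast
  have bd: "bounded \<Omega>" using \<Omega>(2) compact_imp_bounded bounded_subset closure_subset by blast
  define V where "V = Vol \<Omega> (gb 0) * (?n * y\<^sup>2)"
  define R where "R t = (LINT x:\<Omega>|lborel. remainder t x)" for t
  have R: "\<bar>R t\<bar> \<le> B * t\<^sup>2 * measure lborel \<Omega>" if "\<bar>t\<bar> < \<delta>" "\<bar>t\<bar> < d'" for t
    unfolding R_def
    by (rule set_integrable_bounded_continuous(2)[OF \<Omega>(1) bd \<delta>(3)[OF that(1)] B(3)[OF that(2)]])
  have Js: "J \<Omega> (gb s) = V * (k s - (?n - 1)) + R s" if "\<bar>s\<bar> < \<delta>" for s
    using \<delta>(4)[OF that] unfolding V_def R_def .
  \<comment> \<open>The quadratic bound forces k + 2 to vanish at t = 0.\<close>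
  have k0: "k 0 = - 2" using A(3)[of 0 "()"] A(1) by simp
  have R0: "R 0 = 0" using R[of 0] \<delta>(1) B(1) by simp
  show ?thesis
  proof (rule has_derivative_zero_if_quadratic[of "min \<delta> (min d d')" _ "\<bar>V\<bar> * A + B * measure lborel \<Omega>"])
    fix t assume t: "\<bar>t\<bar> < min \<delta> (min d d')"
    have "J \<Omega> (gb t) - J \<Omega> (gb 0) = V * (k t + 2) + R t"
      using Js[of t] Js[of 0] \<delta>(1) t by (simp add: k0 R0 algebra_simps)
    also have "\<bar>\<dots>\<bar> \<le> \<bar>V\<bar> * \<bar>k t + 2\<bar> + \<bar>R t\<bar>"
      unfolding abs_mult[symmetric] by (rule abs_triangle_ineq)
    also have "\<dots> \<le> \<bar>V\<bar> * (A * t\<^sup>2) + B * t\<^sup>2 * measure lborel \<Omega>"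
      using A(3)[of t "()"] R[of t] t by (intro add_mono mult_left_mono) auto
    finally show "\<bar>J \<Omega> (gb t) - J \<Omega> (gb 0)\<bar> \<le> (\<bar>V\<bar> * A + B * measure lborel \<Omega>) * t\<^sup>2"
      by (simp add: algebra_simps)
  qed (use \<delta>(1) A(1) B(1) in auto)
qed

end

section \<open>Regularity of variations\<close>

lemma Ck_on_slice:
  fixes H :: "real \<times> 'a::real_normed_vector \<Rightarrow> real"
  assumes "open U" "t \<in> I"
  shows "Ck_on k (I \<times> U) H \<Longrightarrow> Ck_on k U (\<lambda>x. H (t, x))"
proof (induction k arbitrary: H)
  case 0
  have "continuous_on ((\<lambda>x. (t, x)) ` U) H"
    using 0 assms(2) by (auto intro: continuous_on_subset)
  moreover have "continuous_on U (\<lambda>x. (t, x))"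
    by (intro continuous_on_Pair continuous_on_const continuous_on_id)
  ultimately have "continuous_on U (\<lambda>x. H (t, x))"
    by (rule continuous_on_compose2) auto
  then show ?case by simp
next
  case (Suc k)
  have P: "((\<lambda>x. (t, x)) has_derivative (\<lambda>v. (0, v))) (at x)" for x :: 'a
    by (auto intro!: derivative_eq_intros)
  show ?case
  proof (rule Ck_on_SucI[OF assms(1)])
    fix x assume "x \<in> U"
    then have "(H has_derivative frechet_derivative H (at (t, x))) (at (t, x))"
      using Ck_on_has_derivative[OF Suc.prems] assms(2) by auto
    from diff_chain_at[OF P this]
    show "((\<lambda>x. H (t, x)) has_derivative (\<lambda>v. frechet_derivative H (at (t, x)) (0, v))) (at x)"
      by (simp add: o_def)
  next
    show "Ck_on k U (\<lambda>x. frechet_derivative H (at (t, x)) (0, v))" for v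
      using Suc.prems by (intro Suc.IH) auto
  qed
qed

lemma smooth_on_slice:
  fixes H :: "real \<times> 'a::real_normed_vector \<Rightarrow> real"
  assumes "open U" "t \<in> I" "smooth_on (I \<times> U) H"
  shows "smooth_on U (\<lambda>x. H (t, x))"
  unfolding smooth_on_def
  by (intro allI Ck_on_slice[OF assms(1,2)]) (rule assms(3)[unfolded smooth_on_def, rule_format])

text \<open>On the product of the compact interval from - \<epsilon> / 2 to \<epsilon> / 2 with S,
  both H and its t-derivative are bounded; the mean value inequality in t does the rest.\<close>

lemma lip_on_smooth_family:
  fixes H :: "real \<times> 'a::real_normed_vector \<Rightarrow> real"
  assumes eps: "\<epsilon> > 0" and smooth: "smooth_on ({-\<epsilon><..<\<epsilon>} \<times> U) H" and S: "compact S" "S \<subseteq> U"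
  shows "lip_on S (\<lambda>t x. H (t, x))"
proof -
  let ?Q = "{-(\<epsilon> / 2)..\<epsilon> / 2} \<times> S" and ?W = "{-\<epsilon><..<\<epsilon>} \<times> U"
  have sub: "?Q \<subseteq> ?W" using eps S by auto
  have cQ: "compact ?Q" using S by (intro compact_Times) auto
  have bnd: "\<exists>B. \<forall>p\<in>?Q. \<bar>f p\<bar> \<le> B" if "continuous_on ?W f" for f :: "real \<times> 'a \<Rightarrow> real"
  proof -
    have "bounded (f ` ?Q)"
      by (rule compact_imp_bounded[OF compact_continuous_image[OF continuous_on_subset[OF that sub] cQ]])
    then show ?thesis unfolding bounded_iff real_norm_def by blast
  qed
  obtain A where A: "\<And>p. p \<in> ?Q \<Longrightarrow> \<bar>H p\<bar> \<le> A"
    using bnd[OF smooth_on_continuous_on[OF smooth]] by blast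
  obtain B where B: "\<And>p. p \<in> ?Q \<Longrightarrow> \<bar>frechet_derivative H (at p) (1, 0)\<bar> \<le> B"
    using bnd[OF smooth_on_continuous_on[OF smooth_on_frechet_derivative[OF smooth]]] by blast
  show ?thesis
  proof (rule lip_onI[of "\<epsilon> / 2" _ _ A B])
    fix t x assume tx: "\<bar>t\<bar> < \<epsilon> / 2" "x \<in> S"
    show "\<bar>H (t, x)\<bar> \<le> A" using tx by (intro A) auto
    have "norm (H (t, x) - H (0, x)) \<le> B * norm (t - 0)"
    proof (rule field_differentiable_bound[where S = "{-(\<epsilon> / 2)..\<epsilon> / 2}"])
      fix s assume s: "s \<in> {-(\<epsilon> / 2)..\<epsilon> / 2}"
      have P: "((\<lambda>s. (s, x)) has_derivative (\<lambda>r. (r, 0))) (at s)"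
        by (auto intro!: derivative_eq_intros)
      have W: "(s, x) \<in> ?W" using s tx(2) S(2) eps by auto
      have d: "((\<lambda>s. H (s, x)) has_derivative (\<lambda>r. frechet_derivative H (at (s, x)) (r, 0))) (at s)"
        using diff_chain_at[OF P smooth_on_has_derivative[OF smooth W]] by (simp add: o_def)
      have lin: "linear (frechet_derivative H (at (s, x)))"
        by (rule linear_frechet_derivative[OF smooth_on_differentiable[OF smooth W]])
      have eq: "(\<lambda>r. frechet_derivative H (at (s, x)) (r, 0)) = (*) (frechet_derivative H (at (s, x)) (1, 0))"
      proof
        show "frechet_derivative H (at (s, x)) (r, 0) = frechet_derivative H (at (s, x)) (1, 0) * r" for r
          using linear_scale[OF lin, of r "(1, 0)"] by (simp add: mult.commute)
      qed
      show "((\<lambda>s. H (s, x)) has_field_derivative frechet_derivative H (at (s, x)) (1, 0))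
          (at s within {-(\<epsilon> / 2)..\<epsilon> / 2})"
        unfolding has_field_derivative_def eq[symmetric] by (rule has_derivative_at_withinI[OF d])
      show "norm (frechet_derivative H (at (s, x)) (1, 0)) \<le> B"
        using B[of "(s, x)"] s tx by auto
    qed (use tx eps in auto)
    then show "\<bar>H (t, x) - H (0, x)\<bar> \<le> B * \<bar>t\<bar>" by simp
  qed (use eps in auto)
qed

text \<open>The regularity that \<open>model_family\<close> demands of each metric entry. Smoothness
  is kept on the open set U, so that partial derivatives make sense at all points of the compact set
  S.\<close>

definition lip_C1_on :: "real \<Rightarrow> 'n::finite point set \<Rightarrow> 'n point set \<Rightarrow> (real \<Rightarrow> 'n point \<Rightarrow> real) \<Rightarrow> bool" where
  "lip_C1_on \<epsilon> U S a \<longleftrightarrow> (\<forall>t. \<bar>t\<bar> < \<epsilon> \<longrightarrow> smooth_on U (a t)) \<and> lip_on S a \<and> (\<forall>i. lip_on S (\<lambda>t. pderiv (a t) i))"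

lemma lip_on_subset: "lip_on S a \<Longrightarrow> T \<subseteq> S \<Longrightarrow> lip_on T a"
  unfolding lip_on_def by (meson subsetD)

lemma lip_on_transfer: "lip_on {()} (\<lambda>t _. c t) \<Longrightarrow> lip_on S (\<lambda>t _. c t)"
  unfolding lip_on_def by auto

locale variation_domain =
  fixes \<epsilon> :: real and U S :: "'n::finite point set"
  assumes eps: "\<epsilon> > 0" and U: "open U" and S: "compact S" "S \<subseteq> U"
begin

text \<open>A spatial partial derivative is the derivative of the joint function of (t, x) in a
  direction with t-component 0, hence again jointly smooth, and \<open>lip_on_smooth_family\<close>
  applies to it.\<close>

lemma lip_C1_smooth_family:
  assumes "smooth_on ({-\<epsilon><..<\<epsilon>} \<times> U) (\<lambda>(t, x). h t x)"
  shows "lip_C1_on \<epsilon> U S h"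
proof -
  let ?H = "\<lambda>(t, x). h t x"
  have op: "open ({-\<epsilon><..<\<epsilon>} \<times> U)" by (intro open_Times U) auto
  have s: "smooth_on U (h t)" if "\<bar>t\<bar> < \<epsilon>" for t
  proof -
    have "t \<in> {-\<epsilon><..<\<epsilon>}" using that by auto
    from smooth_on_slice[OF U this assms] show ?thesis by simp
  qed
  have p: "pderiv (h t) i x = frechet_derivative ?H (at (t, x)) (0, axis i 1)" if "\<bar>t\<bar> < \<epsilon>" "x \<in> S" for t i x
  proof -
    have P: "((\<lambda>x. (t, x)) has_derivative (\<lambda>v. (0, v))) (at x)"
      by (auto intro!: derivative_eq_intros)
    have "(t, x) \<in> {-\<epsilon><..<\<epsilon>} \<times> U" using that S by auto
    from diff_chain_at[OF P smooth_on_has_derivative[OF assms this]]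
    have "(h t has_derivative (\<lambda>v. frechet_derivative ?H (at (t, x)) (0, v))) (at x)"
      by (simp add: o_def)
    then show ?thesis by (rule has_derivative_imp_pderiv)
  qed
  have "lip_on S (\<lambda>t. pderiv (h t) i)" for i
  proof (rule lip_on_cong[OF _ eps])
    show "lip_on S (\<lambda>t x. frechet_derivative ?H (at (t, x)) (0, axis i 1))"
      by (rule lip_on_smooth_family[OF eps smooth_on_frechet_derivative[OF assms] S])
  qed (simp add: p)
  moreover have "lip_on S h"
    using lip_on_smooth_family[OF eps assms S] by simp
  ultimately show ?thesis using s by (simp add: lip_C1_on_def)
qed

lemma lip_C1_stationary:
  assumes "smooth_on U f"
  shows "lip_C1_on \<epsilon> U S (\<lambda>_. f)"
proof -
  have b: "lip_on S (\<lambda>_. f)" if s: "smooth_on U f" for f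
  proof -
    have "bounded (f ` S)"
      by (intro compact_imp_bounded compact_continuous_image S(1)
          continuous_on_subset[OF smooth_on_continuous_on[OF s] S(2)])
    then obtain B where "\<And>x. x \<in> S \<Longrightarrow> \<bar>f x\<bar> \<le> B"
      by (auto simp: bounded_iff)
    then show ?thesis by (rule lip_on_stationary)
  qed
  show ?thesis
    unfolding lip_C1_on_def using assms b smooth_on_pderiv[OF assms] by blast
qed

lemma lip_C1_const_in_space:
  assumes "lip_on {()} (\<lambda>t _. c t)"
  shows "lip_C1_on \<epsilon> U S (\<lambda>t _. c t)"
proof -
  have "pderiv (\<lambda>_ :: 'n point. c t) i = (\<lambda>_. 0)" for t i by (rule ext) simp
  then show ?thesis
    using lip_on_transfer[OF assms] by (simp add: lip_C1_on_def lip_on_const)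
qed

lemma lip_C1_add:
  assumes a: "lip_C1_on \<epsilon> U S a" and b: "lip_C1_on \<epsilon> U S b"
  shows "lip_C1_on \<epsilon> U S (\<lambda>t x. a t x + b t x)"
proof -
  have "lip_on S (\<lambda>t. pderiv (\<lambda>x. a t x + b t x) i)" for i
  proof (rule lip_on_cong[OF _ eps])
    show "lip_on S (\<lambda>t x. pderiv (a t) i x + pderiv (b t) i x)"
      using a b by (intro lip_on_add) (auto simp: lip_C1_on_def)
    show "pderiv (a t) i x + pderiv (b t) i x = pderiv (\<lambda>x. a t x + b t x) i x" if "\<bar>t\<bar> < \<epsilon>" "x \<in> S" for t x
      using a b that S(2) smooth_on_differentiable[of U _ x]
      by (subst pderiv_add) (auto simp: lip_C1_on_def)
  qed
  then show ?thesis
    using a b U by (auto simp: lip_C1_on_def intro: smooth_on_add lip_on_add)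
qed

lemma lip_C1_mult:
  assumes a: "lip_C1_on \<epsilon> U S a" and b: "lip_C1_on \<epsilon> U S b"
  shows "lip_C1_on \<epsilon> U S (\<lambda>t x. a t x * b t x)"
proof -
  have "lip_on S (\<lambda>t. pderiv (\<lambda>x. a t x * b t x) i)" for i
  proof (rule lip_on_cong[OF _ eps])
    show "lip_on S (\<lambda>t x. a t x * pderiv (b t) i x + pderiv (a t) i x * b t x)"
      using a b by (intro lip_on_add lip_on_mult) (auto simp: lip_C1_on_def)
    show "a t x * pderiv (b t) i x + pderiv (a t) i x * b t x = pderiv (\<lambda>x. a t x * b t x) i x"
      if "\<bar>t\<bar> < \<epsilon>" "x \<in> S" for t x
      using a b that S(2) smooth_on_differentiable[of U _ x]
      by (subst pderiv_mult) (auto simp: lip_C1_on_def)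
  qed
  then show ?thesis
    using a b U by (auto simp: lip_C1_on_def intro: smooth_on_mult lip_on_mult)
qed

lemma lip_C1_sum:
  "(\<And>i. i \<in> I \<Longrightarrow> lip_C1_on \<epsilon> U S (a i)) \<Longrightarrow> lip_C1_on \<epsilon> U S (\<lambda>t x. \<Sum>i\<in>I. a i t x)"
  by (induction I rule: infinite_finite_induct)
    (simp_all add: lip_C1_add lip_C1_stationary)

end

text \<open>The power function is differentiable at 1 with derivative p, hence \<open>\<bar>u powr p
  - 1\<bar> \<le> (\<bar>p\<bar> + 1) * \<bar>u - 1\<bar>\<close> for u near 1, where w stays for
  small t.\<close>

lemma lip_on_powr:
  assumes "lip_on {()} (\<lambda>t _. w t)" "w 0 = 1"
  shows "lip_on {()} (\<lambda>t _. w t powr p)"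
proof -
  obtain \<delta> K where K: "\<delta> > 0" "K \<ge> 0" "\<And>t x. \<bar>t\<bar> < \<delta> \<Longrightarrow> x \<in> {()} \<Longrightarrow> \<bar>w t - w 0\<bar> \<le> K * \<bar>t\<bar>"
    by (rule lip_on_diffE[OF assms(1)]) blast
  have "((\<lambda>u. u powr p) has_real_derivative p * 1 powr (p - 1)) (at 1)"
    by (rule has_real_derivative_powr) simp
  then have "((\<lambda>u. (u powr p - 1) / (u - 1)) \<longlongrightarrow> p) (at 1)"
    by (simp add: has_field_derivative_iff)
  then have "eventually (\<lambda>u. dist ((u powr p - 1) / (u - 1)) p < 1) (at 1)"
    by (rule tendstoD) simp
  then obtain d where d: "d > 0" "\<And>u. u \<noteq> 1 \<Longrightarrow> \<bar>u - 1\<bar> < d \<Longrightarrow> \<bar>(u powr p - 1) / (u - 1) - p\<bar> < 1"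
    by (auto simp: eventually_at dist_real_def)
  have lin: "\<bar>u powr p - 1\<bar> \<le> (\<bar>p\<bar> + 1) * \<bar>u - 1\<bar>" if "\<bar>u - 1\<bar> < d" for u
  proof (cases "u = 1")
    case False
    then have "\<bar>(u powr p - 1) / (u - 1)\<bar> \<le> \<bar>p\<bar> + 1"
      using d(2)[OF False that] by linarith
    then show ?thesis using False by (simp add: pos_divide_le_eq)
  qed simp
  obtain \<delta>' where \<delta>': "\<delta>' > 0" "\<And>t x. \<bar>t\<bar> < \<delta>' \<Longrightarrow> x \<in> {()} \<Longrightarrow> \<bar>w t - w 0\<bar> \<le> min 1 (d / 2)"
    by (rule lip_on_close[OF assms(1), of "min 1 (d / 2)"]) (use d(1) in auto)
  have l: "\<bar>w t powr p - 1\<bar> \<le> (\<bar>p\<bar> + 1) * \<bar>w t - 1\<bar>" "\<bar>w t - 1\<bar> \<le> 1" if "\<bar>t\<bar> < \<delta>'" for t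
    using \<delta>'(2)[OF that] d(1) assms(2) by (auto intro!: lin)
  show ?thesis
  proof (rule lip_onI[of "min \<delta> \<delta>'" _ _ "\<bar>p\<bar> + 2" "(\<bar>p\<bar> + 1) * K"])
    fix t and x :: unit assume t: "\<bar>t\<bar> < min \<delta> \<delta>'"
    have "(\<bar>p\<bar> + 1) * \<bar>w t - 1\<bar> \<le> (\<bar>p\<bar> + 1) * 1"
      using l(2)[of t] t by (intro mult_left_mono) auto
    then show "\<bar>w t powr p\<bar> \<le> \<bar>p\<bar> + 2"
      using l(1)[of t] t by auto
    have "(\<bar>p\<bar> + 1) * \<bar>w t - 1\<bar> \<le> (\<bar>p\<bar> + 1) * (K * \<bar>t\<bar>)"
      using K(3)[of t "()"] t assms(2) by (intro mult_left_mono) auto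
    then show "\<bar>w t powr p - w 0 powr p\<bar> \<le> (\<bar>p\<bar> + 1) * K * \<bar>t\<bar>"
      using l(1)[of t] t assms(2) by (simp add: mult.assoc)
  qed (use K(1) \<delta>'(1) in auto)
qed

lemma nondegenerate_det:
  fixes g :: "'n::finite tensor2"
  assumes "bilinear (g x)" "\<And>v w. g x v w = g x w v" "nondegenerate_on UNIV (g x)"
  shows "det (gram g x) \<noteq> 0"
proof -
  have "v = 0" if v: "gram g x *v v = 0" for v
  proof (rule ccontr)
    assume "v \<noteq> 0"
    then obtain w where w: "g x v w \<noteq> 0" using assms(3) by (auto simp: nondegenerate_on_def)
    have "g x w v = (\<Sum>i\<in>UNIV. w $ i * (gram g x *v v) $ i)"
      unfolding bilinear_eq_sum[OF assms(1), of w v]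
      by (simp add: matrix_vector_mult_def gram_def sum_distrib_left mult_ac)
    then show False using w assms(2)[of v w] by (simp add: v)
  qed
  then have "\<exists>B. B ** gram g x = mat 1"
    by (subst matrix_left_invertible_ker) blast
  then show ?thesis
    by (metis det_I det_mul mult_zero_right zero_neq_one)
qed

section \<open>Criticality with respect to volume-preserving variations\<close>

text \<open>\<nu> is the normal vector with x_0-component 1, and \<kappa> is its square length. The
  projection to the leaves runs along \<nu>; nondegeneracy on the leaves makes the decomposition
  unique.\<close>

lemma leaf_part_eq:
  fixes h :: "'n::finite tensor2"
  assumes bl: "bilinear (h x)" and nd: "nondegenerate_on leaf_tangent (h x)"
    and \<nu>: "\<And>u. h x \<nu> u = \<kappa> * u $ None" "\<nu> $ None = 1"
  shows "leaf_part h x v = v - (v $ None) *\<^sub>R \<nu>" "normal_part h x v = (v $ None) *\<^sub>R \<nu>"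
proof -
  show 1: "leaf_part h x v = v - (v $ None) *\<^sub>R \<nu>"
    unfolding leaf_part_def
  proof (rule the_equality)
    show "v - (v $ None) *\<^sub>R \<nu> \<in> leaf_tangent \<and> v - (v - (v $ None) *\<^sub>R \<nu>) \<in> normal_space h x"
      by (simp add: leaf_tangent_def normal_space_def \<nu> bilinear_lmul[OF bl])
    fix a assume a: "a \<in> leaf_tangent \<and> v - a \<in> normal_space h x"
    define u where "u = v - a - (v $ None) *\<^sub>R \<nu>"
    have "u \<in> leaf_tangent" using a by (simp add: u_def leaf_tangent_def \<nu>)
    moreover have "h x u w = 0" if "w \<in> leaf_tangent" for w
      using that a by (simp add: u_def bilinear_lsub[OF bl] bilinear_lmul[OF bl] \<nu> normal_space_def leaf_tangent_def)
    ultimately have "u = 0" using nd unfolding nondegenerate_on_def by blast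
    then show "a = v - (v $ None) *\<^sub>R \<nu>" by (simp add: u_def algebra_simps)
  qed
  show "normal_part h x v = (v $ None) *\<^sub>R \<nu>"
    by (simp add: normal_part_def 1)
qed

lemma axis_in_leaf_tangent: "axis (Some i) 1 \<in> leaf_tangent"
  by (simp add: leaf_tangent_def axis_def)

lemma bilinear_axis_expand:
  fixes b :: "real ^ 'm \<Rightarrow> real ^ 'm \<Rightarrow> real"
  assumes "bilinear b"
  shows "b v u = (\<Sum>\<mu>\<in>UNIV. u $ \<mu> * b v (axis \<mu> 1))"
proof -
  have l: "linear (b v)" using assms by (auto simp: bilinear_def)
  show ?thesis
    by (subst vec_eq_sum_axis[of u]) (simp add: linear_sum[OF l] linear_scale[OF l])
qed

text \<open>Rescaling the normal direction of a metric alters its Gram matrix in one corner only. By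
  the hypotheses the inverse of A maps \<kappa> times the k-th unit vector to \<nu>, so \<kappa>
  times the (k, k)-entry of the inverse is 1; the determinant is linear in row k.\<close>

lemma det_add_corner:
  fixes A :: "real ^ 'm ^ 'm"
  assumes nz: "det A \<noteq> 0" and \<nu>: "A *v \<nu> = \<kappa> *\<^sub>R axis k 1" "\<nu> $ k = 1"
  shows "det (\<chi> i j. A $ i $ j + (if i = k \<and> j = k then c * \<kappa> else 0)) = (1 + c) * det A"
proof -
  have "\<kappa> * matrix_inv A $ k $ k = 1"
  proof -
    have "matrix_inv A *v (A *v \<nu>) = \<nu>"
      by (simp add: matrix_vector_mul_assoc matrix_inv_inverse[OF nz])
    then have "(matrix_inv A *v (\<kappa> *\<^sub>R axis k 1)) $ k = 1" using \<nu> by simp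
    moreover have "(matrix_inv A *v (\<kappa> *\<^sub>R axis k 1)) $ k = (\<Sum>j\<in>UNIV. (axis k 1 :: real ^ 'm) $ j * (\<kappa> * matrix_inv A $ k $ j))"
      by (simp add: matrix_vector_mult_def mult_ac)
    ultimately show ?thesis by (simp only: sum_axis_mult)
  qed
  then have cc: "c * \<kappa> * matrix_inv A $ k $ k = c" by simp
  have "(\<chi> i j. A $ i $ j + (if i = k \<and> j = k then c * \<kappa> else 0))
      = (\<chi> i. if i = k then A $ k + (c * \<kappa>) *\<^sub>R axis k 1 else A $ i)"
    by (auto simp: vec_eq_iff axis_def)
  then have "det (\<chi> i j. A $ i $ j + (if i = k \<and> j = k then c * \<kappa> else 0))
      = det A * (\<Sum>j\<in>UNIV. (A $ k + (c * \<kappa>) *\<^sub>R axis k 1) $ j * matrix_inv A $ j $ k)"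
    by (simp add: det_replace_row[OF nz])
  also have "(\<Sum>j\<in>UNIV. (A $ k + (c * \<kappa>) *\<^sub>R axis k 1) $ j * matrix_inv A $ j $ k)
      = (\<Sum>j\<in>UNIV. A $ k $ j * matrix_inv A $ j $ k)
        + (\<Sum>j\<in>UNIV. (axis k 1 :: real ^ 'm) $ j * (c * \<kappa> * matrix_inv A $ j $ k))"
    by (simp add: sum.distrib[symmetric] algebra_simps)
  also have "\<dots> = 1 + c"
    by (simp only: sum_axis_mult cc matrix_inv_sum(1)[OF nz]) simp
  finally show ?thesis by simp
qed

lemma det_diagonal_congruence:
  fixes A :: "real ^ 'm ^ 'm"
  shows "det (\<chi> i j. r i * r j * A $ i $ j) = (\<Prod>i\<in>UNIV. r i)\<^sup>2 * det A"
proof -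
  let ?D = "(\<chi> i j. if i = j then r i else 0) :: real ^ 'm ^ 'm"
  have "(\<chi> i j. r i * r j * A $ i $ j) = ?D ** A ** ?D"
    by (simp add: matrix_matrix_mult_def vec_eq_iff if_distrib[of "\<lambda>t. t * _"] if_distrib[of "(*) _"] cong: if_cong)
  moreover have "det ?D = (\<Prod>i\<in>UNIV. r i)"
    by (subst det_diagonal) simp_all
  ultimately show ?thesis by (simp add: det_mul power2_eq_square)
qed

lemma open_rel_compactD:
  assumes "open_rel_compact U \<Omega>"
  shows "open \<Omega>" "\<Omega> \<noteq> {}" "compact (closure \<Omega>)" "closure \<Omega> \<subseteq> U" "\<Omega> \<subseteq> U" "\<Omega> \<subseteq> closure \<Omega>" "bounded \<Omega>"
  using assms closure_subset[of \<Omega>] compact_imp_bounded[of "closure \<Omega>"] bounded_subset[of "closure \<Omega>" \<Omega>]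
  by (auto simp: open_rel_compact_def)

text \<open>The density of the model is bounded below on the compact closure, and a nonempty open
  set has positive measure.\<close>

lemma Vol_model_pos:
  fixes \<Omega> :: "'n::finite point set"
  assumes "y \<noteq> 0" "open_rel_compact U \<Omega>"
  shows "Vol \<Omega> (model y 1 1) > 0"
proof -
  interpret m: model_params y 1 1 "TYPE('n)" using assms(1) by unfold_locales auto
  note \<Omega> = open_rel_compactD[OF assms(2)]
  have cont: "continuous_on UNIV (vol_density (model y 1 1 :: 'n tensor2))"
    by (rule smooth_on_continuous_on[OF m.vol_density_smooth])
  have pos: "vol_density (model y 1 1) x > 0" for x :: "'n point"
    using m.det_nz[of x] by (simp add: vol_density_def)
  obtain c where c: "c > 0" "\<And>x. x \<in> closure \<Omega> \<Longrightarrow> c \<le> vol_density (model y 1 1) x"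
    using continuous_positive_lower_bound[OF \<Omega>(3) continuous_on_subset[OF cont]] pos by blast
  obtain B where B: "\<And>x. x \<in> closure \<Omega> \<Longrightarrow> \<bar>vol_density (model y 1 1) x\<bar> \<le> B"
    using compact_imp_bounded[OF compact_continuous_image[OF continuous_on_subset[OF cont] \<Omega>(3)]]
    unfolding bounded_iff by auto
  have em: "emeasure lborel \<Omega> < \<infinity>" using \<Omega>(7) by (rule emeasure_bounded_finite)
  have ic: "set_integrable lborel \<Omega> (\<lambda>_. c)"
    by (rule set_integrable_bounded_continuous(1)[OF \<Omega>(1,7), of _ "\<bar>c\<bar>"]) auto
  have iv: "set_integrable lborel \<Omega> (vol_density (model y 1 1))"
    using B \<Omega>(6) by (intro set_integrable_bounded_continuous(1)[OF \<Omega>(1,7) continuous_on_subset[OF cont], of B]) auto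
  obtain x r where "x \<in> \<Omega>" "r > 0" "ball x r \<subseteq> \<Omega>"
    using \<Omega>(1,2) open_contains_ball by blast
  then have "measure lborel (ball x r) \<le> measure lborel \<Omega>" "0 < measure lborel (ball x r)"
    using em \<Omega>(1) by (auto intro!: measure_mono_fmeasurable content_ball_pos simp: fmeasurable_def)
  then have "0 < measure lborel \<Omega>" by linarith
  then have "0 < measure lborel \<Omega> * c" using c(1) by simp
  also have "\<dots> = (LINT x:\<Omega>|lborel. c)"
    using \<Omega>(1) em by (subst set_integral_const) auto
  also have "\<dots> \<le> (LINT x:\<Omega>|lborel. vol_density (model y 1 1) x)"
    using c(2) \<Omega>(6) by (intro set_integral_mono ic iv) auto
  finally show ?thesis by (simp add: Vol_def integral_vol_eq)
qed

section \<open>Variations of the model metric supported in \<Omega>\<close>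

locale model_variation =
  fixes y \<epsilon> :: real and U \<Omega> :: "'n::finite point set" and gt :: "real \<Rightarrow> 'n tensor2"
  assumes y_nz: "y \<noteq> 0" and U: "open U" and rc: "open_rel_compact U \<Omega>"
    and var: "variation U (model y 1 1) \<epsilon> gt" and supp: "supported_in U (model y 1 1) \<epsilon> gt \<Omega>"
begin

sublocale m: model_params y 1 1 "TYPE('n)"
  using y_nz by unfold_locales auto

lemmas \<Omega> = open_rel_compactD[OF rc]

lemma eps: "\<epsilon> > 0"
  using var by (simp add: variation_def)

sublocale d: variation_domain \<epsilon> U "closure \<Omega>"
  by unfold_locales (rule eps U \<Omega>)+

lemma metric:
  assumes "\<bar>t\<bar> < \<epsilon>" "x \<in> U"
  shows "bilinear (gt t x)" "gt t x v w = gt t x w v" "nondegenerate_on leaf_tangent (gt t x)"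
    "det (gram (gt t) x) \<noteq> 0"
proof -
  have "adapted_metric U (gt t)" using var assms by (simp add: variation_def)
  then show 1: "bilinear (gt t x)" "gt t x v w = gt t x w v" "nondegenerate_on leaf_tangent (gt t x)" for v w
    using assms(2) unfolding adapted_metric_def pseudo_metric_def by blast+
  show "det (gram (gt t) x) \<noteq> 0"
    using \<open>adapted_metric U (gt t)\<close> assms(2) unfolding adapted_metric_def pseudo_metric_def
    by (intro nondegenerate_det) blast+
qed

lemma base: "x \<in> U \<Longrightarrow> gt 0 x = model y 1 1 x"
  using var by (simp add: variation_def)

lemma entry_lip_C1: "lip_C1_on \<epsilon> U (closure \<Omega>) (\<lambda>t x. gt t x v w)"
  using var by (intro d.lip_C1_smooth_family) (simp add: variation_def)

definition supp_set :: "real \<Rightarrow> 'n point set" where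
  "supp_set t = closure {x \<in> U. gt t x \<noteq> model y 1 1 x}"

text \<open>\<open>supported_in\<close> controls the closure within U only. Since the points where
  the metrics differ lie in \<Omega>, their closure lies in the compact closure of \<Omega>, which
  is part of U, so no limit point escapes.\<close>

lemma supp_set:
  assumes "\<bar>t\<bar> < \<epsilon>"
  shows "compact (supp_set t)" "supp_set t \<subseteq> \<Omega>" "x \<in> \<Omega> - supp_set t \<Longrightarrow> gt t x = model y 1 1 x"
proof -
  let ?A = "{x \<in> U. gt t x \<noteq> model y 1 1 x}"
  have s: "U \<inter> closure ?A \<subseteq> \<Omega>" using supp assms by (simp add: supported_in_def)
  then have "?A \<subseteq> \<Omega>" using closure_subset[of ?A] by blast
  then have c: "closure ?A \<subseteq> closure \<Omega>" by (rule closure_mono)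
  then show "supp_set t \<subseteq> \<Omega>" using s \<Omega>(4) unfolding supp_set_def by blast
  show "compact (supp_set t)"
    unfolding supp_set_def using \<Omega>(3) c compact_Int_closed[of "closure \<Omega>" "closure ?A"] by (simp add: inf.absorb2)
  show "gt t x = model y 1 1 x" if "x \<in> \<Omega> - supp_set t"
    using that closure_subset[of ?A] \<Omega>(5) unfolding supp_set_def by blast
qed

lemma gt_component_smooth: "\<bar>t\<bar> < \<epsilon> \<Longrightarrow> smooth_on U (\<lambda>x. gt t x v w)"
  using entry_lip_C1 by (simp add: lip_C1_on_def)

lemma vol_density_continuous:
  assumes "\<bar>t\<bar> < \<epsilon>"
  shows "continuous_on U (vol_density (gt t))"
  unfolding vol_density_def[abs_def]
  by (intro smooth_on_continuous_on smooth_on_sqrt_abs smooth_on_det U metric(4)[OF assms])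
    (simp add: gram_def gt_component_smooth[OF assms])

lemma vol_density_lip: "lip_on (closure \<Omega>) (\<lambda>t. vol_density (gt t))"
proof -
  have "\<exists>c>0. \<forall>x\<in>closure \<Omega>. c \<le> \<bar>det (gram (model y 1 1) x)\<bar>"
  proof (rule continuous_positive_lower_bound[OF \<Omega>(3)])
    show "continuous_on (closure \<Omega>) (\<lambda>x. \<bar>det (gram (model y 1 1) x)\<bar>)"
      by (intro continuous_intros continuous_on_subset[OF smooth_on_continuous_on[OF m.det_smooth]]) simp
    show "\<bar>det (gram (model y 1 1) x)\<bar> > 0" for x :: "'n point"
      using m.det_nz[of x] by simp
  qed blast
  then obtain c where c: "c > 0" "\<And>x. x \<in> closure \<Omega> \<Longrightarrow> c \<le> \<bar>det (gram (model y 1 1) x)\<bar>"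
    by blast
  have "c \<le> \<bar>det (gram (gt 0) x)\<bar>" if "x \<in> closure \<Omega>" for x
    using c(2)[OF that] gram_cong[of "gt 0" x "model y 1 1"] base \<Omega>(4) that by auto
  moreover have "lip_on (closure \<Omega>) (\<lambda>t x. gram (gt t) x $ i $ j)" for i j
    using entry_lip_C1 by (simp add: gram_def lip_C1_on_def)
  ultimately show ?thesis
    unfolding vol_density_def[abs_def] using c(1) by (intro lip_on_sqrt_abs[of _ _ c] lip_on_det) auto
qed

definition ratio :: "real \<Rightarrow> real" where
  "ratio t = Vol \<Omega> (gt t) / Vol \<Omega> (model y 1 1)"

lemma Vol_base: "Vol \<Omega> (gt 0) = Vol \<Omega> (model y 1 1)"
  unfolding Vol_def integral_vol_eq vol_density_def
  using \<Omega>(1,5) base by (intro set_lebesgue_integral_cong) (auto simp: gram_def)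

lemmas Vol_model_pos = Vol_model_pos[OF y_nz rc]

lemma ratio_0: "ratio 0 = 1"
  using Vol_model_pos by (simp add: ratio_def Vol_base)

text \<open>The uniform Lipschitz bound of the volume density is integrated over \<Omega>, which has
  finite measure.\<close>

lemma ratio_lip: "lip_on {()} (\<lambda>t _. ratio t)"
proof -
  obtain \<delta> A where l: "\<delta> > 0" "A \<ge> 0"
    "\<And>t x. \<bar>t\<bar> < \<delta> \<Longrightarrow> x \<in> closure \<Omega> \<Longrightarrow> \<bar>vol_density (gt t) x\<bar> \<le> A"
    "\<And>t x. \<bar>t\<bar> < \<delta> \<Longrightarrow> x \<in> closure \<Omega> \<Longrightarrow> \<bar>vol_density (gt t) x - vol_density (gt 0) x\<bar> \<le> A * \<bar>t\<bar>"
    by (rule lip_onE[OF vol_density_lip]) blast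
  have Veq: "Vol \<Omega> (gt t) = (LINT x:\<Omega>|lborel. vol_density (gt t) x)" for t
    by (simp add: Vol_def integral_vol_eq)
  have c: "continuous_on \<Omega> (vol_density (gt t))" if "\<bar>t\<bar> < \<epsilon>" for t
    using vol_density_continuous[OF that] \<Omega>(5) by (rule continuous_on_subset)
  have i: "set_integrable lborel \<Omega> (vol_density (gt t))" "\<bar>Vol \<Omega> (gt t)\<bar> \<le> A * measure lborel \<Omega>"
    if "\<bar>t\<bar> < min \<delta> \<epsilon>" for t
    using set_integrable_bounded_continuous[OF \<Omega>(1,7) c, of t A] l(3)[of t] \<Omega>(6) that
    unfolding Veq by auto
  have dif: "\<bar>Vol \<Omega> (gt t) - Vol \<Omega> (gt 0)\<bar> \<le> A * \<bar>t\<bar> * measure lborel \<Omega>" if t: "\<bar>t\<bar> < min \<delta> \<epsilon>" for t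
  proof -
    have "Vol \<Omega> (gt t) - Vol \<Omega> (gt 0) = (LINT x:\<Omega>|lborel. vol_density (gt t) x - vol_density (gt 0) x)"
      unfolding Veq using i(1)[OF t] i(1)[of 0] l(1) eps by (subst set_integral_diff) auto
    moreover have "\<bar>LINT x:\<Omega>|lborel. vol_density (gt t) x - vol_density (gt 0) x\<bar> \<le> A * \<bar>t\<bar> * measure lborel \<Omega>"
      using l(4)[of t] \<Omega>(6) t eps
      by (intro set_integrable_bounded_continuous(2)[OF \<Omega>(1,7)] continuous_intros c) auto
    ultimately show ?thesis by simp
  qed
  have "lip_on {()} (\<lambda>t _. Vol \<Omega> (gt t))"
    by (rule lip_onI[of "min \<delta> \<epsilon>" _ _ "A * measure lborel \<Omega>" "A * measure lborel \<Omega>"])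
      (use i(2) dif l(1) eps in \<open>auto simp: mult_ac\<close>)
  from lip_on_mult[OF lip_on_const[of _ "inverse (Vol \<Omega> (model y 1 1))"] this] show ?thesis
    by (simp add: ratio_def divide_inverse mult.commute)
qed

lemma ratio_pos:
  obtains \<epsilon>' where "0 < \<epsilon>'" "\<epsilon>' \<le> \<epsilon>" "\<And>t. \<bar>t\<bar> < \<epsilon>' \<Longrightarrow> ratio t > 0"
proof -
  obtain \<delta> where \<delta>: "\<delta> > 0" "\<And>t x. \<bar>t\<bar> < \<delta> \<Longrightarrow> x \<in> {()} \<Longrightarrow> \<bar>ratio t - ratio 0\<bar> \<le> 1 / 2"
    by (rule lip_on_close[OF ratio_lip, of "1 / 2"]) auto
  show ?thesis
  proof (rule that[of "min \<delta> \<epsilon>"])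
    show "ratio t > 0" if "\<bar>t\<bar> < min \<delta> \<epsilon>" for t
    proof -
      have "\<bar>ratio t - ratio 0\<bar> \<le> 1 / 2" using \<delta>(2)[of t "()"] that by simp
      then show ?thesis unfolding ratio_0 by linarith
    qed
  qed (use \<delta>(1) eps in auto)
qed

text \<open>Transfers bounds from an explicit formula on U to the modified variation, which agrees
  with it on \<Omega>; openness of \<Omega> covers the partial derivatives.\<close>

lemma lip_C1_restrict:
  assumes a: "lip_C1_on \<epsilon> U (closure \<Omega>) a" and e: "0 < \<epsilon>'" "\<epsilon>' \<le> \<epsilon>"
    and eq: "\<And>t z. \<bar>t\<bar> < \<epsilon>' \<Longrightarrow> z \<in> \<Omega> \<Longrightarrow> b t z = a t z"
  shows "lip_on \<Omega> b" "lip_on \<Omega> (\<lambda>t. pderiv (b t) i)"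
proof -
  have l: "lip_on \<Omega> a" "lip_on \<Omega> (\<lambda>t. pderiv (a t) i)"
    using a lip_on_subset \<Omega>(6) unfolding lip_C1_on_def by blast+
  show "lip_on \<Omega> b" by (rule lip_on_cong[OF l(1) e(1)]) (simp add: eq)
  show "lip_on \<Omega> (\<lambda>t. pderiv (b t) i)"
    by (rule lip_on_cong[OF l(2) e(1)], rule pderiv_cong_open[OF \<Omega>(1)]) (simp_all add: eq)
qed

lemma model_axis: "model y 1 1 x (axis i 1) (axis j 1) = (if i = j then (theta y i x)\<^sup>2 else 0)"
  for x :: "'n point"
proof -
  have "rescale 1 1 \<mu> = 1" for \<mu> :: "'n option" by (simp add: rescale_def split: option.split)
  then show ?thesis using m.gram_model_component[of x i j] by (simp add: gram_def)
qed

text \<open>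
  Reduces both kinds of modified variations to \<open>model_family\<close>: outside the support of the variation
  they agree with a rescaled model metric, and their volume density is the one of the variation,
  divided by the volume ratio.
\<close>

lemma rescaled_variation_stationary:
  assumes \<epsilon>': "0 < \<epsilon>'" "\<epsilon>' \<le> \<epsilon>"
    and bl: "\<And>t x. \<bar>t\<bar> < \<epsilon>' \<Longrightarrow> x \<in> \<Omega> \<Longrightarrow> bilinear (gb t x)"
    and sym: "\<And>t x v w. \<bar>t\<bar> < \<epsilon>' \<Longrightarrow> x \<in> \<Omega> \<Longrightarrow> gb t x v w = gb t x w v"
    and entry: "\<And>i j. lip_C1_on \<epsilon> U (closure \<Omega>) (a i j)"
      "\<And>t x i j. \<bar>t\<bar> < \<epsilon>' \<Longrightarrow> x \<in> \<Omega> \<Longrightarrow> gram (gb t) x $ i $ j = a i j t x"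
    and dens: "\<And>t x. \<bar>t\<bar> < \<epsilon>' \<Longrightarrow> x \<in> \<Omega> \<Longrightarrow> vol_density (gb t) x = s t * vol_density (gt t) x"
      "\<And>t. \<bar>t\<bar> < \<epsilon>' \<Longrightarrow> s t * ratio t = 1"
    and rescale: "lip_on {()} (\<lambda>t _. al t)" "lip_on {()} (\<lambda>t _. be t)" "al 0 = 1" "be 0 = 1"
      "\<And>t. \<bar>t\<bar> < \<epsilon>' \<Longrightarrow> al t > 0" "\<And>t. \<bar>t\<bar> < \<epsilon>' \<Longrightarrow> be t > 0"
    and off: "\<And>t x. \<bar>t\<bar> < \<epsilon>' \<Longrightarrow> x \<in> \<Omega> - supp_set t \<Longrightarrow> gb t x = model y (al t) (be t) x"
  shows "((\<lambda>t. J \<Omega> (gb t)) has_real_derivative 0) (at 0)"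
proof (rule model_family.J_stationary)
  have Volb: "Vol \<Omega> (gb t) = Vol \<Omega> (model y 1 1)" if t: "\<bar>t\<bar> < \<epsilon>'" for t
  proof -
    have "Vol \<Omega> (gb t) = (LINT x:\<Omega>|lborel. s t * vol_density (gt t) x)"
      unfolding Vol_def integral_vol_eq using \<Omega>(1) dens(1)[OF t] by (intro set_lebesgue_integral_cong) auto
    also have "\<dots> = s t * Vol \<Omega> (gt t)" by (simp add: Vol_def integral_vol_eq)
    also have "\<dots> = (s t * ratio t) * Vol \<Omega> (model y 1 1)" using Vol_model_pos by (simp add: ratio_def)
    finally show ?thesis by (simp add: dens(2)[OF t])
  qed
  show "model_family y \<epsilon>' \<Omega> gb al be supp_set"
  proof
    show "lip_on \<Omega> (\<lambda>t x. gram (gb t) x $ i $ j)" "lip_on \<Omega> (\<lambda>t. pderiv (\<lambda>z. gram (gb t) z $ i $ j) m)" for i j m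
      using lip_C1_restrict[OF entry(1) \<epsilon>' entry(2)] by blast+
    show "gb 0 x = model y 1 1 x" if "x \<in> \<Omega>" for x
    proof -
      have "supp_set 0 = {}" by (simp add: supp_set_def base)
      then show ?thesis using off[of 0 x] that \<epsilon>'(1) rescale(3,4) by simp
    qed
    fix t :: real assume t: "\<bar>t\<bar> < \<epsilon>'"
    then have t': "\<bar>t\<bar> < \<epsilon>" using \<epsilon>' by simp
    show "compact (supp_set t)" "supp_set t \<subseteq> \<Omega>" "Vol \<Omega> (gb t) = Vol \<Omega> (gb 0)"
      using supp_set[OF t'] Volb[OF t] Volb[of 0] \<epsilon>'(1) by auto
    show "smooth_on \<Omega> (\<lambda>x. gb t x v w)" for v w
    proof -
      have "smooth_on \<Omega> (a i j t)" for i j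
        using entry(1)[of i j] t' \<Omega>(5) smooth_on_mono unfolding lip_C1_on_def by blast
      then have "smooth_on \<Omega> (\<lambda>x. \<Sum>i\<in>UNIV. \<Sum>j\<in>UNIV. v $ i * w $ j * a i j t x)"
        by (intro smooth_on_sum smooth_on_mult smooth_on_const \<Omega>(1))
      moreover have "gb t x v w = (\<Sum>i\<in>UNIV. \<Sum>j\<in>UNIV. v $ i * w $ j * a i j t x)" if "x \<in> \<Omega>" for x
        using bilinear_eq_sum[OF bl[OF t that], of v w] by (simp add: entry(2)[OF t that, symmetric] gram_def)
      ultimately show ?thesis
        using smooth_on_cong[OF \<Omega>(1), of "\<lambda>x. gb t x v w"] by simp
    qed
  qed (use y_nz \<epsilon>' \<Omega> bl sym rescale off in auto)
qed

text \<open>The leaf metrics remain those of the model, so the normal \<nu> with x_0-component 1 is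
  explicit, and the modified metric adds \<open>al\<^sup>2 - 1\<close> times \<kappa> to the (x_0,
  x_0)-entry of \<open>gt t\<close>. Off the support this is the model rescaled by \<alpha> = al and
  \<beta> = 1.\<close>

lemma bar_perp_stationary:
  assumes leaf: "\<And>t x v w. \<bar>t\<bar> < \<epsilon> \<Longrightarrow> x \<in> U \<Longrightarrow> v \<in> leaf_tangent \<Longrightarrow> w \<in> leaf_tangent \<Longrightarrow>
    gt t x v w = model y 1 1 x v w"
  shows "((\<lambda>t. J \<Omega> (bar_perp \<Omega> (model y 1 1) (gt t))) has_real_derivative 0) (at 0)"
proof -
  let ?g = "model y 1 1 :: 'n tensor2" and ?e = "\<lambda>\<mu>. axis \<mu> 1 :: 'n point"
  \<comment> \<open>Solves the orthogonality to the leaf directions, on which the Gram matrix is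
    diagonal with the squares of theta as entries.\<close>
  define \<nu> where "\<nu> t x = (\<chi> \<mu>. case \<mu> of None \<Rightarrow> 1 | Some i \<Rightarrow> - gt t x (?e None) (?e (Some i)) / (theta y (Some i) x)\<^sup>2)" for t x
  \<comment> \<open>The square length of \<nu>. The factors - 1 and 1 / theta^2 are kept apart to
    fit the rules \<open>lip_C1_sum\<close> and \<open>lip_C1_mult\<close>.\<close>
  define \<kappa> where "\<kappa> t x = gt t x (?e None) (?e None)
    + (\<Sum>i\<in>UNIV. (- 1) * (gt t x (?e None) (?e (Some i)) * gt t x (?e None) (?e (Some i)) * (1 / (theta y (Some i) x)\<^sup>2)))" for t x
  \<comment> \<open>Lengths of normal vectors scale with the root of the metric factor
    \<open>ratio t powr (- 2)\<close>; the volume density scales likewise, which cancels the volume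
    ratio.\<close>
  define al where "al t = ratio t powr (- 1)" for t
  define gb where "gb t = bar_perp \<Omega> ?g (gt t)" for t
  obtain \<epsilon>' where \<epsilon>': "0 < \<epsilon>'" "\<epsilon>' \<le> \<epsilon>" "\<And>t. \<bar>t\<bar> < \<epsilon>' \<Longrightarrow> ratio t > 0"
    using ratio_pos by blast
  have al: "al t > 0" "al t * ratio t = 1" "ratio t powr (- 2) = al t * al t" if "\<bar>t\<bar> < \<epsilon>'" for t
    using \<epsilon>'(3)[OF that] by (auto simp: al_def powr_minus power2_eq_square)
  have h\<nu>: "gt t x (\<nu> t x) u = \<kappa> t x * u $ None" if tx: "\<bar>t\<bar> < \<epsilon>" "x \<in> U" for t x u
  proof -
    note bl = metric(1)[OF tx] and sy = metric(2)[OF tx]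
    have "gt t x (\<nu> t x) (?e \<mu>) = (if \<mu> = None then \<kappa> t x else 0)" for \<mu>
    proof -
      have "gt t x (\<nu> t x) (?e \<mu>) = (\<Sum>\<rho>\<in>UNIV. \<nu> t x $ \<rho> * gt t x (?e \<mu>) (?e \<rho>))"
        unfolding sy[of "\<nu> t x"] by (rule bilinear_axis_expand[OF bl])
      also have "\<dots> = (if \<mu> = None then \<kappa> t x else 0)"
      proof (cases \<mu>)
        case None
        then show ?thesis
          by (simp add: sum_option \<nu>_def \<kappa>_def sum_negf[symmetric])
      next
        case (Some j)
        have "gt t x (?e (Some j)) (?e (Some i)) = (if i = j then (theta y (Some j) x)\<^sup>2 else 0)" for i
          using leaf[OF tx axis_in_leaf_tangent axis_in_leaf_tangent, of j i] by (simp add: model_axis)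
        then show ?thesis
          using Some by (simp add: sum_option \<nu>_def sy[of "?e (Some j)" "?e None"] if_distrib[of "(*) _"] cong: if_cong)
      qed
      finally show ?thesis .
    qed
    then show ?thesis
      by (subst bilinear_axis_expand[OF bl]) (simp add: sum_option)
  qed
  have \<nu>0: "\<nu> t x $ None = 1" for t x by (simp add: \<nu>_def)
  have gb: "gb t x v w = gt t x v w + (al t * al t - 1) * \<kappa> t x * (v $ None * w $ None)"
    if tx: "\<bar>t\<bar> < \<epsilon>'" "x \<in> U" for t x v w
  proof -
    have t: "\<bar>t\<bar> < \<epsilon>" using tx \<epsilon>' by simp
    note bl = metric(1)[OF t tx(2)] and sy = metric(2)[OF t tx(2)]
    note lp = leaf_part_eq[where h = "gt t" and x = x and \<nu> = "\<nu> t x", OF bl metric(3)[OF t tx(2)] h\<nu>[OF t tx(2)] \<nu>0]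
    have lt: "u - (u $ None) *\<^sub>R \<nu> t x \<in> leaf_tangent" for u
      by (simp add: leaf_tangent_def \<nu>0)
    have "gb t x v w = al t * al t * gt t x ((v $ None) *\<^sub>R \<nu> t x) ((w $ None) *\<^sub>R \<nu> t x)
        + gt t x (v - (v $ None) *\<^sub>R \<nu> t x) (w - (w $ None) *\<^sub>R \<nu> t x)"
      unfolding gb_def bar_perp_def lp leaf[OF t tx(2) lt lt] al(3)[OF tx(1), symmetric] ratio_def ..
    also have "gt t x ((v $ None) *\<^sub>R \<nu> t x) ((w $ None) *\<^sub>R \<nu> t x) = \<kappa> t x * (v $ None * w $ None)"
      by (simp add: bilinear_lmul[OF bl] bilinear_rmul[OF bl] h\<nu>[OF t tx(2)] \<nu>0)
    also have "gt t x (v - (v $ None) *\<^sub>R \<nu> t x) (w - (w $ None) *\<^sub>R \<nu> t x) = gt t x v w - \<kappa> t x * (v $ None * w $ None)"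
      by (simp add: bilinear_lmul[OF bl] bilinear_rmul[OF bl] bilinear_lsub[OF bl] bilinear_rsub[OF bl]
          h\<nu>[OF t tx(2)] \<nu>0 sy[of v "\<nu> t x"])
    finally show ?thesis by (simp add: algebra_simps)
  qed
  have \<kappa>C1: "lip_C1_on \<epsilon> U (closure \<Omega>) \<kappa>"
    unfolding \<kappa>_def[abs_def]
    by (intro d.lip_C1_add d.lip_C1_sum d.lip_C1_mult entry_lip_C1 d.lip_C1_stationary
        smooth_on_divide smooth_on_power smooth_on_const smooth_on_mono[OF m.theta_smooth] U) auto
  have allip: "lip_on {()} (\<lambda>t _. al t)"
    unfolding al_def by (rule lip_on_powr[OF ratio_lip ratio_0])
  have entryC1: "lip_C1_on \<epsilon> U (closure \<Omega>)
      (\<lambda>t x. gt t x v w + (al t * al t - 1) * \<kappa> t x * (v $ None * w $ None))" for v w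
  proof -
    have "lip_on {()} (\<lambda>t _. al t * al t - 1)"
      by (intro lip_on_diff lip_on_mult lip_on_const allip)
    then show ?thesis
      by (intro d.lip_C1_add d.lip_C1_mult entry_lip_C1 \<kappa>C1 d.lip_C1_const_in_space d.lip_C1_stationary smooth_on_const)
  qed
  have detb: "vol_density (gb t) x = al t * vol_density (gt t) x" if tx: "\<bar>t\<bar> < \<epsilon>'" "x \<in> \<Omega>" for t x
  proof -
    have t: "\<bar>t\<bar> < \<epsilon>" and x: "x \<in> U" using tx \<epsilon>' \<Omega>(5) by auto
    have "gram (gb t) x = (\<chi> i j. gram (gt t) x $ i $ j + (if i = None \<and> j = None then (al t * al t - 1) * \<kappa> t x else 0))"
      by (simp add: gram_def gb[OF tx(1) x] vec_eq_iff axis_def)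
    moreover have "gram (gt t) x *v \<nu> t x = \<kappa> t x *\<^sub>R axis None 1"
    proof -
      have "(gram (gt t) x *v \<nu> t x) $ \<mu> = gt t x (?e \<mu>) (\<nu> t x)" for \<mu>
        by (subst bilinear_axis_expand[OF metric(1)[OF t x]])
          (simp add: matrix_vector_mult_def gram_def mult.commute)
      moreover have "?e \<mu> $ None = ?e None $ \<mu>" for \<mu> by (simp add: axis_def)
      ultimately show ?thesis
        by (simp add: vec_eq_iff metric(2)[OF t x, of "?e _"] h\<nu>[OF t x])
    qed
    ultimately have "det (gram (gb t) x) = (1 + (al t * al t - 1)) * det (gram (gt t) x)"
      by (simp add: det_add_corner[OF metric(4)[OF t x] _ \<nu>0])
    then show ?thesis
      using al(1)[OF tx(1)] by (simp add: vol_density_def abs_mult real_sqrt_mult)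
  qed
  have U: "x \<in> U" if "x \<in> \<Omega>" for x using that \<Omega>(5) by auto
  have "((\<lambda>t. J \<Omega> (gb t)) has_real_derivative 0) (at 0)"
  proof (rule rescaled_variation_stationary[OF \<epsilon>'(1,2) _ _ entryC1 _ detb al(2) allip lip_on_const _ _ al(1)])
    fix t x assume t: "\<bar>t\<bar> < \<epsilon>'" and x: "x \<in> \<Omega>"
    then have t': "\<bar>t\<bar> < \<epsilon>" using \<epsilon>' by simp
    note bl = metric(1)[OF t' U[OF x]]
    show "bilinear (gb t x)"
      unfolding bilinear_def gb[OF t U[OF x]]
      by (auto intro!: linearI simp: bilinear_ladd[OF bl] bilinear_radd[OF bl] bilinear_lmul[OF bl]
          bilinear_rmul[OF bl] algebra_simps)
    show "gb t x v w = gb t x w v" for v w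
      by (simp add: gb[OF t U[OF x]] metric(2)[OF t' U[OF x], of v w] mult_ac)
    show "gram (gb t) x $ i $ j = gt t x (?e i) (?e j) + (al t * al t - 1) * \<kappa> t x * (?e i $ None * ?e j $ None)" for i j
      by (simp add: gram_def gb[OF t U[OF x]])
  next
    fix t x assume t: "\<bar>t\<bar> < \<epsilon>'" and xK: "x \<in> \<Omega> - supp_set t"
    then have t': "\<bar>t\<bar> < \<epsilon>" and x: "x \<in> \<Omega>" using \<epsilon>' by auto
    have h: "gt t x = ?g x" by (rule supp_set(3)[OF t' xK])
    then have "\<kappa> t x = (theta y None x)\<^sup>2" by (simp add: \<kappa>_def model_axis)
    then show "gb t x = model y (al t) 1 x"
      by (intro ext) (simp add: gb[OF t U[OF x]] h model_def sum_option rescale_def power2_eq_square algebra_simps)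
  qed (simp_all add: al_def ratio_0)
  then show ?thesis by (simp add: gb_def)
qed

text \<open>The coordinate vector of x_0 remains normal to the leaves, so the projections are those
  of the model, and the modified metric is \<open>gt t\<close> composed with the diagonal map
  \<open>A (be t)\<close>. Off the support this is the model rescaled by \<alpha> = 1 and \<beta> =
  be.\<close>

lemma bar_top_stationary:
  assumes nrm: "\<And>t x v w. \<bar>t\<bar> < \<epsilon> \<Longrightarrow> x \<in> U \<Longrightarrow> v \<in> normal_space (model y 1 1) x \<Longrightarrow>
      w \<in> normal_space (model y 1 1) x \<Longrightarrow> gt t x v w = model y 1 1 x v w"
    and orth: "\<And>t x v w. \<bar>t\<bar> < \<epsilon> \<Longrightarrow> x \<in> U \<Longrightarrow> v \<in> leaf_tangent \<Longrightarrow>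
      w \<in> normal_space (model y 1 1) x \<Longrightarrow> gt t x v w = 0"
  shows "((\<lambda>t. J \<Omega> (bar_top \<Omega> (model y 1 1) (gt t))) has_real_derivative 0) (at 0)"
proof -
  let ?g = "model y 1 1 :: 'n tensor2" and ?e = "\<lambda>\<mu>. axis \<mu> 1 :: 'n point" and ?n = "CARD('n)"
  \<comment> \<open>Each of the n leaf directions contributes one factor be to the volume density,
    and together they have to cancel \<open>ratio t\<close>.\<close>
  define be where "be t = ratio t powr (- 1 / real ?n)" for t
  define A where "A b v = (\<chi> \<mu>. rescale 1 b \<mu> * v $ \<mu>)" for b and v :: "'n point"
  define gb where "gb t = bar_top \<Omega> ?g (gt t)" for t
  obtain \<epsilon>' where \<epsilon>': "0 < \<epsilon>'" "\<epsilon>' \<le> \<epsilon>" "\<And>t. \<bar>t\<bar> < \<epsilon>' \<Longrightarrow> ratio t > 0"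
    using ratio_pos by blast
  have be: "be t > 0" "be t ^ ?n * ratio t = 1" "ratio t powr (- 2 / real ?n) = be t * be t" if "\<bar>t\<bar> < \<epsilon>'" for t
  proof -
    note pos = \<epsilon>'(3)[OF that]
    show "be t > 0" using pos by (simp add: be_def)
    have "be t ^ ?n = ratio t powr (real ?n * (- 1 / real ?n))"
      unfolding be_def using pos by (intro powr_power) simp
    then show "be t ^ ?n * ratio t = 1" using pos by (simp add: powr_minus)
    have "be t * be t = ratio t powr (- 1 / real ?n + - 1 / real ?n)"
      unfolding be_def by (rule powr_add[symmetric])
    then show "ratio t powr (- 2 / real ?n) = be t * be t" by simp
  qed
  have g0: "?g x (?e None) u = (theta y None x)\<^sup>2 * u $ None" for x u
    by (subst bilinear_axis_expand[OF m.bilin]) (simp_all add: model_axis sum_option mult.commute)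
  have lp: "leaf_part ?g x v = v - (v $ None) *\<^sub>R ?e None" "normal_part ?g x v = (v $ None) *\<^sub>R ?e None" for x v
    by (rule leaf_part_eq[where h = ?g and x = x, OF m.bilin m.leaf_nondegenerate g0], simp_all)+
  have e0: "?e None \<in> normal_space ?g x" for x
    by (simp add: normal_space_def g0 leaf_tangent_def)
  have gb: "gb t x v w = gt t x (A (be t) v) (A (be t) w)" if tx: "\<bar>t\<bar> < \<epsilon>'" "x \<in> U" for t x v w
  proof -
    have t: "\<bar>t\<bar> < \<epsilon>" using tx \<epsilon>' by simp
    note bl = metric(1)[OF t tx(2)] and sy = metric(2)[OF t tx(2)]
    let ?L = "\<lambda>u. u - (u $ None) *\<^sub>R ?e None"
    have Aeq: "A b u = (u $ None) *\<^sub>R ?e None + b *\<^sub>R ?L u" for b u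
      by (simp add: A_def vec_eq_iff rescale_def axis_def split: option.split)
    have "?L u \<in> leaf_tangent" for u by (simp add: leaf_tangent_def)
    then have o: "gt t x (?L u) (?e None) = 0" "gt t x (?e None) (?L u) = 0" for u
      using orth[OF t tx(2) _ e0] sy by metis+
    have "gt t x (A (be t) v) (A (be t) w)
        = (v $ None * w $ None) * gt t x (?e None) (?e None) + be t * be t * gt t x (?L v) (?L w)"
      unfolding Aeq bilinear_ladd[OF bl] bilinear_radd[OF bl] bilinear_lmul[OF bl] bilinear_rmul[OF bl] o
      by simp
    moreover have "gb t x v w = (v $ None * w $ None) * ?g x (?e None) (?e None) + be t * be t * gt t x (?L v) (?L w)"
      unfolding gb_def bar_top_def lp be(3)[OF tx(1), symmetric] ratio_def
        bilinear_lmul[OF m.bilin[OF UNIV_I]] bilinear_rmul[OF m.bilin[OF UNIV_I]] by simp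
    ultimately show ?thesis using nrm[OF t tx(2) e0 e0] by simp
  qed
  have Ae: "A b (?e \<mu>) = rescale 1 b \<mu> *\<^sub>R ?e \<mu>" for b \<mu>
    by (simp add: A_def vec_eq_iff axis_def)
  have belip: "lip_on {()} (\<lambda>t _. be t)"
    unfolding be_def by (rule lip_on_powr[OF ratio_lip ratio_0])
  have gram: "gram (gb t) z $ i $ j = rescale 1 (be t) i * rescale 1 (be t) j * gt t z (?e i) (?e j)"
    if "\<bar>t\<bar> < \<epsilon>'" "z \<in> \<Omega>" for t z i j
  proof -
    have t: "\<bar>t\<bar> < \<epsilon>" and z: "z \<in> U" using that \<epsilon>' \<Omega>(5) by auto
    show ?thesis
      by (simp add: gram_def gb[OF that(1) z] Ae bilinear_lmul[OF metric(1)[OF t z]] bilinear_rmul[OF metric(1)[OF t z]])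
  qed
  have entryC1: "lip_C1_on \<epsilon> U (closure \<Omega>)
      (\<lambda>t x. rescale 1 (be t) i * rescale 1 (be t) j * gt t x v w)" for i j :: "'n option" and v w
  proof -
    have "lip_on {()} (\<lambda>t _. rescale 1 (be t) i)" for i :: "'n option"
      by (cases i) (simp_all add: rescale_def belip lip_on_const)
    then have "lip_on {()} (\<lambda>t _. rescale 1 (be t) i * rescale 1 (be t) j)"
      by (intro lip_on_mult)
    then show ?thesis
      by (intro d.lip_C1_mult entry_lip_C1 d.lip_C1_const_in_space)
  qed
  have detb: "vol_density (gb t) x = be t ^ ?n * vol_density (gt t) x" if tx: "\<bar>t\<bar> < \<epsilon>'" "x \<in> \<Omega>" for t x
  proof -
    have "gram (gb t) x = (\<chi> i j. rescale 1 (be t) i * rescale 1 (be t) j * gram (gt t) x $ i $ j)"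
      by (simp add: vec_eq_iff gram[OF tx]) (simp add: gram_def)
    then have "det (gram (gb t) x) = (be t ^ ?n)\<^sup>2 * det (gram (gt t) x)"
      by (simp add: det_diagonal_congruence prod_option rescale_def)
    then show ?thesis
      using be(1)[OF tx(1)] by (simp add: vol_density_def abs_mult real_sqrt_mult)
  qed
  have U: "x \<in> U" if "x \<in> \<Omega>" for x using that \<Omega>(5) by auto
  have "((\<lambda>t. J \<Omega> (gb t)) has_real_derivative 0) (at 0)"
  proof (rule rescaled_variation_stationary[OF \<epsilon>'(1,2) _ _ entryC1 gram detb be(2) lip_on_const belip _ _ _ be(1)])
    fix t x assume t: "\<bar>t\<bar> < \<epsilon>'" and x: "x \<in> \<Omega>"
    then have t': "\<bar>t\<bar> < \<epsilon>" using \<epsilon>' by simp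
    note bl = metric(1)[OF t' U[OF x]]
    have "A b (u + v) = A b u + A b v" "A b (c *\<^sub>R v) = c *\<^sub>R A b v" for b c u v
      by (simp_all add: A_def vec_eq_iff algebra_simps)
    then show "bilinear (gb t x)"
      unfolding bilinear_def gb[OF t U[OF x]]
      by (auto intro!: linearI simp: bilinear_ladd[OF bl] bilinear_radd[OF bl] bilinear_lmul[OF bl]
          bilinear_rmul[OF bl])
    show "gb t x v w = gb t x w v" for v w
      by (simp add: gb[OF t U[OF x]] metric(2)[OF t' U[OF x], of "A (be t) v"])
  next
    fix t x assume t: "\<bar>t\<bar> < \<epsilon>'" and xK: "x \<in> \<Omega> - supp_set t"
    then have t': "\<bar>t\<bar> < \<epsilon>" and x: "x \<in> \<Omega>" using \<epsilon>' by auto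
    have h: "gt t x = ?g x" by (rule supp_set(3)[OF t' xK])
    show "gb t x = model y 1 (be t) x"
      by (intro ext) (simp add: gb[OF t U[OF x]] h model_def sum_option rescale_def A_def power2_eq_square mult_ac)
  qed (simp_all add: be_def ratio_0)
  then show ?thesis by (simp add: gb_def)
qed

end

section \<open>The model metric in the form required by the theorem\<close>

lemma pderiv_line:
  assumes "f differentiable (at x)"
  shows "((\<lambda>s. f (x + s *\<^sub>R axis i 1)) has_real_derivative pderiv f i x) (at 0)"
proof -
  have P: "((\<lambda>s. x + s *\<^sub>R axis i 1) has_derivative (\<lambda>r. r *\<^sub>R axis i 1)) (at 0)"
    by (auto intro!: derivative_eq_intros)
  have "(f has_derivative frechet_derivative f (at x)) (at (x + 0 *\<^sub>R axis i 1))"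
    using assms by (simp add: frechet_derivative_works)
  from diff_chain_at[OF P this]
  have "((\<lambda>s. f (x + s *\<^sub>R axis i 1)) has_derivative (\<lambda>r. frechet_derivative f (at x) (r *\<^sub>R axis i 1))) (at 0)"
    by (simp add: o_def)
  moreover have "(\<lambda>r. frechet_derivative f (at x) (r *\<^sub>R axis i 1)) = (*) (pderiv f i x)"
    by (intro ext) (simp add: pderiv_def linear_scale[OF linear_frechet_derivative[OF assms]])
  ultimately show ?thesis
    by (simp add: has_field_derivative_def)
qed

context model_params
begin

lemma adapted_metric_model: "adapted_metric U (model y \<alpha> \<beta> :: 'n tensor2)"
proof -
  have "nondegenerate_on UNIV (model y \<alpha> \<beta> x)" for x :: "'n point"
    unfolding nondegenerate_on_def
  proof (intro ballI impI bexI)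
    fix v :: "'n point" assume "v \<noteq> 0"
    then obtain \<mu> where "v $ \<mu> \<noteq> 0" by (auto simp: vec_eq_iff)
    then have "0 < (\<theta> \<mu> x)\<^sup>2 * (v $ \<mu>)\<^sup>2"
      by (intro mult_pos_pos) (simp_all add: zero_less_power2)
    then have "0 < (\<theta> \<mu> x)\<^sup>2 * v $ \<mu> * v $ \<mu>"
      by (simp add: power2_eq_square mult.assoc)
    then have "0 < (\<Sum>\<mu>\<in>UNIV. (\<theta> \<mu> x)\<^sup>2 * v $ \<mu> * v $ \<mu>)"
      by (intro sum_pos2[of UNIV \<mu>]) (auto simp: mult.assoc)
    then show "model y \<alpha> \<beta> x v v \<noteq> 0" by (simp add: model_def)
  qed simp
  then show ?thesis
    unfolding adapted_metric_def pseudo_metric_def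
    using bilin sym leaf_nondegenerate smooth_on_mono[OF smooth] by blast
qed

lemma orthogonal_coordinates_model: "orthogonal_coordinates U (model y \<alpha> \<beta> :: 'n tensor2)"
proof -
  have "model y \<alpha> \<beta> x (axis \<mu> 1) (axis \<nu> 1) = 0" if "\<mu> \<noteq> \<nu>" for \<mu> \<nu> and x :: "'n point"
    using gram_model_component[of x \<mu> \<nu>] that by (simp add: gram_def)
  then show ?thesis by (simp add: orthogonal_coordinates_def)
qed

end

text \<open>With F = ln esum the factor exp (- 2 F) is the reciprocal square of esum; the square of
  X_i supplies the factor exp (2 x_i) of f_i.\<close>

lemma model_eq:
  fixes x v w :: "'n::finite point"
  assumes "y \<noteq> 0"
  shows "model y 1 1 x v w = (theta y None x)\<^sup>2 * v $ None * w $ None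
    + (\<Sum>i\<in>UNIV. 1 * (exp (2 * leaf_coords x $ i) / y\<^sup>2) * exp (- 2 * ln (esum y x)) * v $ Some i * w $ Some i)"
proof -
  have "exp (- 2 * ln (esum y x)) = 1 / (esum y x)\<^sup>2"
    using esum_pos[of y x] by (simp add: exp_minus exp_double inverse_eq_divide)
  moreover have "(theta y (Some i) x)\<^sup>2 = exp (2 * leaf_coords x $ i) / y\<^sup>2 * (1 / (esum y x)\<^sup>2)" for i
    by (simp add: theta_def cexp_def leaf_coords_def power_divide power_mult_distrib exp_double)
  ultimately show ?thesis
    by (simp add: model_def sum_option rescale_def)
qed

text \<open>The x_0-derivative of ln esum is sgn y times X_0 / esum, while
  \<open>theta y None\<close> is X_0 divided by esum and the absolute value of y.\<close>

lemma antiderivative_ln_esum: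
  fixes U :: "'n::finite point set"
  assumes "y \<noteq> 0"
  shows "antiderivative_x0 U (\<lambda>x. sqrt \<bar>(theta y None x)\<^sup>2\<bar> * y) (\<lambda>x. ln (esum y x))"
  unfolding antiderivative_x0_def
proof
  fix x assume "x \<in> U"
  have "((\<lambda>s. ln (esum y (x + s *\<^sub>R axis None 1))) has_real_derivative
      inverse (esum y (x + 0 *\<^sub>R axis None 1)) * pderiv (esum y) None x) (at 0)"
    by (rule DERIV_chain2[OF DERIV_ln[OF esum_pos] pderiv_line[OF esum_diff]])
  moreover have "theta y None x > 0" using assms by (simp add: theta_def)
  then have "inverse (esum y (x + 0 *\<^sub>R axis None 1)) * pderiv (esum y) None x
      = sqrt \<bar>(theta y None x)\<^sup>2\<bar> * y"
    using assms by (cases "y > 0") (simp_all add: pderiv_esum, simp_all add: theta_def field_simps)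
  ultimately show "((\<lambda>s. ln (esum y (x + s *\<^sub>R axis None 1))) has_real_derivative
      sqrt \<bar>(theta y None x)\<^sup>2\<bar> * y) (at 0)"
    by simp
qed

lemma mean_divergence_model:
  fixes \<Omega> :: "'n::finite point set"
  assumes "y \<noteq> 0" "open_rel_compact U \<Omega>"
  shows "mean_value (divergence (model y 1 1) (H_tilde (model y 1 1))) \<Omega> (model y 1 1) = - ((real CARD('n) * y)\<^sup>2)"
proof -
  interpret m: model_params y 1 1 "TYPE('n)" using assms(1) by unfold_locales auto
  have "integral_vol (model y 1 1) \<Omega> (divergence (model y 1 1) (H_tilde (model y 1 1)))
      = (LINT x:\<Omega>|lborel. - ((real CARD('n) * y)\<^sup>2) * vol_density (model y 1 1) x)"
    by (simp add: integral_vol_eq m.divergence_H_tilde_model)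
  also have "\<dots> = - ((real CARD('n) * y)\<^sup>2) * Vol \<Omega> (model y 1 1)"
    by (simp only: set_integral_mult_right Vol_def integral_vol_eq mult_1)
  finally show ?thesis
    using Vol_model_pos[OF assms] by (simp add: mean_value_def)
qed

lemma critical_model:
  fixes U :: "'n::finite point set"
  assumes "y \<noteq> 0" "open U" "open_rel_compact U \<Omega>"
  shows "critical_bar_perp U \<Omega> (model y 1 1)" "critical_bar_top U \<Omega> (model y 1 1)"
proof -
  show "critical_bar_perp U \<Omega> (model y 1 1)"
    unfolding critical_bar_perp_def
  proof (intro allI impI)
    fix \<epsilon> gt assume v: "perp_variation U (model y 1 1) \<epsilon> gt \<and> supported_in U (model y 1 1) \<epsilon> gt \<Omega>"
    then interpret model_variation y \<epsilon> U \<Omega> gt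
      using assms by unfold_locales (auto simp: perp_variation_def)
    show "((\<lambda>t. J \<Omega> (bar_perp \<Omega> (model y 1 1) (gt t))) has_real_derivative 0) (at 0)"
      by (rule bar_perp_stationary) (use v in \<open>auto simp: perp_variation_def\<close>)
  qed
  show "critical_bar_top U \<Omega> (model y 1 1)"
    unfolding critical_bar_top_def
  proof (intro allI impI)
    fix \<epsilon> gt assume v: "top_variation U (model y 1 1) \<epsilon> gt \<and> supported_in U (model y 1 1) \<epsilon> gt \<Omega>"
    then interpret model_variation y \<epsilon> U \<Omega> gt
      using assms by unfold_locales (auto simp: top_variation_def)
    show "((\<lambda>t. J \<Omega> (bar_top \<Omega> (model y 1 1) (gt t))) has_real_derivative 0) (at 0)"
      by (rule bar_top_stationary) (use v in \<open>auto simp: top_variation_def\<close>)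
  qed
qed

theorem proposition2p11:
  fixes U :: "'n::finite point set" and C y :: real
  assumes "biregular_domain U"
    and "C < 0"
    and "y = sqrt \<bar>C\<bar> / real CARD('n) \<or> y = - (sqrt \<bar>C\<bar> / real CARD('n))"
  shows "\<exists>(g :: 'n tensor2) (g00 :: 'n point \<Rightarrow> real) (F :: 'n point \<Rightarrow> real)
            (\<epsilon> :: 'n \<Rightarrow> real) (f :: 'n \<Rightarrow> real ^ 'n \<Rightarrow> real).
      smooth_on U g00 \<and> ((\<forall>x\<in>U. g00 x > 0) \<or> (\<forall>x\<in>U. g00 x < 0)) \<and>
      antiderivative_x0 U (\<lambda>x. sqrt \<bar>g00 x\<bar> * y) F \<and>
      (\<forall>i. \<epsilon> i \<in> {-1, 1}) \<and>
      (\<forall>i. smooth_on (leaf_coords ` U) (f i) \<and> (\<forall>z\<in>leaf_coords ` U. f i z > 0)) \<and>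
      (\<forall>x\<in>U. \<forall>v w. g x v w =
         g00 x * v $ None * w $ None
         + (\<Sum>i\<in>UNIV. \<epsilon> i * f i (leaf_coords x) * exp (- 2 * F x) * v $ Some i * w $ Some i)) \<and>
      adapted_metric U g \<and> orthogonal_coordinates U g \<and>
      (\<forall>\<Omega>. open_rel_compact U \<Omega> \<longrightarrow>
         mean_value (divergence g (H_tilde g)) \<Omega> g = C \<and>
         critical_bar_perp U \<Omega> g \<and> critical_bar_top U \<Omega> g)"
proof -
  let ?n = "real CARD('n)"
  have "y \<noteq> 0" using assms(2,3) by auto
  interpret m: model_params y 1 1 "TYPE('n)" using \<open>y \<noteq> 0\<close> by unfold_locales auto
  have U: "open U" using assms(1) by (simp add: biregular_domain_def)
  \<comment> \<open>The divergence of H-tilde is the constant - (n y)^2, which is why the absolute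
    value of y is \<open>sqrt \<bar>C\<bar>\<close> divided by n.\<close>
  have C: "- ((?n * y)\<^sup>2) = C"
    using assms(2,3) by (auto simp: power_mult_distrib power_divide)
  show ?thesis
  proof (rule exI[of _ "model y 1 1"], rule exI[of _ "\<lambda>x. (theta y None x)\<^sup>2"],
      rule exI[of _ "\<lambda>x. ln (esum y x)"], rule exI[of _ "\<lambda>_. 1"],
      rule exI[of _ "\<lambda>i z. exp (2 * z $ i) / y\<^sup>2"], intro conjI)
    show "smooth_on U (\<lambda>x. (theta y None x)\<^sup>2)"
      by (rule smooth_on_mono[OF smooth_on_power[OF open_UNIV m.theta_smooth]]) simp
    show "(\<forall>x\<in>U. (theta y None x)\<^sup>2 > 0) \<or> (\<forall>x\<in>U. (theta y None x)\<^sup>2 < 0)"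
      by simp
    show "antiderivative_x0 U (\<lambda>x. sqrt \<bar>(theta y None x)\<^sup>2\<bar> * y) (\<lambda>x. ln (esum y x))"
      by (rule antiderivative_ln_esum[OF \<open>y \<noteq> 0\<close>])
    show "\<forall>i. (1::real) \<in> {- 1, 1}" by simp
    have "smooth_on UNIV (\<lambda>z :: real ^ 'n. exp (2 * z $ i) / y\<^sup>2)" for i
      using \<open>y \<noteq> 0\<close>
      by (intro smooth_on_divide smooth_on_exp smooth_on_mult smooth_on_const smooth_on_component open_UNIV) simp
    then show "\<forall>i. smooth_on (leaf_coords ` U) (\<lambda>z. exp (2 * z $ i) / y\<^sup>2) \<and>
        (\<forall>z\<in>leaf_coords ` U. exp (2 * z $ i) / y\<^sup>2 > 0)"
      using \<open>y \<noteq> 0\<close> smooth_on_mono[OF _ subset_UNIV] by auto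
    show "\<forall>x\<in>U. \<forall>v w. model y 1 1 x v w = (theta y None x)\<^sup>2 * v $ None * w $ None
        + (\<Sum>i\<in>UNIV. 1 * (exp (2 * leaf_coords x $ i) / y\<^sup>2) * exp (- 2 * ln (esum y x)) * v $ Some i * w $ Some i)"
      using model_eq[OF \<open>y \<noteq> 0\<close>] by blast
    show "adapted_metric U (model y 1 1)" by (rule m.adapted_metric_model)
    show "orthogonal_coordinates U (model y 1 1)" by (rule m.orthogonal_coordinates_model)
    show "\<forall>\<Omega>. open_rel_compact U \<Omega> \<longrightarrow>
        mean_value (divergence (model y 1 1) (H_tilde (model y 1 1))) \<Omega> (model y 1 1) = C \<and>
        critical_bar_perp U \<Omega> (model y 1 1) \<and> critical_bar_top U \<Omega> (model y 1 1)"
      using mean_divergence_model[OF \<open>y \<noteq> 0\<close>] critical_model[OF \<open>y \<noteq> 0\<close> U] C by auto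
  qed
qed

end
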